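(* Let $P$ be a $2$-dimensional polyhedral space. Then there exists a piecewise distance-preserving map $f\colon P\to\mathbb{R}^2$, where $\mathbb{R}^2$ is the Euclidean plane with its standard metric.
   Context: Metrics take finite values; $|x-y|_X$ denotes the distance in a metric space $X$. A map $f\colon X\to Y$ of metric spaces is distance-preserving if $|f(x)-f(x')|_Y=|x-x'|_X$ for all $x,x'\in X$; an isometry is a distance-preserving bijection. The length of a curve (continuous map) $\alpha\colon\mathbb{I}\to X$ on a real interval $\mathbb{I}$ is the supremum of $\sum_{i=1}^k|\alpha(t_{i-1})-\alpha(t_i)|_X$ over all $k\geq 1$ and all $t_0<\dots<t_k$ in $\mathbb{I}$. A metric space $X$ is a length space if for any $x,y\in X$ and any $\varepsilon>0$ there is a curve from $x$ to $y$ of length less than $|x-y|_X+\varepsilon$. A simplicial complex $\mathcal K$ is a finite collection of (Euclidean, non-degenerate) simplices in some $\mathbb{R}^n$ that contains all faces of its simplices and such that any two of its simplices intersect in the empty set or in a common face; $|\mathcal K|\subset\mathbb{R}^n$ is the union of its simplices. A triangulation of a metric space $X$ is a simplicial complex $\mathcal K$ together with a homeomorphism $|\mathcal K|\to X$; the images of simplices of $\mathcal K$ are called the simplices of the triangulation. A polyhedral space is a length space that admits a triangulation such that each of its simplices is isometric to a simplex in Euclidean space; "triangulation" of a polyhedral space always means a triangulation of this kind. The dimension of a polyhedral space is the maximal dimension of the simplices in its triangulation (not every simplex need be a face of a simplex of maximal dimension). A map $f\colon P\to\mathbb{R}^n$ from a polyhedral space $P$ is piecewise distance-preserving if there is a triangulation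 of $P$ such that for every simplex $\Delta$ of the triangulation the restriction $f|_\Delta$ is distance-preserving. *)

theory Defs
  imports "HOL-Analysis.Analysis"
begin

text \<open>
  The Euclidean spaces of all dimensions are kept inside one inner product space, the
  space of finitely supported real sequences, so that ``some Euclidean space'' can be
  expressed by an existential quantifier over the natural number \<open>n\<close>.
\<close>

typedef rinf = "{x :: nat \<Rightarrow> real. finite {i. x i \<noteq> 0}}"
  morphisms coord Abs_rinf
  by (rule exI [of _ "\<lambda>_. 0"]) simp

setup_lifting type_definition_rinf

lemma finite_coord: "finite {i. coord x i \<noteq> 0}"
  using coord [of x] by simp

lemma rinf_eqI: "(\<And>i. coord x i = coord y i) \<Longrightarrow> x = y"
  by (metis coord_inject ext)

instantiation rinf :: real_vector
begin

lift_definition zero_rinf :: rinf is "\<lambda>_. 0" by simp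

lift_definition plus_rinf :: "rinf \<Rightarrow> rinf \<Rightarrow> rinf" is "\<lambda>x y i. x i + y i"
proof -
  fix x y :: "nat \<Rightarrow> real"
  assume "finite {i. x i \<noteq> 0}" "finite {i. y i \<noteq> 0}"
  then show "finite {i. x i + y i \<noteq> 0}"
    by - (rule finite_subset [of _ "{i. x i \<noteq> 0} \<union> {i. y i \<noteq> 0}"], auto)
qed

lift_definition minus_rinf :: "rinf \<Rightarrow> rinf \<Rightarrow> rinf" is "\<lambda>x y i. x i - y i"
proof -
  fix x y :: "nat \<Rightarrow> real"
  assume "finite {i. x i \<noteq> 0}" "finite {i. y i \<noteq> 0}"
  then show "finite {i. x i - y i \<noteq> 0}"
    by - (rule finite_subset [of _ "{i. x i \<noteq> 0} \<union> {i. y i \<noteq> 0}"], auto)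
qed

lift_definition uminus_rinf :: "rinf \<Rightarrow> rinf" is "\<lambda>x i. - x i" by simp

lift_definition scaleR_rinf :: "real \<Rightarrow> rinf \<Rightarrow> rinf" is "\<lambda>c x i. c * x i"
proof -
  fix c :: real and x :: "nat \<Rightarrow> real"
  assume "finite {i. x i \<noteq> 0}"
  then show "finite {i. c * x i \<noteq> 0}"
    by (rule rev_finite_subset) auto
qed

lemma coord_simps [simp]:
  "coord 0 i = 0"
  "coord (x + y) i = coord x i + coord y i"
  "coord (x - y) i = coord x i - coord y i"
  "coord (- x) i = - coord x i"
  "coord (c *\<^sub>R x) i = c * coord x i"
  by (simp_all add: zero_rinf.rep_eq plus_rinf.rep_eq minus_rinf.rep_eq uminus_rinf.rep_eq
      scaleR_rinf.rep_eq)

instance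
proof
  fix x y z :: rinf and a b :: real
  show "x + y + z = x + (y + z)" "x + y = y + x" "0 + x = x" "- x + x = 0" "x - y = x + - y"
    "a *\<^sub>R (x + y) = a *\<^sub>R x + a *\<^sub>R y" "(a + b) *\<^sub>R x = a *\<^sub>R x + b *\<^sub>R x"
    "a *\<^sub>R b *\<^sub>R x = (a * b) *\<^sub>R x" "1 *\<^sub>R x = x"
    by (rule rinf_eqI, simp add: algebra_simps)+
qed

end

instantiation rinf :: real_inner
begin

definition inner_rinf :: "rinf \<Rightarrow> rinf \<Rightarrow> real"
  where "inner_rinf x y = (\<Sum>i | coord x i \<noteq> 0. coord x i * coord y i)"

definition norm_rinf :: "rinf \<Rightarrow> real"
  where "norm_rinf x = sqrt (inner x x)"

definition sgn_rinf :: "rinf \<Rightarrow> rinf"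
  where "sgn_rinf x = x /\<^sub>R norm x"

definition dist_rinf :: "rinf \<Rightarrow> rinf \<Rightarrow> real"
  where "dist_rinf x y = norm (x - y)"

definition uniformity_rinf :: "(rinf \<times> rinf) filter"
  where "uniformity_rinf = (INF e\<in>{0<..}. principal {(x, y). dist x y < e})"

definition open_rinf :: "rinf set \<Rightarrow> bool"
  where "open_rinf U \<longleftrightarrow> (\<forall>x\<in>U. \<forall>\<^sub>F (x', y) in uniformity. x' = x \<longrightarrow> y \<in> U)"

lemma inner_rinf_superset:
  assumes "finite A" "{i. coord x i \<noteq> 0} \<subseteq> A"
  shows "inner x y = (\<Sum>i\<in>A. coord x i * coord y i)"
  unfolding inner_rinf_def using assms by (intro sum.mono_neutral_left) auto

instance
proof
  fix x y z :: rinf and r :: real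
  define A where "A = {i. coord x i \<noteq> 0} \<union> {i. coord y i \<noteq> 0}"
  have A: "finite A" "{i. coord x i \<noteq> 0} \<subseteq> A" "{i. coord y i \<noteq> 0} \<subseteq> A"
    "{i. coord (x + y) i \<noteq> 0} \<subseteq> A" "{i. coord (r *\<^sub>R x) i \<noteq> 0} \<subseteq> A"
    by (auto simp: A_def finite_coord)
  note sums = A(2-5) [THEN inner_rinf_superset [OF A(1)]]
  show "inner x y = inner y x"
    by (simp add: sums mult.commute)
  show "inner (x + y) z = inner x z + inner y z"
    unfolding sums by (simp add: algebra_simps sum.distrib)
  show "inner (r *\<^sub>R x) y = r * inner x y"
    unfolding sums by (simp add: sum_distrib_left mult.assoc)
  show "0 \<le> inner x x"
    by (simp add: inner_rinf_def sum_nonneg)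
  show "inner x x = 0 \<longleftrightarrow> x = 0"
  proof
    assume "inner x x = 0"
    then have "\<forall>i\<in>{i. coord x i \<noteq> 0}. coord x i * coord x i = 0"
      unfolding inner_rinf_def
      by (subst (asm) sum_nonneg_eq_0_iff) (auto simp: finite_coord)
    then show "x = 0"
      by (intro rinf_eqI) auto
  qed (simp add: inner_rinf_def)
qed (simp_all only: norm_rinf_def sgn_rinf_def dist_rinf_def uniformity_rinf_def open_rinf_def)

end

definition R_space :: "nat \<Rightarrow> rinf set"
  where "R_space n = {x. \<forall>i\<ge>n. coord x i = 0}"

lemma dist_R_space:
  assumes "x \<in> R_space n" "y \<in> R_space n"
  shows "dist x y = sqrt (\<Sum>i<n. (coord x i - coord y i)\<^sup>2)"
proof -
  have "{i. coord (x - y) i \<noteq> 0} \<subseteq> {..<n}"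
    using assms by (auto simp: R_space_def) (metis diff_self not_less)
  then show ?thesis
    unfolding dist_rinf_def norm_rinf_def
    by (subst inner_rinf_superset [of "{..<n}"]) (simp_all add: power2_eq_square)
qed


definition distance_preserving_on :: "'a::metric_space set \<Rightarrow> ('a \<Rightarrow> 'b::metric_space) \<Rightarrow> bool"
  where "distance_preserving_on S f \<longleftrightarrow> (\<forall>x\<in>S. \<forall>y\<in>S. dist (f x) (f y) = dist x y)"

definition isometric :: "'a::metric_space set \<Rightarrow> 'b::metric_space set \<Rightarrow> bool"
  where "isometric S T \<longleftrightarrow> (\<exists>f. distance_preserving_on S f \<and> bij_betw f S T)"

text \<open>The supremum is taken in \<open>[0,\<infinity>]\<close>, so a curve on a one-point interval has length 0.\<close>

definition curve_length :: "real set \<Rightarrow> (real \<Rightarrow> 'a::metric_space) \<Rightarrow> ennreal"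
  where "curve_length I \<alpha> =
    (SUP (k, t) \<in> {(k :: nat, t :: nat \<Rightarrow> real).
        k \<ge> 1 \<and> (\<forall>i\<le>k. t i \<in> I) \<and> strict_mono_on {..k} t}.
      ennreal (\<Sum>i = 1..k. dist (\<alpha> (t (i - 1))) (\<alpha> (t i))))"

definition length_space :: "'a::metric_space set \<Rightarrow> bool"
  where "length_space X \<longleftrightarrow>
    (\<forall>x\<in>X. \<forall>y\<in>X. \<forall>\<epsilon>>0. \<exists>a b \<alpha>. a \<le> b \<and> continuous_on {a..b} \<alpha> \<and> \<alpha> ` {a..b} \<subseteq> X \<and>
      \<alpha> a = x \<and> \<alpha> b = y \<and> curve_length {a..b} \<alpha> < ennreal (dist x y + \<epsilon>))"


text \<open>
  The library's \<open>simplex\<close> and \<open>simplicial_complex\<close> require a type of class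
  \<open>euclidean_space\<close>, that is, an ambient dimension fixed by the type. Below, simplices are
  non-empty, so the empty face is not a member of a complex.
\<close>

definition simplex_in :: "nat \<Rightarrow> nat \<Rightarrow> rinf set \<Rightarrow> bool"
  where "simplex_in n k S \<longleftrightarrow>
    (\<exists>V. V \<subseteq> R_space n \<and> finite V \<and> card V = k + 1 \<and> \<not> affine_dependent V \<and> S = convex hull V)"

definition simplicial_complex_in :: "nat \<Rightarrow> rinf set set \<Rightarrow> bool"
  where "simplicial_complex_in n K \<longleftrightarrow>
    finite K \<and>
    (\<forall>S\<in>K. \<exists>k. simplex_in n k S) \<and>
    (\<forall>S\<in>K. \<forall>F. F face_of S \<and> F \<noteq> {} \<longrightarrow> F \<in> K) \<and>
    (\<forall>S\<in>K. \<forall>T\<in>K. S \<inter> T = {} \<or> S \<inter> T face_of S \<and> S \<inter> T face_of T)"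

definition triangulation_of :: "'a::metric_space set \<Rightarrow> rinf set set \<Rightarrow> (rinf \<Rightarrow> 'a) \<Rightarrow> bool"
  where "triangulation_of X K h \<longleftrightarrow>
    (\<exists>n. simplicial_complex_in n K) \<and> (\<exists>g. homeomorphism (\<Union>K) X h g)"

definition polyhedral_triangulation_of ::
    "'a::metric_space set \<Rightarrow> rinf set set \<Rightarrow> (rinf \<Rightarrow> 'a) \<Rightarrow> bool"
  where "polyhedral_triangulation_of X K h \<longleftrightarrow>
    triangulation_of X K h \<and>
    (\<forall>S\<in>K. \<exists>n k T. simplex_in n k T \<and> isometric (h ` S) T)"

definition polyhedral_space :: "'a::metric_space set \<Rightarrow> bool"
  where "polyhedral_space P \<longleftrightarrow> length_space P \<and> (\<exists>K h. polyhedral_triangulation_of P K h)"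

definition complex_has_dim :: "rinf set set \<Rightarrow> nat \<Rightarrow> bool"
  where "complex_has_dim K d \<longleftrightarrow>
    (\<exists>S\<in>K. \<exists>n. simplex_in n d S) \<and> (\<forall>S\<in>K. \<forall>n k. simplex_in n k S \<longrightarrow> k \<le> d)"

definition polyhedral_space_of_dim :: "nat \<Rightarrow> 'a::metric_space set \<Rightarrow> bool"
  where "polyhedral_space_of_dim d P \<longleftrightarrow>
    polyhedral_space P \<and> (\<exists>K h. polyhedral_triangulation_of P K h \<and> complex_has_dim K d)"

definition piecewise_distance_preserving ::
    "'a::metric_space set \<Rightarrow> ('a \<Rightarrow> 'b::euclidean_space) \<Rightarrow> bool"
  where "piecewise_distance_preserving P f \<longleftrightarrow>
    (\<exists>K h. polyhedral_triangulation_of P K h \<and> (\<forall>S\<in>K. distance_preserving_on (h ` S) f))"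

end

(* Proof idea. Choose finitely many sites on the edges of the triangulation, among them all vertices,
   so fine that the midpoint of two neighbouring sites on an edge has no site of the space closer to it
   than these two. Develop each triangle into the plane. There the sites can be inserted one by one to
   obtain a piecewise isometric map F of the plane with |F z| = dist(z, sites) that is linear on the
   segments from a site to the points of its Voronoi cell. Each edge is a union of segments from a site
   to a midpoint, and F maps such a segment isometrically into a ray from the origin. Folding finitely
   many rays onto the first coordinate axis gives a map whose value on an edge is (dist to the nearest
   site, 0). It does not depend on the triangle, so the maps of the triangles fit together. All folds
   are hyperplanes of the developed triangles; realizing the complex in five-dimensional space by
   points of the moment curve, one extends them to hyperplanes of that space and subdivides. *)

theory Submission
  imports Defs
begin

section \<open>Piecewise isometric maps of Euclidean spaces\<close>

text \<open>The triangulating homeomorphism is only topological. It need not be affine in the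
  Euclidean models of the simplices, so hyperplanes of a model cannot be pulled back along it; this
  is why the complex is rebuilt from its vertices. Nor is it given that the vertices of a simplex go
  to the corners of its model: invariance of dimension bounds the number of corners, and
  connectedness arguments match them with the vertices, using that the edges are themselves
  isometric to Euclidean simplices. Five dimensions suffice because two triangles have at most six
  vertices, and hulls of subsets of an affinely independent set meet exactly in the hull of the
  common points. The obstacle in folding is that the maps of two triangles must agree on a shared
  edge although each triangle sees different sites. Hence the comparison with all sites of the
  space: a nearest site on the edge is then nearest in both triangles, and the distance to it is
  intrinsic. Pieces are described by finite lists of hyperplanes instead of cells, because
  composition and refinement only lengthen such a list.\<close>

definition same_side :: "('a::real_inner \<times> real) set \<Rightarrow> 'a \<Rightarrow> 'a \<Rightarrow> bool" where
  "same_side L x y \<longleftrightarrow>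
    (\<forall>(n, \<beta>)\<in>L. n \<bullet> x \<le> \<beta> \<and> n \<bullet> y \<le> \<beta> \<or> \<beta> \<le> n \<bullet> x \<and> \<beta> \<le> n \<bullet> y)"

text \<open>A condition on pairs of points, so \<open>L\<close> may be enlarged freely. The
  half-spaces are closed: points close to \<open>x\<close> are on the same side as \<open>x\<close>,
  which makes such maps continuous. Hyperplane subdivisions of cells deliver their pieces in the
  same form.\<close>

definition piecewise_isometric :: "('a::real_inner \<Rightarrow> 'b::metric_space) \<Rightarrow> bool" where
  "piecewise_isometric F \<longleftrightarrow>
    (\<exists>L. finite L \<and> (\<forall>x y. same_side L x y \<longrightarrow> dist (F x) (F y) = dist x y))"

lemma same_sideD:
  "same_side L x y \<Longrightarrow> (n, \<beta>) \<in> L \<Longrightarrow>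
    n \<bullet> x \<le> \<beta> \<and> n \<bullet> y \<le> \<beta> \<or> \<beta> \<le> n \<bullet> x \<and> \<beta> \<le> n \<bullet> y"
  by (auto simp: same_side_def)

lemma same_side_mono: "same_side L x y \<Longrightarrow> L' \<subseteq> L \<Longrightarrow> same_side L' x y"
  by (auto simp: same_side_def)

section \<open>Isometries on subsets and affine maps\<close>

lemma inner_eq_if_dist_eq:
  fixes a b :: "'a::real_inner" and a' b' :: "'b::real_inner"
  assumes "norm a = norm a'" "norm b = norm b'" "dist a b = dist a' b'"
  shows "a \<bullet> b = a' \<bullet> b'"
proof -
  have "(norm (a - b))\<^sup>2 = (norm (a' - b'))\<^sup>2"
    using assms(3) by (simp add: dist_norm)
  moreover have "(norm a)\<^sup>2 = (norm a')\<^sup>2" "(norm b)\<^sup>2 = (norm b')\<^sup>2"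
    using assms by auto
  ultimately show ?thesis
    unfolding power2_norm_eq_inner by (simp add: inner_diff inner_commute)
qed

lemma norm2_combination:
  fixes a b :: "'a::real_inner"
  shows "(norm (s *\<^sub>R a - t *\<^sub>R b))\<^sup>2 =
    s\<^sup>2 * (norm a)\<^sup>2 - 2 * s * t * (a \<bullet> b) + t\<^sup>2 * (norm b)\<^sup>2"
  unfolding power2_norm_eq_inner
  by (simp add: inner_diff_left inner_diff_right inner_commute power2_eq_square algebra_simps)

lemma norm_combination_eq:
  fixes a b :: "'a::real_inner" and a' b' :: "'b::real_inner"
  assumes "norm a = norm a'" "norm b = norm b'" "a \<bullet> b = a' \<bullet> b'"
  shows "norm (s *\<^sub>R a - t *\<^sub>R b) = norm (s *\<^sub>R a' - t *\<^sub>R b')"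
proof -
  have "(norm (s *\<^sub>R a - t *\<^sub>R b))\<^sup>2 = (norm (s *\<^sub>R a' - t *\<^sub>R b'))\<^sup>2"
    unfolding norm2_combination using assms by simp
  then show ?thesis by simp
qed

text \<open>After a point of \<open>D\<close> is moved to the origin, \<open>F\<close> preserves
  inner products, so a linear map fitted on a maximal independent set of differences fits
  everywhere. As \<open>D\<close> is arbitrary, this serves for cells as well as for changes of
  charts.\<close>

lemma isometric_imp_affine:
  fixes F :: "'a::euclidean_space \<Rightarrow> 'b::real_inner"
  assumes F: "\<And>x y. x \<in> D \<Longrightarrow> y \<in> D \<Longrightarrow> dist (F x) (F y) = dist x y"
  obtains h c where "linear h" "\<And>x. x \<in> D \<Longrightarrow> F x = h x + c"
proof (cases "D = {}")
  case True
  then show ?thesis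
    using that [of "\<lambda>_. 0" 0] by (simp add: linear_zero)
next
  case False
  then obtain p where p: "p \<in> D" by auto
  define N where "N = (\<lambda>x. x - p) ` D"
  define g where "g w = F (w + p) - F p" for w
  have norm_g: "norm (g w) = norm w" if "w \<in> N" for w
    using that F p unfolding N_def g_def by (auto simp: dist_norm)
  have dist_g: "dist (g w) (g v) = dist w v" if "w \<in> N" "v \<in> N" for w v
    using that F p unfolding N_def g_def by (auto simp: dist_norm)
  have inner_g: "g w \<bullet> g v = w \<bullet> v" if "w \<in> N" "v \<in> N" for w v
    using that by (intro inner_eq_if_dist_eq) (simp_all add: norm_g dist_g)
  obtain B where B: "B \<subseteq> N" "independent B" "N \<subseteq> span B"
    using maximal_independent_subset [of N] by auto
  have finB: "finite B"
    using B(2) independent_imp_finite by blast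
  obtain h where h: "linear h" "\<And>v. v \<in> B \<Longrightarrow> h v = g v"
    using linear_independent_extend [OF B(2), of g] by auto
  have "h w = g w" if w: "w \<in> N" for w
  proof -
    obtain u where u: "w = (\<Sum>b\<in>B. u b *\<^sub>R b)"
      using w B(3) span_finite [OF finB] by auto
    \<comment> \<open>The defect of linearity. It is orthogonal to every \<open>g v\<close>, and
      being itself a combination of such vectors it vanishes.\<close>
    define z where "z = g w - (\<Sum>b\<in>B. u b *\<^sub>R g b)"
    have zg: "z \<bullet> g v = 0" if v: "v \<in> N" for v
    proof -
      have "z \<bullet> g v = g w \<bullet> g v - (\<Sum>b\<in>B. u b * (g b \<bullet> g v))"
        by (simp add: z_def inner_diff_left inner_sum_left)
      also have "\<dots> = w \<bullet> v - (\<Sum>b\<in>B. u b * (b \<bullet> v))"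
        using inner_g w v B(1) by (auto intro!: sum.cong)
      also have "\<dots> = 0"
        by (subst u) (simp add: inner_sum_left)
      finally show ?thesis .
    qed
    have "z \<bullet> z = z \<bullet> g w - (\<Sum>b\<in>B. u b * (z \<bullet> g b))"
      by (subst (2) z_def) (simp add: inner_diff_right inner_sum_right)
    also have "\<dots> = 0"
      using zg w B(1) by (simp add: subset_iff)
    finally have "z = 0" by simp
    moreover have "h w = (\<Sum>b\<in>B. u b *\<^sub>R g b)"
      by (subst u) (simp add: linear_sum [OF h(1)] linear_scale [OF h(1)] h(2))
    ultimately show ?thesis
      by (simp add: z_def)
  qed
  then have "F x = h x + (F p - h p)" if "x \<in> D" for x
    using that h(1) unfolding N_def g_def by (force simp: linear_diff algebra_simps)
  then show ?thesis
    using that h(1) by blast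
qed

text \<open>The preimages, under the affine map \<open>h x + c\<close>, of the hyperplanes
  \<open>n \<bullet> y = \<beta>\<close> in \<open>L\<close>.\<close>

definition pull_back ::
    "('a::euclidean_space \<Rightarrow> 'b::euclidean_space) \<Rightarrow> 'b \<Rightarrow> ('b \<times> real) set \<Rightarrow> ('a \<times> real) set" where
  "pull_back h c L = (\<lambda>(n, \<beta>). (adjoint h n, \<beta> - n \<bullet> c)) ` L"

lemma finite_pull_back [simp]: "finite L \<Longrightarrow> finite (pull_back h c L)"
  by (simp add: pull_back_def)

lemma same_side_pull_back:
  assumes "linear h"
  shows "same_side (pull_back h c L) x y \<longleftrightarrow> same_side L (h x + c) (h y + c)"
proof -
  have "adjoint h n \<bullet> z = n \<bullet> h z" for n z
    using adjoint_works [OF assms, of z n] by (simp add: inner_commute)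
  then show ?thesis
    unfolding same_side_def pull_back_def
    by (simp add: case_prod_unfold inner_add_right algebra_simps)
qed

text \<open>On each cell of \<open>L\<close> the map \<open>F\<close> is affine, so the walls of
  \<open>G\<close> have hyperplanes as preimages there. These are added for all cells at once and
  extended over the whole space; the list stays finite because there are finitely many sign
  patterns.\<close>

lemma piecewise_isometric_compose:
  fixes F :: "'a::euclidean_space \<Rightarrow> 'b::euclidean_space" and G :: "'b \<Rightarrow> 'c::metric_space"
  assumes "piecewise_isometric F" "piecewise_isometric G"
  shows "piecewise_isometric (\<lambda>x. G (F x))"
proof -
  obtain L where L: "finite L" "\<And>x y. same_side L x y \<Longrightarrow> dist (F x) (F y) = dist x y"
    using assms(1) unfolding piecewise_isometric_def by blast
  obtain M where M: "finite M" "\<And>x y. same_side M x y \<Longrightarrow> dist (G x) (G y) = dist x y"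
    using assms(2) unfolding piecewise_isometric_def by blast
  \<comment> \<open>A sign pattern \<open>\<sigma>\<close> selects a closed cell. For an empty cell
    any affine map serves.\<close>
  define D where "D \<sigma> = {x. \<forall>(n, \<beta>)\<in>L. if (n, \<beta>) \<in> \<sigma> then n \<bullet> x \<le> \<beta> else \<beta> \<le> n \<bullet> x}" for \<sigma>
  have DL: "same_side L x y" if "x \<in> D \<sigma>" "y \<in> D \<sigma>" for x y \<sigma>
    using that unfolding D_def same_side_def by (fastforce split: if_splits)
  have "\<exists>h c. linear h \<and> (\<forall>x\<in>D \<sigma>. F x = h x + c)" for \<sigma>
    using isometric_imp_affine [of "D \<sigma>" F] DL L(2) by metis
  then obtain h c where hc: "\<And>\<sigma>. linear (h \<sigma>)" "\<And>\<sigma> x. x \<in> D \<sigma> \<Longrightarrow> F x = h \<sigma> x + c \<sigma>"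
    by metis
  define L' where "L' = L \<union> (\<Union>\<sigma>\<in>Pow L. pull_back (h \<sigma>) (c \<sigma>) M)"
  have "finite L'"
    unfolding L'_def using L(1) M(1) by auto
  moreover have "dist (G (F x)) (G (F y)) = dist x y" if s: "same_side L' x y" for x y
  proof -
    have sL: "same_side L x y"
      using s by (rule same_side_mono) (auto simp: L'_def)
    define \<sigma> where "\<sigma> = {(n, \<beta>)\<in>L. n \<bullet> x \<le> \<beta> \<and> n \<bullet> y \<le> \<beta>}"
    have D: "x \<in> D \<sigma>" "y \<in> D \<sigma>"
      using sL unfolding D_def \<sigma>_def same_side_def by auto
    have "\<sigma> \<in> Pow L" by (auto simp: \<sigma>_def)
    then have "same_side (pull_back (h \<sigma>) (c \<sigma>) M) x y"
      by (intro same_side_mono [OF s]) (auto simp: L'_def)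
    then have "same_side M (F x) (F y)"
      using same_side_pull_back [OF hc(1)] hc(2) D by metis
    then show ?thesis
      using M(2) L(2) sL by simp
  qed
  ultimately show ?thesis
    unfolding piecewise_isometric_def by blast
qed

text \<open>On the Voronoi cell of a site, \<open>F\<close> is a cone with apex at the site;
  \<open>t = 0\<close> sends the site to the origin. All nearest sites are quantified, so on a
  common wall the condition holds for both cells, which is what allows the insertion of a further
  site.\<close>

definition cone_fold :: "'a::real_inner set \<Rightarrow> ('a \<Rightarrow> 'a) \<Rightarrow> bool" where
  "cone_fold A F \<longleftrightarrow> (\<forall>z. \<forall>a\<in>A. (\<forall>a'\<in>A. dist z a \<le> dist z a') \<longrightarrow>
     norm (F z) = dist z a \<and> (\<forall>t\<in>{0..1}. F (a + t *\<^sub>R (z - a)) = t *\<^sub>R F z))"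

text \<open>The corners of a large cube serve as additional sites that make all Voronoi cells bounded.\<close>

definition corners :: "real \<Rightarrow> 'a::euclidean_space set" where
  "corners B = {c. \<forall>i\<in>Basis. \<bar>c \<bullet> i\<bar> = B}"

lemma finite_corners: "finite (corners B :: 'a::euclidean_space set)"
proof (rule finite_subset)
  show "corners B \<subseteq> (\<lambda>f. \<Sum>i\<in>Basis. f i *\<^sub>R i) ` (PiE Basis (\<lambda>_. {B, - B}) :: ('a \<Rightarrow> real) set)"
  proof
    fix c :: 'a assume c: "c \<in> corners B"
    then have "(\<lambda>i\<in>Basis. c \<bullet> i) \<in> PiE Basis (\<lambda>_. {B, - B})"
      by (auto simp: corners_def)
    moreover have "c = (\<Sum>i\<in>Basis. (\<lambda>i\<in>Basis. c \<bullet> i) i *\<^sub>R i)"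
      by (simp add: euclidean_representation)
    ultimately show "c \<in> (\<lambda>f. \<Sum>i\<in>Basis. f i *\<^sub>R i) ` PiE Basis (\<lambda>_. {B, - B})"
      by blast
  qed
qed (simp add: finite_PiE)

text \<open>The Voronoi cells of the corners are the orthants. Absolute values of the coordinates
  fold all orthants onto the positive one, and a translation takes its corner to the origin.\<close>

lemma corners_fold:
  assumes B: "B > 0"
  obtains F :: "'a::euclidean_space \<Rightarrow> 'a" where "piecewise_isometric F" "cone_fold (corners B) F"
proof
  define F :: "'a \<Rightarrow> 'a" where "F x = (\<Sum>i\<in>Basis. (\<bar>x \<bullet> i\<bar> - B) *\<^sub>R i)" for x
  have F: "F x \<bullet> i = \<bar>x \<bullet> i\<bar> - B" if "i \<in> Basis" for x i
    using that by (simp add: F_def)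
  show "piecewise_isometric F"
    unfolding piecewise_isometric_def
  proof (intro exI conjI allI impI)
    show "finite ((\<lambda>i. (i, 0::real)) ` (Basis::'a set))" by simp
  next
    fix x y assume s: "same_side ((\<lambda>i. (i, 0::real)) ` (Basis::'a set)) x y"
    have "\<bar>\<bar>x \<bullet> i\<bar> - \<bar>y \<bullet> i\<bar>\<bar> = \<bar>x \<bullet> i - y \<bullet> i\<bar>" if "i \<in> Basis" for i
      using same_sideD [OF s, of i 0] that by (auto simp: inner_commute)
    then show "dist (F x) (F y) = dist x y"
      by (simp add: euclidean_dist_l2 [of "F x"] euclidean_dist_l2 [of x] L2_set_def F dist_real_def
          cong: sum.cong)
  qed
  show "cone_fold (corners B) F"
    unfolding cone_fold_def
  proof (intro allI ballI impI)
    fix z c :: 'a assume c: "c \<in> corners B" and near: "\<forall>c'\<in>corners B. dist z c \<le> dist z c'"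
    have cB: "c \<bullet> i = B \<or> c \<bullet> i = - B" if "i \<in> Basis" for i
      using c that by (auto simp: corners_def abs_eq_iff')
    \<comment> \<open>The competitor \<open>c'\<close> is \<open>c\<close> reflected in the
      \<open>i\<close>-th coordinate. As \<open>c\<close> is no farther from \<open>z\<close>, the
      point \<open>z\<close> lies on the side of \<open>c\<close>.\<close>
    have sg: "(z \<bullet> i) * (c \<bullet> i) \<ge> 0" if i: "i \<in> Basis" for i
    proof -
      define c' where "c' = c - (2 * (c \<bullet> i)) *\<^sub>R i"
      have "c' \<bullet> j = (if j = i then - (c \<bullet> i) else c \<bullet> j)" if "j \<in> Basis" for j
        using that i by (auto simp: c'_def inner_diff_left inner_Basis)
      then have "c' \<in> corners B"
        using c i by (auto simp: corners_def)
      then have "(norm (z - c))\<^sup>2 \<le> (norm (z - c'))\<^sup>2"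
        using near by (simp add: dist_norm)
      moreover have "i \<bullet> i = 1" using i by simp
      ultimately show ?thesis
        unfolding power2_norm_eq_inner c'_def
        by (simp add: inner_diff inner_commute algebra_simps)
    qed
    have ab: "\<bar>c \<bullet> i + t * (z \<bullet> i - c \<bullet> i)\<bar> - B = t * (\<bar>z \<bullet> i\<bar> - B)"
      if "i \<in> Basis" "0 \<le> t" "t \<le> 1" for i t
    proof -
      from cB [OF that(1)] show ?thesis
      proof
        assume 1: "c \<bullet> i = B"
        then have z: "z \<bullet> i \<ge> 0"
          using sg [OF that(1)] B by (simp add: zero_le_mult_iff)
        have "B + t * (z \<bullet> i - B) = (1 - t) * B + t * (z \<bullet> i)"
          by (simp add: algebra_simps)
        moreover have "(1 - t) * B + t * (z \<bullet> i) \<ge> 0"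
          using that B z by (intro add_nonneg_nonneg mult_nonneg_nonneg) auto
        ultimately show ?thesis
          using 1 z by (simp add: algebra_simps)
      next
        assume 1: "c \<bullet> i = - B"
        then have z: "z \<bullet> i \<le> 0"
          using sg [OF that(1)] B by (simp add: mult_le_0_iff)
        have "- B + t * (z \<bullet> i + B) = - ((1 - t) * B + t * (- (z \<bullet> i)))"
          by (simp add: algebra_simps)
        moreover have "(1 - t) * B + t * (- (z \<bullet> i)) \<ge> 0"
          using that B z by (intro add_nonneg_nonneg mult_nonneg_nonneg) auto
        ultimately show ?thesis
          using 1 z by (simp add: algebra_simps)
      qed
    qed
    have "\<bar>F z \<bullet> i\<bar> = dist (z \<bullet> i) (c \<bullet> i)" if "i \<in> Basis" for i
      using cB [OF that]
    proof
      assume 1: "c \<bullet> i = B"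
      then show ?thesis
        using sg [OF that] B by (simp add: F [OF that] dist_real_def zero_le_mult_iff)
    next
      assume 1: "c \<bullet> i = - B"
      then show ?thesis
        using sg [OF that] B by (simp add: F [OF that] dist_real_def mult_le_0_iff abs_if)
    qed
    then have coord: "dist (F z \<bullet> i) (0 \<bullet> i) = dist (z \<bullet> i) (c \<bullet> i)" if "i \<in> Basis" for i
      using that by simp
    have "dist (F z) 0 = L2_set (\<lambda>i. dist (z \<bullet> i) (c \<bullet> i)) Basis"
      by (subst euclidean_dist_l2, rule L2_set_cong [OF refl], rule coord)
    then have "norm (F z) = dist z c"
      unfolding dist_0_norm dist_norm [of "F z" 0] diff_zero
      by (rule trans [OF _ euclidean_dist_l2 [of z c, symmetric]])
    moreover have "F (c + t *\<^sub>R (z - c)) = t *\<^sub>R F z" if "t \<in> {0..1}" for t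
      using that ab by (auto intro!: euclidean_eqI [where 'a = 'a] simp: F inner_add_left inner_diff_left)
    ultimately show "norm (F z) = dist z c \<and> (\<forall>t\<in>{0..1}. F (c + t *\<^sub>R (z - c)) = t *\<^sub>R F z)"
      by blast
  qed
qed


text \<open>Inserting a site \<open>b\<close> keeps the map outside the Voronoi cell of \<open>b\<close> and replaces it in the
  cell by the cone over its values on the boundary of the cell. A ray \<open>b + s *\<^sub>R d\<close> leaves the cell
  at \<open>s = 1 / m d\<close>, where \<open>m d\<close> is the maximum of the linear forms \<open>w c\<close> below, so all walls
  of the new map are hyperplanes.\<close>

lemma cone_fold_insert:
  fixes F :: "'a::euclidean_space \<Rightarrow> 'a"
  assumes finA: "finite A" and F: "piecewise_isometric F" and cone: "cone_fold A F"
    and b: "b \<notin> A" and pos: "\<And>d. d \<noteq> 0 \<Longrightarrow> \<exists>c\<in>A. d \<bullet> (c - b) > 0" and A: "A \<noteq> {}"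
  obtains F' where "piecewise_isometric F'" "cone_fold (insert b A) F'"
proof -
  \<comment> \<open>Scaled so that the bisector of \<open>b\<close> and \<open>c\<close> is
    \<open>w c \<bullet> (x - b) = 1\<close>. Thus \<open>m\<close> is the gauge of the cell of
    \<open>b\<close> with \<open>b\<close> as origin, and \<open>pos\<close> says that this cell is
    bounded.\<close>
  define w where "w c = (2 / (norm (c - b))\<^sup>2) *\<^sub>R (c - b)" for c
  define m where "m d = Max ((\<lambda>c. w c \<bullet> d) ` A)" for d
  have m_ge: "w c \<bullet> d \<le> m d" if "c \<in> A" for c d
    using that finA by (auto simp: m_def)
  have m_in: "\<exists>c\<in>A. m d = w c \<bullet> d" for d
  proof -
    have "m d \<in> (\<lambda>c. w c \<bullet> d) ` A"
      unfolding m_def using finA A by (intro Max_in) auto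
    then show ?thesis by auto
  qed
  have m_pos: "m d > 0" if d: "d \<noteq> 0" for d
  proof -
    obtain c where c: "c \<in> A" "d \<bullet> (c - b) > 0" using pos [OF d] by auto
    then have "w c \<bullet> d > 0"
      using b by (auto simp: w_def inner_commute intro!: divide_pos_pos)
    then show ?thesis using m_ge [OF c(1), of d] by linarith
  qed
  have m_zero: "m 0 = 0"
    using m_in [of 0] by auto
  have m_scale: "m (t *\<^sub>R d) = t * m d" if "t \<ge> 0" for t d
  proof (rule antisym)
    show "m (t *\<^sub>R d) \<le> t * m d"
      using m_in [of "t *\<^sub>R d"] m_ge [of _ d] that by (auto intro!: mult_left_mono)
    show "t * m d \<le> m (t *\<^sub>R d)"
      using m_in [of d] m_ge [of _ "t *\<^sub>R d"] by force
  qed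
  have w_self: "w c \<bullet> (c - b) = 2" if "c \<in> A" for c
    using that b by (auto simp: w_def power2_norm_eq_inner)
  have wc: "(norm (x - c))\<^sup>2 - (norm (x - b))\<^sup>2 = (norm (c - b))\<^sup>2 * (1 - w c \<bullet> (x - b))"
    if "c \<in> A" for c x
  proof -
    have "norm (c - b) \<noteq> 0" using that b by auto
    then have "(norm (c - b))\<^sup>2 * (1 - w c \<bullet> (x - b)) = (norm (c - b))\<^sup>2 - 2 * ((c - b) \<bullet> (x - b))"
      by (simp add: w_def algebra_simps)
    moreover have "x - c = (x - b) - (c - b)" by simp
    ultimately show ?thesis
      by (simp add: power2_norm_eq_inner inner_diff inner_commute algebra_simps)
  qed
  have closer_iff: "dist x b \<le> dist x c \<longleftrightarrow> w c \<bullet> (x - b) \<le> 1"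
    and further_iff: "dist x c \<le> dist x b \<longleftrightarrow> 1 \<le> w c \<bullet> (x - b)" if "c \<in> A" for c x
  proof -
    have p: "(norm (c - b))\<^sup>2 > 0" using that b by auto
    have "dist x b \<le> dist x c \<longleftrightarrow> 0 \<le> (norm (x - c))\<^sup>2 - (norm (x - b))\<^sup>2"
      by (simp add: dist_norm flip: abs_le_square_iff)
    then show "dist x b \<le> dist x c \<longleftrightarrow> w c \<bullet> (x - b) \<le> 1"
      using p by (simp add: wc [OF that] zero_le_mult_iff)
    have "dist x c \<le> dist x b \<longleftrightarrow> (norm (x - c))\<^sup>2 - (norm (x - b))\<^sup>2 \<le> 0"
      by (simp add: dist_norm flip: abs_le_square_iff)
    then show "dist x c \<le> dist x b \<longleftrightarrow> 1 \<le> w c \<bullet> (x - b)"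
      using p by (simp add: wc [OF that] mult_le_0_iff)
  qed
  \<comment> \<open>Central projection from \<open>b\<close> to the boundary of its cell. Division
    by zero gives \<open>Y b = b\<close>, and \<open>F'\<close> treats \<open>b\<close>
    separately.\<close>
  define Y where "Y x = b + (1 / m (x - b)) *\<^sub>R (x - b)" for x
  define F' where "F' x = (if x = b then 0 else if m (x - b) \<ge> 1 then F x else m (x - b) *\<^sub>R F (Y x))"
    for x
  have F'_out: "F' x = F x" if "m (x - b) \<ge> 1" for x
    using that m_zero by (auto simp: F'_def)
  have F'_in: "F' x = m (x - b) *\<^sub>R F (Y x)" if "x \<noteq> b" "m (x - b) \<le> 1" for x
    using that by (auto simp: F'_def Y_def)
  have F'_b: "F' b = 0" by (simp add: F'_def)
  have Y: "x - b = m (x - b) *\<^sub>R (Y x - b)" if "x \<noteq> b" for x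
    using m_pos [of "x - b"] that by (simp add: Y_def)
  \<comment> \<open>A boundary point is equidistant from \<open>b\<close> and from a site of
    \<open>A\<close> nearest to it, so the old map already has the norm that the new cone
    demands.\<close>
  have norm_FY: "norm (F (Y x)) = norm (Y x - b)" if "x \<noteq> b" for x
  proof -
    have "Y x - b = (1 / m (x - b)) *\<^sub>R (x - b)" by (simp add: Y_def)
    then have 1: "m (Y x - b) = 1"
      using m_pos [of "x - b"] that by (simp add: m_scale)
    then obtain c where c: "c \<in> A" "w c \<bullet> (Y x - b) = 1"
      using m_in by metis
    have "dist (Y x) c = dist (Y x) b"
      using c closer_iff [of c "Y x"] further_iff [of c "Y x"] by auto
    moreover have "dist (Y x) b \<le> dist (Y x) c'" if "c' \<in> A" for c'
      using m_ge [OF that, of "Y x - b"] 1 closer_iff [OF that, of "Y x"] by auto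
    ultimately show ?thesis
      using cone c(1) unfolding cone_fold_def by (metis dist_norm)
  qed
  have norm_F': "norm (F' x) = dist x b" if "m (x - b) \<le> 1" for x
  proof (cases "x = b")
    case False
    then have "norm (F' x) = norm (m (x - b) *\<^sub>R (Y x - b))"
      using that m_pos [of "x - b"] by (simp add: F'_in norm_FY)
    then show ?thesis
      using Y [OF False] by (simp add: dist_norm)
  qed (simp add: F'_b)
  have "cone_fold (insert b A) F'"
    unfolding cone_fold_def
  proof (intro allI ballI impI)
    fix z a assume a: "a \<in> insert b A" and near: "\<forall>a'\<in>insert b A. dist z a \<le> dist z a'"
    show "norm (F' z) = dist z a \<and> (\<forall>t\<in>{0..1}. F' (a + t *\<^sub>R (z - a)) = t *\<^sub>R F' z)"
    proof (cases "a = b")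
      case True
      have mz: "m (z - b) \<le> 1"
        using near closer_iff [of _ z] m_in [of "z - b"] True by auto
      have "F' (b + t *\<^sub>R (z - b)) = t *\<^sub>R F' z" if t: "t \<in> {0..1}" for t
      proof (cases "t = 0 \<or> z = b")
        case False
        then have t0: "t > 0" and zb: "z \<noteq> b" using t by auto
        have mt: "m (t *\<^sub>R (z - b)) = t * m (z - b)" using m_scale t by auto
        have "Y (b + t *\<^sub>R (z - b)) = Y z"
          using t0 by (simp add: Y_def mt)
        moreover have "t * m (z - b) \<le> 1"
          using mz t m_pos [of "z - b"] zb by (auto intro: mult_le_one)
        ultimately show ?thesis
          using False mz zb by (subst (1 2) F'_in) (auto simp: mt)
      qed (auto simp: F'_b)
      then show ?thesis using norm_F' [OF mz] True by auto
    next
      case False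
      then have aA: "a \<in> A" using a by auto
      have wz: "1 \<le> w a \<bullet> (z - b)" using near further_iff [OF aA] by auto
      have Fz: "F' z = F z"
        using wz m_ge [OF aA, of "z - b"] by (intro F'_out) auto
      \<comment> \<open>The form \<open>w a\<close> applied to \<open>x - b\<close> is 2 at
        \<open>x = a\<close> and at least 1 at \<open>x = z\<close>, hence at least 1 in between:
        the segment avoids the interior of the new cell.\<close>
      have "F' (a + t *\<^sub>R (z - a)) = F (a + t *\<^sub>R (z - a))" if t: "t \<in> {0..1}" for t
      proof -
        have "a + t *\<^sub>R (z - a) - b = (1 - t) *\<^sub>R (a - b) + t *\<^sub>R (z - b)"
          by (simp add: algebra_simps)
        then have "w a \<bullet> (a + t *\<^sub>R (z - a) - b) = (1 - t) * 2 + t * (w a \<bullet> (z - b))"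
          using w_self [OF aA] by (simp add: inner_add_right)
        moreover have "t * (w a \<bullet> (z - b)) \<ge> t * 1"
          using wz t by (intro mult_left_mono) auto
        ultimately have "1 \<le> w a \<bullet> (a + t *\<^sub>R (z - a) - b)" using t by auto
        then show ?thesis
          using m_ge [OF aA, of "a + t *\<^sub>R (z - a) - b"] by (intro F'_out) auto
      qed
      then show ?thesis
        using cone aA near Fz unfolding cone_fold_def by auto
    qed
  qed
  moreover have "piecewise_isometric F'"
  proof -
    obtain L where L: "finite L" "\<And>x y. same_side L x y \<Longrightarrow> dist (F x) (F y) = dist x y"
      using F unfolding piecewise_isometric_def by blast
    \<comment> \<open>The normal of the hyperplane spanned by \<open>b\<close> and the trace of
      \<open>l\<close> on the facet of \<open>c\<close>: where \<open>w c\<close> is maximal, its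
      sign at \<open>x\<close> is that of \<open>l\<close> at \<open>Y x\<close>. So
      \<open>L1\<close> holds the bisectors, \<open>L2\<close> decides which form is maximal, and
      \<open>L3\<close> holds the cones over the old walls.\<close>
    define q where "q l c = (fst l \<bullet> b - snd l) *\<^sub>R w c + fst l" for l :: "'a \<times> real" and c
    define L1 where "L1 = (\<lambda>c. (w c, 1 + w c \<bullet> b)) ` A"
    define L2 where "L2 = (\<lambda>(c, c'). (w c - w c', (w c - w c') \<bullet> b)) ` (A \<times> A)"
    define L3 where "L3 = (\<lambda>(l, c). (q l c, q l c \<bullet> b)) ` (L \<times> A)"
    have fin: "finite (L \<union> L1 \<union> L2 \<union> L3)"
      unfolding L1_def L2_def L3_def using L(1) finA by auto
    have "dist (F' x) (F' y) = dist x y" if s: "same_side (L \<union> L1 \<union> L2 \<union> L3) x y" for x y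
    proof -
      have sL: "same_side L x y" by (rule same_side_mono [OF s]) auto
      have s1: "w c \<bullet> (x - b) \<le> 1 \<and> w c \<bullet> (y - b) \<le> 1 \<or> 1 \<le> w c \<bullet> (x - b) \<and> 1 \<le> w c \<bullet> (y - b)"
        if "c \<in> A" for c
      proof -
        have "(w c, 1 + w c \<bullet> b) \<in> L \<union> L1 \<union> L2 \<union> L3" using that by (auto simp: L1_def)
        from same_sideD [OF s this] show ?thesis by (auto simp: inner_diff_right)
      qed
      have s2: "w c \<bullet> (x - b) \<le> w c' \<bullet> (x - b) \<and> w c \<bullet> (y - b) \<le> w c' \<bullet> (y - b) \<or>
          w c' \<bullet> (x - b) \<le> w c \<bullet> (x - b) \<and> w c' \<bullet> (y - b) \<le> w c \<bullet> (y - b)"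
        if "c \<in> A" "c' \<in> A" for c c'
      proof -
        have "(w c - w c', (w c - w c') \<bullet> b) \<in> L \<union> L1 \<union> L2 \<union> L3"
          using that by (auto simp: L2_def)
        from same_sideD [OF s this] show ?thesis by (auto simp: inner_diff_right inner_diff_left)
      qed
      have s3: "q l c \<bullet> (x - b) \<le> 0 \<and> q l c \<bullet> (y - b) \<le> 0 \<or> 0 \<le> q l c \<bullet> (x - b) \<and> 0 \<le> q l c \<bullet> (y - b)"
        if "c \<in> A" "l \<in> L" for c l
      proof -
        have "(q l c, q l c \<bullet> b) \<in> L \<union> L1 \<union> L2 \<union> L3" using that by (force simp: L3_def)
        from same_sideD [OF s this] show ?thesis by (auto simp: inner_diff_right)
      qed
      \<comment> \<open>Thanks to \<open>L2\<close> a single site attains the maximum at both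
        points, so both project to the same facet.\<close>
      obtain c where c: "c \<in> A" "m (x - b) = w c \<bullet> (x - b)" "m (y - b) = w c \<bullet> (y - b)"
      proof -
        obtain cx where cx: "cx \<in> A" "m (x - b) = w cx \<bullet> (x - b)" using m_in by metis
        obtain cy where cy: "cy \<in> A" "m (y - b) = w cy \<bullet> (y - b)" using m_in by metis
        from s2 [OF cx(1) cy(1)] show ?thesis
          using that [of cx] that [of cy] cx cy m_ge [OF cx(1), of "y - b"] m_ge [OF cy(1), of "x - b"]
          by auto
      qed
      from s1 [OF c(1)] show ?thesis
      proof
        assume "1 \<le> w c \<bullet> (x - b) \<and> 1 \<le> w c \<bullet> (y - b)"
        then show ?thesis using F'_out L(2) [OF sL] c by simp
      next
        assume le: "w c \<bullet> (x - b) \<le> 1 \<and> w c \<bullet> (y - b) \<le> 1"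
        show ?thesis
        proof (cases "x = b \<or> y = b")
          case True
          then show ?thesis
            using le c norm_F' [of x] norm_F' [of y] F'_b by (auto simp: dist_commute)
        next
          case False
          define \<mu> \<nu> where "\<mu> = m (x - b)" and "\<nu> = m (y - b)"
          have pos': "\<mu> > 0" "\<nu> > 0" using False m_pos by (auto simp: \<mu>_def \<nu>_def)
          have x: "x - b = \<mu> *\<^sub>R (Y x - b)" and y: "y - b = \<nu> *\<^sub>R (Y y - b)"
            using False Y by (auto simp: \<mu>_def \<nu>_def)
          have "same_side L (Y x) (Y y)"
            unfolding same_side_def
          proof (intro ballI)
            fix l assume "l \<in> L"
            moreover obtain n \<beta> where nb: "l = (n, \<beta>)" by (cases l)
            ultimately have l: "(n, \<beta>) \<in> L" by simp
            have "q (n, \<beta>) c \<bullet> (x - b) = \<mu> * (n \<bullet> Y x - \<beta>)"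
            proof -
              have "q (n, \<beta>) c \<bullet> (x - b) = (n \<bullet> b - \<beta>) * \<mu> + n \<bullet> (x - b)"
                using c by (simp add: q_def inner_add_left \<mu>_def)
              also have "n \<bullet> (x - b) = \<mu> * (n \<bullet> Y x - n \<bullet> b)"
                by (subst x) (simp add: inner_diff_right)
              finally show ?thesis by (simp add: algebra_simps)
            qed
            moreover have "q (n, \<beta>) c \<bullet> (y - b) = \<nu> * (n \<bullet> Y y - \<beta>)"
            proof -
              have "q (n, \<beta>) c \<bullet> (y - b) = (n \<bullet> b - \<beta>) * \<nu> + n \<bullet> (y - b)"
                using c by (simp add: q_def inner_add_left \<nu>_def)
              also have "n \<bullet> (y - b) = \<nu> * (n \<bullet> Y y - n \<bullet> b)"
                by (subst y) (simp add: inner_diff_right)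
              finally show ?thesis by (simp add: algebra_simps)
            qed
            ultimately have "n \<bullet> Y x \<le> \<beta> \<and> n \<bullet> Y y \<le> \<beta> \<or> \<beta> \<le> n \<bullet> Y x \<and> \<beta> \<le> n \<bullet> Y y"
              using s3 [OF c(1) l] pos' by (auto simp: mult_le_0_iff zero_le_mult_iff)
            then show "case l of (n, \<beta>) \<Rightarrow>
                n \<bullet> Y x \<le> \<beta> \<and> n \<bullet> Y y \<le> \<beta> \<or> \<beta> \<le> n \<bullet> Y x \<and> \<beta> \<le> n \<bullet> Y y"
              by (simp add: nb)
          qed
          then have "dist (F (Y x)) (F (Y y)) = dist (Y x - b) (Y y - b)"
            using L(2) by (simp add: dist_norm)
          \<comment> \<open>Norms and inner products of the two generators are preserved, hence so
            are the distances between their multiples.\<close>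
          then have inn: "F (Y x) \<bullet> F (Y y) = (Y x - b) \<bullet> (Y y - b)"
            using norm_FY False by (intro inner_eq_if_dist_eq) auto
          have F'xy: "F' x = \<mu> *\<^sub>R F (Y x)" "F' y = \<nu> *\<^sub>R F (Y y)"
            using F'_in False le c by (auto simp: \<mu>_def \<nu>_def)
          have "(x - b) - (y - b) = \<mu> *\<^sub>R (Y x - b) - \<nu> *\<^sub>R (Y y - b)"
            using x y by metis
          moreover have "norm (F' x - F' y) = norm (\<mu> *\<^sub>R (Y x - b) - \<nu> *\<^sub>R (Y y - b))"
            unfolding F'xy using False by (intro norm_combination_eq [OF norm_FY norm_FY inn]) auto
          ultimately have "norm (F' x - F' y) = norm (x - y)" by simp
          then show ?thesis by (simp add: dist_norm)
        qed
      qed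
    qed
    then show ?thesis
      unfolding piecewise_isometric_def using fin by (intro exI [of _ "L \<union> L1 \<union> L2 \<union> L3"]) simp
  qed
  ultimately show ?thesis by (rule that [rotated])
qed

text \<open>The sites are inserted one by one into the fold of the corners. The corners surround
  them, so every new cell is bounded and the cone construction applies.\<close>

lemma cone_fold_exists:
  fixes A :: "'a::euclidean_space set"
  assumes "finite A" and B: "B > 0" and "\<And>a i. a \<in> A \<Longrightarrow> i \<in> Basis \<Longrightarrow> \<bar>a \<bullet> i\<bar> < B"
  shows "\<exists>F. piecewise_isometric F \<and> cone_fold (A \<union> corners B) F"
  using assms(1,3)
proof (induction A rule: finite_induct)
  case empty
  show ?case using corners_fold [OF B] by (metis sup_bot_left)
next
  case (insert b A)
  then obtain F where F: "piecewise_isometric F" "cone_fold (A \<union> corners B) F" by auto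
  have bB: "\<bar>b \<bullet> i\<bar> < B" if "i \<in> Basis" for i using insert.prems that by auto
  have "b \<notin> corners B"
    using bB SOME_Basis unfolding corners_def by fastforce
  then have b: "b \<notin> A \<union> corners B" using insert by auto
  have pos: "\<exists>c\<in>A \<union> corners B. d \<bullet> (c - b) > 0" if "d \<noteq> 0" for d
  proof -
    \<comment> \<open>The corner in the orthant of \<open>d\<close>. Since \<open>b\<close> is
      inside the cube, \<open>c - b\<close> agrees in sign with every nonzero coordinate of
      \<open>d\<close>.\<close>
    define c where "c = (\<Sum>i\<in>Basis. (if d \<bullet> i \<ge> 0 then B else - B) *\<^sub>R i)"
    have ci: "c \<bullet> i = (if d \<bullet> i \<ge> 0 then B else - B)" if "i \<in> Basis" for i
      using that by (simp add: c_def)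
    have "c \<in> corners B"
      using B by (auto simp: corners_def ci)
    moreover have "d \<bullet> (c - b) > 0"
    proof -
      have "\<exists>i\<in>Basis. d \<bullet> i \<noteq> 0" using that euclidean_all_zero_iff [of d] by auto
      then obtain i where i: "i \<in> Basis" "d \<bullet> i \<noteq> 0" by auto
      have t: "(d \<bullet> j) * ((c - b) \<bullet> j) > 0" if "j \<in> Basis" "d \<bullet> j \<noteq> 0" for j
        using bB [OF that(1)] that(2)
        by (auto simp: inner_diff_left ci [OF that(1)] zero_less_mult_iff)
      have "0 \<le> (d \<bullet> j) * ((c - b) \<bullet> j)" if "j \<in> Basis" for j
        using t [OF that] by (cases "d \<bullet> j = 0") auto
      then have "0 < (\<Sum>j\<in>Basis. (d \<bullet> j) * ((c - b) \<bullet> j))"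
        using t [OF i] by (intro sum_pos2 [OF finite_Basis i(1)]) auto
      then show ?thesis by (subst euclidean_inner) simp
    qed
    ultimately show ?thesis by blast
  qed
  have "corners B \<noteq> ({} :: 'a set)"
  proof -
    have "(\<Sum>i\<in>Basis. B *\<^sub>R i) \<in> (corners B :: 'a set)"
      using B by (auto simp: corners_def)
    then show ?thesis by blast
  qed
  then obtain F' where "piecewise_isometric F'" "cone_fold (insert b (A \<union> corners B)) F'"
    using cone_fold_insert [OF _ F b pos] finite_corners insert.hyps(1) by auto
  then show ?case by auto
qed

section \<open>Folding rays of the plane onto one axis\<close>

definition turn :: "real^2 \<Rightarrow> real^2" where
  "turn z = vector [- z $ 2, z $ 1]"

lemma norm2_turn:
  assumes "norm e = 1"
  shows "(z \<bullet> e)\<^sup>2 + (z \<bullet> turn e)\<^sup>2 = (norm z)\<^sup>2"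
proof -
  have e: "(e $ 1)\<^sup>2 + (e $ 2)\<^sup>2 = 1"
    using assms by (simp add: norm_eq_sqrt_inner inner_vec_def sum_2 power2_eq_square)
  have "(z \<bullet> e)\<^sup>2 + (z \<bullet> turn e)\<^sup>2 = ((z $ 1)\<^sup>2 + (z $ 2)\<^sup>2) * ((e $ 1)\<^sup>2 + (e $ 2)\<^sup>2)"
    by (simp add: inner_vec_def sum_2 turn_def power2_eq_square algebra_simps)
  moreover have "(norm z)\<^sup>2 = (z $ 1)\<^sup>2 + (z $ 2)\<^sup>2"
    unfolding power2_norm_eq_inner by (simp add: inner_vec_def sum_2 power2_eq_square)
  ultimately show ?thesis by (simp only: e mult_1_right)
qed

text \<open>The plane is folded along the rays spanned by \<open>E\<close> and along the bisectors of neighbouring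
  rays: \<open>m z\<close> below is attained at the direction closest to \<open>z\<close>.\<close>

lemma fold_directions:
  fixes E :: "(real^2) set"
  assumes E: "finite E" "E \<noteq> {}" "\<And>e. e \<in> E \<Longrightarrow> norm e = 1"
  obtains G :: "real^2 \<Rightarrow> real^2" where "piecewise_isometric G"
    "\<And>e s. e \<in> E \<Longrightarrow> s \<ge> 0 \<Longrightarrow> G (s *\<^sub>R e) = vector [s, 0]"
proof
  define m where "m z = Max ((\<lambda>e. z \<bullet> e) ` E)" for z
  \<comment> \<open>The second coordinate is the distance from \<open>z\<close> to the line through
    the direction that attains \<open>m z\<close>.\<close>
  define G :: "real^2 \<Rightarrow> real^2" where "G z = vector [m z, sqrt ((norm z)\<^sup>2 - (m z)\<^sup>2)]" for z
  have m_ge: "z \<bullet> e \<le> m z" if "e \<in> E" for e z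
    using that E by (auto simp: m_def)
  have m_in: "\<exists>e\<in>E. m z = z \<bullet> e" for z
  proof -
    have "m z \<in> (\<lambda>e. z \<bullet> e) ` E" unfolding m_def using E by (intro Max_in) auto
    then show ?thesis by auto
  qed
  show "piecewise_isometric G"
    unfolding piecewise_isometric_def
  proof (intro exI conjI allI impI)
    let ?L = "(\<lambda>(e, e'). (e - e', 0 :: real)) ` (E \<times> E) \<union> (\<lambda>e. (turn e, 0)) ` E"
    show "finite ?L" using E(1) by auto
    fix x y assume s: "same_side ?L x y"
    have s1: "x \<bullet> e \<le> x \<bullet> e' \<and> y \<bullet> e \<le> y \<bullet> e' \<or> x \<bullet> e' \<le> x \<bullet> e \<and> y \<bullet> e' \<le> y \<bullet> e"
      if "e \<in> E" "e' \<in> E" for e e'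
    proof -
      have "(e - e', 0) \<in> ?L" using that by auto
      from same_sideD [OF s this] show ?thesis
        unfolding inner_diff_left by (simp add: inner_commute)
    qed
    obtain e where e: "e \<in> E" "m x = x \<bullet> e" "m y = y \<bullet> e"
    proof -
      obtain ex where ex: "ex \<in> E" "m x = x \<bullet> ex" using m_in by metis
      obtain ey where ey: "ey \<in> E" "m y = y \<bullet> ey" using m_in by metis
      from s1 [OF ex(1) ey(1)] show ?thesis
        using that [of ex] that [of ey] ex ey m_ge [OF ex(1), of y] m_ge [OF ey(1), of x] by auto
    qed
    have n: "norm e = 1" using e E by auto
    have "(turn e, 0) \<in> ?L" using e by auto
    from same_sideD [OF s this]
    have ab: "(\<bar>x \<bullet> turn e\<bar> - \<bar>y \<bullet> turn e\<bar>)\<^sup>2 = (x \<bullet> turn e - y \<bullet> turn e)\<^sup>2"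
      by (auto simp: inner_commute abs_if power2_commute)
    have G: "G z = vector [z \<bullet> e, \<bar>z \<bullet> turn e\<bar>]" if "m z = z \<bullet> e" for z
    proof -
      have "(norm z)\<^sup>2 - (m z)\<^sup>2 = (z \<bullet> turn e)\<^sup>2" using norm2_turn [OF n, of z] that by simp
      then show ?thesis using that by (simp add: G_def)
    qed
    have "(norm (G x - G y))\<^sup>2 = (x \<bullet> e - y \<bullet> e)\<^sup>2 + (\<bar>x \<bullet> turn e\<bar> - \<bar>y \<bullet> turn e\<bar>)\<^sup>2"
      by (simp only: G [OF e(2)] G [OF e(3)] power2_norm_eq_inner)
        (simp add: inner_vec_def sum_2 power2_eq_square)
    also have "\<dots> = (norm (x - y))\<^sup>2"
      using norm2_turn [OF n, of "x - y"] ab by (simp add: inner_diff_left)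
    finally show "dist (G x) (G y) = dist x y"
      by (simp add: dist_norm)
  qed
  show "G (s *\<^sub>R e) = vector [s, 0]" if "e \<in> E" "s \<ge> 0" for e s
  proof -
    have "s *\<^sub>R e \<bullet> e' \<le> s" if "e' \<in> E" for e'
    proof -
      have "e \<bullet> e' \<le> 1" using norm_cauchy_schwarz [of e e'] E(3) that \<open>e \<in> E\<close> by simp
      then show ?thesis using mult_left_mono [of "e \<bullet> e'" 1 s] \<open>s \<ge> 0\<close> by simp
    qed
    moreover have "s *\<^sub>R e \<bullet> e = s" using E(3) [OF that(1)] by (simp add: norm_eq_1)
    ultimately have "m (s *\<^sub>R e) = s"
      using m_ge [OF that(1), of "s *\<^sub>R e"] m_in [of "s *\<^sub>R e"] by fastforce
    moreover have "norm (s *\<^sub>R e) = s" using E(3) [OF that(1)] that(2) by simp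
    ultimately show ?thesis by (simp add: G_def)
  qed
qed

text \<open>The cone fold lays each segment from a site to \<open>m\<close> along a ray from the
  origin, preserving length; folding the finitely many rays together forgets which ray it was. The
  resulting value involves nothing but a distance, so it can be compared between different
  charts.\<close>

lemma fold_onto_axis:
  fixes A M :: "(real^2) set"
  assumes fin: "finite A" "finite M"
  obtains H :: "real^2 \<Rightarrow> real^2" where "piecewise_isometric H"
    "\<And>m s x. m \<in> M \<Longrightarrow> s \<in> A \<Longrightarrow> (\<And>a. a \<in> A \<Longrightarrow> dist m s \<le> dist m a) \<Longrightarrow>
      x \<in> closed_segment s m \<Longrightarrow> H x = vector [dist s x, 0]"
proof -
  \<comment> \<open>Large enough for the cube to contain all sites and for its corners never to be
    nearest: \<open>dist m c\<close> is at least \<open>B - norm m\<close>, which exceeds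
    \<open>norm m + norm s\<close>.\<close>
  define B where "B = 1 + (\<Sum>a\<in>A. norm a) + 2 * (\<Sum>m\<in>M. norm m)"
  have nA: "norm a \<le> (\<Sum>a\<in>A. norm a)" if "a \<in> A" for a
    using member_le_sum [OF that, of norm] fin by auto
  have nM: "norm a \<le> (\<Sum>a\<in>M. norm a)" if "a \<in> M" for a
    using member_le_sum [OF that, of norm] fin by auto
  have s0: "(\<Sum>a\<in>A. norm a) \<ge> 0" "(\<Sum>m\<in>M. norm m) \<ge> 0" by (auto intro: sum_nonneg)
  have B: "B > 0" using s0 by (simp add: B_def)
  have "\<bar>a \<bullet> i\<bar> < B" if "a \<in> A" "i \<in> Basis" for a i
    using nA [OF that(1)] Basis_le_norm [OF that(2), of a] s0 by (simp add: B_def)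
  then obtain F where F: "piecewise_isometric F" "cone_fold (A \<union> corners B) F"
    using cone_fold_exists [OF fin(1) B] by metis
  \<comment> \<open>\<open>axis 1 1\<close> keeps \<open>E\<close> nonempty and serves the points
    with \<open>F m = 0\<close>, which have no direction to normalize.\<close>
  define E where "E = insert (axis 1 1) ((\<lambda>m. F m /\<^sub>R norm (F m)) ` {m\<in>M. F m \<noteq> 0})"
  have E: "finite E" "E \<noteq> {}" "\<And>e. e \<in> E \<Longrightarrow> norm e = 1"
    using fin(2) by (auto simp: E_def)
  obtain G :: "real^2 \<Rightarrow> real^2" where G: "piecewise_isometric G"
    "\<And>e s. e \<in> E \<Longrightarrow> s \<ge> 0 \<Longrightarrow> G (s *\<^sub>R e) = vector [s, 0]"
    using fold_directions [OF E] by metis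
  show ?thesis
  proof (rule that [of "\<lambda>x. G (F x)"])
    show "piecewise_isometric (\<lambda>x. G (F x))"
      by (rule piecewise_isometric_compose [OF F(1) G(1)])
    fix m s x assume m: "m \<in> M" and s: "s \<in> A" and near: "\<And>a. a \<in> A \<Longrightarrow> dist m s \<le> dist m a"
      and x: "x \<in> closed_segment s m"
    have far: "dist m s \<le> dist m c" if "c \<in> corners B" for c
    proof -
      have "norm c \<ge> B"
      proof -
        obtain i :: "real^2" where i: "i \<in> Basis" using nonempty_Basis by blast
        then have "\<bar>c \<bullet> i\<bar> = B" using that by (simp add: corners_def)
        then show ?thesis using Basis_le_norm [OF i, of c] by simp
      qed
      moreover have "norm c \<le> dist m c + norm m"
        using norm_triangle_ineq4 [of m "m - c"] by (simp add: dist_norm)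
      moreover have "dist m s \<le> norm m + norm s" by (simp add: dist_norm norm_triangle_ineq4)
      ultimately show ?thesis using nA [OF s] nM [OF m] by (simp add: B_def)
    qed
    obtain t where t: "0 \<le> t" "t \<le> 1" "x = s + t *\<^sub>R (m - s)"
      using x unfolding closed_segment_def by (auto simp: algebra_simps)
    have "\<forall>a'\<in>A \<union> corners B. dist m s \<le> dist m a'" using near far by auto
    then have F1: "norm (F m) = dist m s" and F2: "F x = t *\<^sub>R F m"
      using F(2) s t unfolding cone_fold_def by auto
    have dx: "dist s x = t * dist m s"
      using t by (simp add: dist_norm norm_minus_commute)
    show "G (F x) = vector [dist s x, 0]"
    proof (cases "F m = 0")
      case True
      have 1: "dist s x = 0"
        unfolding dx F1 [symmetric] True by simp
      have 2: "F x = 0 *\<^sub>R axis 1 1"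
        unfolding F2 True by simp
      have "axis 1 1 \<in> E" by (simp add: E_def)
      then show ?thesis
        unfolding 1 2 by (rule G(2)) simp
    next
      case False
      let ?e = "F m /\<^sub>R norm (F m)"
      have "?e \<in> E" using m False by (simp add: E_def)
      moreover have "F x = dist s x *\<^sub>R ?e"
        unfolding F2 dx F1 [symmetric] using False by simp
      ultimately show ?thesis by (metis G(2) zero_le_dist)
    qed
  qed
qed

section \<open>Points in general position\<close>

definition moment_curve :: "real \<Rightarrow> real \<times> real \<times> real \<times> real \<times> real" where
  "moment_curve t = (t, t ^ 2, t ^ 3, t ^ 4, t ^ 5)"

text \<open>The coefficients of an affine dependence annihilate all powers up to the fifth, hence
  all polynomials of degree at most five. Testing with the polynomial that vanishes at all
  parameters except \<open>r\<close> isolates the coefficient of \<open>r\<close>.\<close>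

lemma moment_curve_independent:
  assumes T: "finite T" "card T \<le> 6"
  shows "\<not> affine_dependent (moment_curve ` T)"
proof
  assume "affine_dependent (moment_curve ` T)"
  then obtain U where U: "sum U (moment_curve ` T) = 0" "\<exists>v\<in>moment_curve ` T. U v \<noteq> 0"
    "(\<Sum>v\<in>moment_curve ` T. U v *\<^sub>R v) = 0"
    using affine_dependent_explicit_finite [of "moment_curve ` T"] T(1) by auto
  define u where "u t = U (moment_curve t)" for t
  have inj: "inj_on moment_curve T"
    by (auto simp: inj_on_def moment_curve_def)
  have u0: "(\<Sum>t\<in>T. u t) = 0"
    using U(1) by (simp add: sum.reindex [OF inj] u_def)
  have "(\<Sum>t\<in>T. u t *\<^sub>R moment_curve t) = 0"
    using U(3) by (simp add: sum.reindex [OF inj] u_def)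
  then have u1: "(\<Sum>t\<in>T. u t * t) = 0" "(\<Sum>t\<in>T. u t * t ^ 2) = 0" "(\<Sum>t\<in>T. u t * t ^ 3) = 0"
    "(\<Sum>t\<in>T. u t * t ^ 4) = 0" "(\<Sum>t\<in>T. u t * t ^ 5) = 0"
    by (simp_all add: moment_curve_def prod_eq_iff fst_sum snd_sum)
  have u: "(\<Sum>t\<in>T. u t * t ^ k) = 0" if "k \<le> 5" for k
  proof -
    have "k \<in> {0, 1, 2, 3, 4, 5}" using that by auto
    then show ?thesis using u0 u1 by auto
  qed
  have "u r = 0" if r: "r \<in> T" for r
  proof -
    define p where "p = (\<Prod>s\<in>T - {r}. [:- s, 1:])"
    have "degree p \<le> 5"
      using degree_prod_sum_le [of "T - {r}" "\<lambda>s. [:- s, 1:]"] T r by (simp add: p_def)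
    then have "(\<Sum>t\<in>T. \<Sum>i\<le>degree p. u t * (coeff p i * t ^ i)) = 0"
      by (subst sum.swap) (use u in \<open>simp add: mult.left_commute [of "u _"] flip: sum_distrib_left\<close>)
    then have "(\<Sum>t\<in>T. u t * poly p t) = 0"
      by (simp add: poly_altdef sum_distrib_left)
    moreover have "poly p t = 0" if "t \<in> T - {r}" for t
      using that T(1) by (auto simp: p_def poly_prod)
    ultimately have "u r * poly p r = 0"
      using sum.remove [OF T(1) r, of "\<lambda>t. u t * poly p t"] by simp
    moreover have "poly p r \<noteq> 0"
      using T(1) by (auto simp: p_def poly_prod)
    ultimately show ?thesis by simp
  qed
  then show False using U(2) by (auto simp: u_def)
qed

lemma general_position:
  assumes "finite V"
  obtains \<gamma> :: "'a \<Rightarrow> real \<times> real \<times> real \<times> real \<times> real" where "inj_on \<gamma> V"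
    "\<And>W. W \<subseteq> V \<Longrightarrow> card W \<le> 6 \<Longrightarrow> \<not> affine_dependent (\<gamma> ` W)"
proof -
  obtain f :: "'a \<Rightarrow> nat" where f: "inj_on f V"
    using finite_imp_inj_to_nat_seg [OF assms] by blast
  show ?thesis
  proof
    show "inj_on (\<lambda>v. moment_curve (real (f v))) V"
      using f by (auto simp: inj_on_def moment_curve_def)
    fix W assume W: "W \<subseteq> V" "card W \<le> 6"
    then have "finite W" using assms finite_subset by blast
    then have "\<not> affine_dependent (moment_curve ` ((\<lambda>v. real (f v)) ` W))"
      using W card_image_le [of W "\<lambda>v. real (f v)"] by (intro moment_curve_independent) auto
    then show "\<not> affine_dependent ((\<lambda>v. moment_curve (real (f v))) ` W)"
      by (simp add: image_image)
  qed
qed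

section \<open>Sites on the edges\<close>

lemma compact_disjoint_dist_ge:
  fixes S T :: "'a::metric_space set"
  assumes S: "compact S" and T: "compact T" and disj: "S \<inter> T = {}"
  shows "\<exists>d>0. \<forall>x\<in>S. \<forall>y\<in>T. d \<le> dist x y"
proof (cases "S = {} \<or> T = {}")
  case True
  then show ?thesis by (auto intro: exI [of _ 1])
next
  case False
  have "continuous_on S (\<lambda>x. infdist x T)" by (intro continuous_intros)
  then obtain x where x: "x \<in> S" "\<And>y. y \<in> S \<Longrightarrow> infdist x T \<le> infdist y T"
    using continuous_attains_inf [OF S] False by blast
  have "infdist x T > 0"
    using infdist_pos_not_in_closed [of T x] T False x(1) disj by (auto simp: compact_imp_closed)
  then show ?thesis
    using x(2) infdist_le order_trans by meson
qed

text \<open>Serves to choose each small constant of \<open>edge_sites\<close> uniformly over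
  finitely many vertices, edges or pairs of them.\<close>

lemma finite_common_bound:
  fixes P :: "'i \<Rightarrow> real \<Rightarrow> bool"
  assumes "finite I" "\<And>i. i \<in> I \<Longrightarrow> \<exists>d>0. P i d"
    and "\<And>i d d'. P i d \<Longrightarrow> 0 < d' \<Longrightarrow> d' \<le> d \<Longrightarrow> P i d'"
  shows "\<exists>d>0. \<forall>i\<in>I. P i d"
  using assms(1,2)
proof (induction I rule: finite_induct)
  case empty
  show ?case by (auto intro: exI [of _ 1])
next
  case (insert i I)
  have "\<exists>d>0. \<forall>i\<in>I. P i d" using insert by simp
  then obtain d where d: "d > 0" "\<forall>i\<in>I. P i d" by blast
  obtain d' where "d' > 0" "P i d'" using insert.prems [of i] by blast
  with d show ?case
    using assms(3) by (intro exI [of _ "min d d'"]) (auto intro: assms(3))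
qed

text \<open>Each edge receives its end points, the points at distance \<open>\<epsilon>\<close> from them, and a fine equidistant
  subdivision in between. Distinct sites are then at least \<open>\<epsilon>\<close> away from every vertex, which settles
  the midpoints next to a vertex by the triangle inequality; the other midpoints are at least \<open>\<eta>\<close> away
  from all other edges by compactness.\<close>

lemma edge_sites:
  fixes c :: "'e \<Rightarrow> real \<Rightarrow> 'a::metric_space" and l :: "'e \<Rightarrow> real"
  assumes E: "finite E" and V: "finite V" and l: "\<And>e. e \<in> E \<Longrightarrow> l e > 0"
    and c: "\<And>e s t. e \<in> E \<Longrightarrow> s \<in> {0..l e} \<Longrightarrow> t \<in> {0..l e} \<Longrightarrow> dist (c e s) (c e t) = \<bar>s - t\<bar>"
    and ends: "\<And>e. e \<in> E \<Longrightarrow> c e 0 \<in> V" "\<And>e. e \<in> E \<Longrightarrow> c e (l e) \<in> V"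
    and inner: "\<And>e t. e \<in> E \<Longrightarrow> 0 < t \<Longrightarrow> t < l e \<Longrightarrow> c e t \<notin> V"
    and disj: "\<And>e e' s t. e \<in> E \<Longrightarrow> e' \<in> E \<Longrightarrow> e \<noteq> e' \<Longrightarrow> s \<in> {0..l e} \<Longrightarrow> t \<in> {0..l e'} \<Longrightarrow>
      c e s = c e' t \<Longrightarrow> c e s \<in> V"
  obtains A M where "finite A" "finite M" "V \<subseteq> A"
    "\<And>e t. e \<in> E \<Longrightarrow> t \<in> {0..l e} \<Longrightarrow> \<exists>s\<in>{0..l e}. \<exists>u\<in>{0..l e}. c e s \<in> A \<and> c e u \<in> M \<and>
      t \<in> closed_segment s u \<and> (\<forall>a\<in>A. dist (c e u) (c e s) \<le> dist (c e u) a)"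
proof -
  have cont: "continuous_on {0..l e} (c e)" if "e \<in> E" for e
    unfolding continuous_on_iff using c [OF that] by (metis dist_real_def)
  have comp: "compact (c e ` {a..b})" if "e \<in> E" "0 \<le> a" "b \<le> l e" for e a b
    using that by (intro compact_continuous_image continuous_on_subset [OF cont]) auto
  have on_edge: "p = c e 0 \<or> p = c e (l e)" if p: "p \<in> V" "e \<in> E" "p \<in> c e ` {0..l e}" for p e
  proof -
    obtain t where t: "0 \<le> t" "t \<le> l e" "p = c e t" using p(3) by auto
    have "\<not> (0 < t \<and> t < l e)" using inner [OF p(2)] p(1) t(3) by blast
    then have "t = 0 \<or> t = l e" using t by linarith
    then show ?thesis using t(3) by blast
  qed
  \<comment> \<open>Three bounds make up \<open>\<epsilon>\<close>: \<open>e1\<close> leaves a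
    middle part on every edge, \<open>e2\<close> separates a vertex from the edges that miss it, and
    \<open>e3\<close> separates the vertices from each other.\<close>
  have "\<exists>d>0. \<forall>e\<in>E. 2 * d < l e"
  proof (rule finite_common_bound [OF E])
    show "\<exists>d>0. 2 * d < l e" if "e \<in> E" for e
      using l [OF that] by (intro exI [of _ "l e / 3"]) auto
  qed auto
  then obtain e1 where e1: "e1 > 0" "\<And>e. e \<in> E \<Longrightarrow> 2 * e1 < l e" by auto
  have "\<exists>d>0. \<forall>i\<in>V \<times> E. fst i \<notin> c (snd i) ` {0..l (snd i)} \<longrightarrow>
      (\<forall>t\<in>{0..l (snd i)}. d \<le> dist (fst i) (c (snd i) t))"
  proof (rule finite_common_bound)
    show "finite (V \<times> E)" using V E by simp
    fix i assume i: "i \<in> V \<times> E"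
    show "\<exists>d>0. fst i \<notin> c (snd i) ` {0..l (snd i)} \<longrightarrow>
      (\<forall>t\<in>{0..l (snd i)}. d \<le> dist (fst i) (c (snd i) t))"
    proof (cases "fst i \<in> c (snd i) ` {0..l (snd i)}")
      case True
      then show ?thesis by (auto intro: exI [of _ 1])
    next
      case False
      then have "{fst i} \<inter> c (snd i) ` {0..l (snd i)} = {}" by auto
      then obtain d where "d > 0" "\<forall>x\<in>{fst i}. \<forall>y\<in>c (snd i) ` {0..l (snd i)}. d \<le> dist x y"
        using compact_disjoint_dist_ge [of "{fst i}" "c (snd i) ` {0..l (snd i)}"] comp i by force
      then show ?thesis by auto
    qed
  qed (meson order_trans)
  then obtain e2 where e2: "e2 > 0" "\<And>p e t. p \<in> V \<Longrightarrow> e \<in> E \<Longrightarrow> p \<notin> c e ` {0..l e} \<Longrightarrow>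
      t \<in> {0..l e} \<Longrightarrow> e2 \<le> dist p (c e t)"
    by force
  have "\<exists>d>0. \<forall>i\<in>V \<times> V. fst i \<noteq> snd i \<longrightarrow> d \<le> dist (fst i) (snd i)"
  proof (rule finite_common_bound)
    show "\<exists>d>0. fst i \<noteq> snd i \<longrightarrow> d \<le> dist (fst i) (snd i)" for i :: "'a \<times> 'a"
      by (cases "fst i = snd i") (auto intro: exI [of _ "dist (fst i) (snd i)"] exI [of _ 1])
  qed (use V in auto)
  then obtain e3 where e3: "e3 > 0" "\<And>p q. p \<in> V \<Longrightarrow> q \<in> V \<Longrightarrow> p \<noteq> q \<Longrightarrow> e3 \<le> dist p q"
    by force
  define \<epsilon> where "\<epsilon> = min e1 (min e2 e3)"
  have \<epsilon>: "\<epsilon> > 0" "\<And>e. e \<in> E \<Longrightarrow> 2 * \<epsilon> < l e"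
    "\<And>p q. p \<in> V \<Longrightarrow> q \<in> V \<Longrightarrow> p \<noteq> q \<Longrightarrow> \<epsilon> \<le> dist p q"
    using e1 e2(1) e3 by (fastforce simp: \<epsilon>_def min_def)+
  \<comment> \<open>A vertex on the edge is one of its ends, and then arc length gives the bound;
    otherwise \<open>e2\<close> does.\<close>
  have \<epsilon>V: "\<epsilon> \<le> dist p (c e t)" if "p \<in> V" "e \<in> E" "t \<in> {\<epsilon>..l e - \<epsilon>}" for p e t
  proof (cases "p \<in> c e ` {0..l e}")
    case True
    from on_edge [OF that(1,2) True] show ?thesis
      using c [of e 0 t] c [of e "l e" t] that \<epsilon>(1) l [OF that(2)] by auto
  next
    case False
    then have "e2 \<le> dist p (c e t)" using e2(2) that \<epsilon>(1) by auto
    then show ?thesis by (simp add: \<epsilon>_def)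
  qed
  have comp': "compact (c e ` {\<epsilon>..l e - \<epsilon>})" if "e \<in> E" for e
    using that \<epsilon>(1) by (intro comp) auto
  have off: "c e t \<notin> V" if "e \<in> E" "t \<in> {\<epsilon>..l e - \<epsilon>}" for e t
    using that \<epsilon>(1) by (intro inner) auto
  \<comment> \<open>Edges meet only in vertices and the middle part of an edge contains none, so
    compactness yields a positive gap to every other edge.\<close>
  have "\<exists>d>0. \<forall>i\<in>E \<times> E. fst i \<noteq> snd i \<longrightarrow>
      (\<forall>x\<in>c (fst i) ` {\<epsilon>..l (fst i) - \<epsilon>}. \<forall>y\<in>c (snd i) ` {0..l (snd i)}. d \<le> dist x y)"
  proof (rule finite_common_bound)
    show "finite (E \<times> E)" using E by simp
    fix i assume i: "i \<in> E \<times> E"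
    show "\<exists>d>0. fst i \<noteq> snd i \<longrightarrow>
      (\<forall>x\<in>c (fst i) ` {\<epsilon>..l (fst i) - \<epsilon>}. \<forall>y\<in>c (snd i) ` {0..l (snd i)}. d \<le> dist x y)"
    proof (cases "fst i = snd i")
      case True
      then show ?thesis by (auto intro: exI [of _ 1])
    next
      case False
      have "c (fst i) ` {\<epsilon>..l (fst i) - \<epsilon>} \<inter> c (snd i) ` {0..l (snd i)} = {}"
      proof (rule ccontr)
        assume "\<not> ?thesis"
        then obtain x where x: "x \<in> c (fst i) ` {\<epsilon>..l (fst i) - \<epsilon>}" "x \<in> c (snd i) ` {0..l (snd i)}"
          by blast
        obtain s where s: "s \<in> {\<epsilon>..l (fst i) - \<epsilon>}" "x = c (fst i) s" using x(1) by blast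
        obtain t where t: "t \<in> {0..l (snd i)}" "x = c (snd i) t" using x(2) by blast
        have "c (fst i) s = c (snd i) t" using s t by simp
        with s t have "c (fst i) s \<in> V"
          using i False \<epsilon>(1) by (intro disj [of "fst i" "snd i" s t]) auto
        then show False using off i s by auto
      qed
      then show ?thesis
        using compact_disjoint_dist_ge [OF comp' comp] i by (metis mem_Times_iff order_refl)
    qed
  qed (meson order_trans)
  then obtain h1 where h1: "h1 > 0" "\<And>e e' s t. e \<in> E \<Longrightarrow> e' \<in> E \<Longrightarrow> e \<noteq> e' \<Longrightarrow>
      s \<in> {\<epsilon>..l e - \<epsilon>} \<Longrightarrow> t \<in> {0..l e'} \<Longrightarrow> h1 \<le> dist (c e s) (c e' t)"
    by force
  define \<eta> where "\<eta> = min h1 \<epsilon>"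
  have \<eta>: "\<eta> > 0" "\<eta> \<le> h1" "\<eta> \<le> \<epsilon>" using h1 \<epsilon> by (auto simp: \<eta>_def)
  \<comment> \<open>With spacing at most \<open>2 * \<eta>\<close>, a midpoint is within
    \<open>\<eta>\<close> of its two neighbours. Sites on other edges are at least \<open>h1\<close>
    away and vertices at least \<open>\<epsilon>\<close>, so none of them is nearer.\<close>
  have "\<exists>n::nat. n > 0 \<and> l e - 2 * \<epsilon> \<le> real n * (2 * \<eta>)" for e
  proof -
    obtain n :: nat where "l e - 2 * \<epsilon> \<le> real n * (2 * \<eta>)"
      using reals_Archimedean3 [of "2 * \<eta>"] \<eta>(1) by (meson less_imp_le mult_pos_pos zero_less_numeral)
    then show ?thesis
      using \<eta>(1) by (intro exI [of _ "Suc n"]) (auto simp: algebra_simps)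
  qed
  then obtain N :: "'e \<Rightarrow> nat" where N: "\<And>e. N e > 0" "\<And>e. l e - 2 * \<epsilon> \<le> real (N e) * (2 * \<eta>)"
    by metis
  define \<delta> where "\<delta> e = (l e - 2 * \<epsilon>) / real (N e)" for e
  have N\<delta>: "real (N e) * \<delta> e = l e - 2 * \<epsilon>" for e
    using N(1) [of e] by (simp add: \<delta>_def)
  have \<delta>: "\<delta> e > 0" "\<delta> e \<le> 2 * \<eta>" if "e \<in> E" for e
    using N [of e] \<epsilon>(2) [OF that] by (auto simp: \<delta>_def divide_le_eq mult.commute)
  \<comment> \<open>Integer arguments from 0 to \<open>N e\<close> give the sites of the middle
    part, including the two at distance \<open>\<epsilon>\<close> from the ends; half-integers give
    midpoints.\<close>
  define pt where "pt e x = \<epsilon> + x * \<delta> e" for e x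
  have pt: "pt e x \<in> {\<epsilon>..l e - \<epsilon>}" if "e \<in> E" "0 \<le> x" "x \<le> real (N e)" for e x
    using that \<delta>(1) [OF that(1)] N\<delta> [of e] mult_right_mono [of x "real (N e)" "\<delta> e"]
    by (auto simp: pt_def)
  define A where "A = V \<union> (\<Union>e\<in>E. (\<lambda>j. c e (pt e (real j))) ` {..N e})"
  define M where "M = (\<Union>e\<in>E. {c e (\<epsilon> / 2), c e (l e - \<epsilon> / 2)} \<union> (\<lambda>j. c e (pt e (real j + 1/2))) ` {..N e})"
  have far: "a = p \<or> \<epsilon> \<le> dist p a" if "a \<in> A" "p \<in> V" for a p
  proof -
    from that(1) consider "a \<in> V" | e j where "e \<in> E" "j \<le> N e" "a = c e (pt e (real j))"
      by (auto simp: A_def)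
    then show ?thesis
    proof cases
      case 1
      then show ?thesis using \<epsilon>(3) that(2) by blast
    next
      case 2
      then show ?thesis using \<epsilon>V [OF that(2) 2(1) pt] by auto
    qed
  qed
  \<comment> \<open>Such a \<open>q\<close> has distance \<open>\<epsilon> / 2\<close> from the site
    \<open>p\<close>, and by \<open>far\<close> every other site is at least
    \<open>\<epsilon>\<close> from \<open>p\<close>.\<close>
  have nearend: "\<epsilon> / 2 \<le> dist q a" if "a \<in> A" "p \<in> V" "dist q p = \<epsilon> / 2" for a p q
    using far [OF that(1,2)] that(3) dist_triangle [of p a q] by (auto simp: dist_commute)
  have mid: "\<delta> e / 2 \<le> dist (c e (pt e (real j + 1/2))) a" if "e \<in> E" "j < N e" "a \<in> A" for e j a
  proof -
    have u: "pt e (real j + 1/2) \<in> {\<epsilon>..l e - \<epsilon>}"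
      using that(2) by (intro pt [OF that(1)]) auto
    from that(3) consider "a \<in> V" | e' i where "e' \<in> E" "i \<le> N e'" "a = c e' (pt e' (real i))"
      by (auto simp: A_def)
    then show ?thesis
    proof cases
      case 1
      then show ?thesis using \<epsilon>V [OF 1 that(1) u] \<delta>(2) [OF that(1)] \<eta> by (auto simp: dist_commute)
    next
      case 2
      have i: "pt e' (real i) \<in> {\<epsilon>..l e' - \<epsilon>}" using 2 by (intro pt) auto
      show ?thesis
      proof (cases "e' = e")
        case False
        then have "h1 \<le> dist (c e (pt e (real j + 1/2))) a"
          unfolding 2(3) using 2 i u that(1) \<epsilon>(1) by (intro h1(2)) auto
        then show ?thesis using \<delta>(2) [OF that(1)] \<eta> by auto
      next
        case True
        have "\<bar>pt e (real j + 1/2) - pt e (real i)\<bar> = \<bar>real j + 1/2 - real i\<bar> * \<delta> e"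
          using \<delta>(1) [OF that(1)] by (simp add: pt_def abs_mult flip: left_diff_distrib)
        moreover have "\<bar>real j + 1/2 - real i\<bar> \<ge> 1/2"
        proof (cases "i \<le> j")
          case False
          then have "real i \<ge> real j + 1" by linarith
          then show ?thesis by linarith
        qed auto
        ultimately have "\<bar>pt e (real j + 1/2) - pt e (real i)\<bar> \<ge> 1/2 * \<delta> e"
          using \<delta>(1) [OF that(1)] by (metis less_imp_le mult_right_mono)
        moreover have "dist (c e (pt e (real j + 1/2))) a = \<bar>pt e (real j + 1/2) - pt e (real i)\<bar>"
          unfolding 2(3) True using u i \<epsilon>(1) that(1) True by (intro c) auto
        ultimately show ?thesis by simp
      qed
    qed
  qed
  show ?thesis
  proof (rule that [of A M])
    show "finite A" "finite M" "V \<subseteq> A" using E V by (auto simp: A_def M_def)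
    fix e t assume e: "e \<in> E" and t: "t \<in> {0..l e}"
    have l2: "2 * \<epsilon> < l e" "0 < \<epsilon>" using \<epsilon> e by auto
    have goal: "\<exists>s\<in>{0..l e}. \<exists>u\<in>{0..l e}. c e s \<in> A \<and> c e u \<in> M \<and>
      t \<in> closed_segment s u \<and> (\<forall>a\<in>A. dist (c e u) (c e s) \<le> dist (c e u) a)"
      if "s \<in> {0..l e}" "u \<in> {0..l e}" "c e s \<in> A" "c e u \<in> M" "s \<le> t \<and> t \<le> u \<or> u \<le> t \<and> t \<le> s"
        "\<And>a. a \<in> A \<Longrightarrow> \<bar>u - s\<bar> \<le> dist (c e u) a" for s u
    proof (rule bexI [OF _ that(1)], rule bexI [OF _ that(2)], intro conjI ballI)
      show "t \<in> closed_segment s u"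
        using that(5) by (auto simp: closed_segment_eq_real_ivl)
    qed (use that c [OF e that(2,1)] in auto)
    have A0: "c e 0 \<in> A" "c e (l e) \<in> A" using ends e by (auto simp: A_def)
    have Aj: "c e (pt e (real j)) \<in> A" if "j \<le> N e" for j using that e by (auto simp: A_def)
    have p0: "pt e 0 = \<epsilon>" and pN: "pt e (real (N e)) = l e - \<epsilon>" using N\<delta> [of e] by (auto simp: pt_def)
    have A1: "c e \<epsilon> \<in> A" "c e (l e - \<epsilon>) \<in> A" using Aj [of 0] Aj [of "N e"] p0 pN by auto
    have M0: "c e (\<epsilon> / 2) \<in> M" "c e (l e - \<epsilon> / 2) \<in> M" using e by (auto simp: M_def)
    have n0: "\<epsilon> / 2 \<le> dist (c e (\<epsilon> / 2)) a" "\<epsilon> / 2 \<le> dist (c e (l e - \<epsilon> / 2)) a" if "a \<in> A" for a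
      using nearend [OF that ends(1) [OF e], of "c e (\<epsilon> / 2)"]
        nearend [OF that ends(2) [OF e], of "c e (l e - \<epsilon> / 2)"] c e l2 by auto
    consider "t \<le> \<epsilon> / 2" | "\<epsilon> / 2 \<le> t" "t \<le> \<epsilon>" | "\<epsilon> \<le> t" "t < l e - \<epsilon>"
      | "l e - \<epsilon> \<le> t" "t \<le> l e - \<epsilon> / 2" | "l e - \<epsilon> / 2 \<le> t" by linarith
    then show "\<exists>s\<in>{0..l e}. \<exists>u\<in>{0..l e}. c e s \<in> A \<and> c e u \<in> M \<and>
      t \<in> closed_segment s u \<and> (\<forall>a\<in>A. dist (c e u) (c e s) \<le> dist (c e u) a)"
    proof cases
      case 1
      show ?thesis by (rule goal [of 0 "\<epsilon> / 2"]) (use 1 t l2 A0 M0 n0 in auto)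
    next
      case 2
      show ?thesis by (rule goal [of \<epsilon> "\<epsilon> / 2"]) (use 2 t l2 A1 M0 n0 in auto)
    next
      case 4
      show ?thesis by (rule goal [of "l e - \<epsilon>" "l e - \<epsilon> / 2"]) (use 4 t l2 A1 M0 n0 in auto)
    next
      case 5
      show ?thesis by (rule goal [of "l e" "l e - \<epsilon> / 2"]) (use 5 t l2 A0 M0 n0 in auto)
    next
      case 3
      define x where "x = (t - \<epsilon>) / \<delta> e"
      have tx: "t = pt e x" using \<delta>(1) [OF e] by (simp add: x_def pt_def)
      have x0: "0 \<le> x" using 3 \<delta>(1) [OF e] by (simp add: x_def)
      have xN: "x < real (N e)" using 3 \<delta>(1) [OF e] N\<delta> [of e] by (simp add: x_def divide_less_eq)
      define j where "j = nat \<lfloor>x\<rfloor>"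
      have j: "real j \<le> x" "x < real j + 1" using x0 by (auto simp: j_def)
      then have jN: "j < N e" using xN by linarith
      have mono: "pt e a \<le> pt e b" if "a \<le> b" for a b
        using that \<delta>(1) [OF e] by (simp add: pt_def)
      have "c e (pt e (real j + 1/2)) \<in> (\<lambda>j. c e (pt e (real j + 1/2))) ` {..N e}"
        using jN by (intro imageI) simp
      then have "c e (pt e (real j + 1/2)) \<in> M"
        unfolding M_def using e by blast
      then have u: "pt e (real j + 1/2) \<in> {0..l e}" "c e (pt e (real j + 1/2)) \<in> M"
        using pt [OF e, of "real j + 1/2"] jN l2 by auto
      show ?thesis
      proof (cases "x \<le> real j + 1/2")
        case True
        have "\<bar>pt e (real j + 1/2) - pt e (real j)\<bar> = \<delta> e / 2"
          using \<delta>(1) [OF e] by (simp add: pt_def algebra_simps)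
        then have "\<bar>pt e (real j + 1/2) - pt e (real j)\<bar> \<le> dist (c e (pt e (real j + 1/2))) a"
          if "a \<in> A" for a using mid [OF e jN that] by simp
        moreover have "pt e (real j) \<in> {0..l e}"
          using pt [OF e, of "real j"] jN l2 by auto
        moreover have "pt e (real j) \<le> t" "t \<le> pt e (real j + 1/2)"
          using True j by (auto simp: tx intro: mono)
        ultimately show ?thesis
          using u Aj [of j] jN by (intro goal [of "pt e (real j)" "pt e (real j + 1/2)"]) auto
      next
        case False
        have "\<bar>pt e (real j + 1/2) - pt e (real j + 1)\<bar> = \<delta> e / 2"
          using \<delta>(1) [OF e] by (simp add: pt_def algebra_simps)
        then have "\<bar>pt e (real j + 1/2) - pt e (real j + 1)\<bar> \<le> dist (c e (pt e (real j + 1/2))) a"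
          if "a \<in> A" for a using mid [OF e jN that] by simp
        moreover have "c e (pt e (real j + 1)) \<in> A" using Aj [of "Suc j"] jN by (simp add: add.commute)
        moreover have "pt e (real j + 1) \<in> {0..l e}"
          using pt [OF e, of "real j + 1"] jN l2 by auto
        moreover have "pt e (real j + 1/2) \<le> t" "t \<le> pt e (real j + 1)"
          using False j by (auto simp: tx intro: mono)
        ultimately show ?thesis
          using u by (intro goal [of "pt e (real j + 1)" "pt e (real j + 1/2)"]) auto
      qed
    qed
  qed
qed

section \<open>Folding a complex of planar simplices\<close>

lemma affine_map_hull:
  assumes "linear h"
  shows "(\<lambda>x. h x + c) ` (convex hull S) = convex hull ((\<lambda>x. h x + c) ` S)"
proof -
  have *: "(\<lambda>x. h x + c) ` S = (+) c ` (h ` S)" for S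
    by (auto simp: image_image add.commute)
  show ?thesis
    unfolding * by (simp add: convex_hull_translation convex_hull_linear_image [OF assms])
qed

lemma affine_map_eq_on_hull:
  assumes h: "linear h" "linear h'" and eq: "\<And>x. x \<in> S \<Longrightarrow> h x + c = h' x + c'"
    and x: "x \<in> convex hull S"
  shows "h x + c = h' x + c'"
proof -
  have "convex {x. h x + c = h' x + c'}"
    unfolding convex_def
  proof (safe)
    fix x y and u v :: real
    assume xy: "h x + c = h' x + c'" "h y + c = h' y + c'" and uv: "u + v = 1"
    have "h (u *\<^sub>R x + v *\<^sub>R y) + c = u *\<^sub>R (h x + c) + v *\<^sub>R (h y + c)"
      using uv by (simp add: linear_add [OF h(1)] linear_scale [OF h(1)] scaleR_add_right
          flip: scaleR_add_left)
    also have "\<dots> = u *\<^sub>R (h' x + c') + v *\<^sub>R (h' y + c')" by (simp add: xy)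
    also have "\<dots> = h' (u *\<^sub>R x + v *\<^sub>R y) + c'"
      using uv by (simp add: linear_add [OF h(2)] linear_scale [OF h(2)] scaleR_add_right
          flip: scaleR_add_left)
    finally show "h (u *\<^sub>R x + v *\<^sub>R y) + c = h' (u *\<^sub>R x + v *\<^sub>R y) + c'" .
  qed
  then have "convex hull S \<subseteq> {x. h x + c = h' x + c'}"
    using eq by (intro hull_minimal) auto
  then show ?thesis using x by auto
qed

lemma affine_extension:
  fixes f :: "'a::real_vector \<Rightarrow> 'b::real_vector"
  assumes "\<not> affine_dependent S"
  obtains h c where "linear h" "\<And>x. x \<in> S \<Longrightarrow> h x + c = f x"
proof (cases "S = {}")
  case True
  then show ?thesis using that [of "\<lambda>_. 0" 0] by (simp add: module_hom_zero linear_iff)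
next
  case False
  then obtain a where a: "a \<in> S" by auto
  have ind: "independent ((\<lambda>x. - a + x) ` (S - {a}))"
    using assms affine_dependent_iff_dependent2 [OF a] by simp
  obtain h where h: "linear h" "\<And>y. y \<in> (\<lambda>x. - a + x) ` (S - {a}) \<Longrightarrow> h y = f (y + a) - f a"
    using linear_independent_extend [OF ind, of "\<lambda>y. f (y + a) - f a"] by blast
  have "h x + (f a - h a) = f x" if "x \<in> S" for x
  proof (cases "x = a")
    case False
    then have "h (- a + x) = f x - f a"
      using h(2) [of "- a + x"] that by simp
    moreover have "h (- a + x) = h x - h a"
      using linear_diff [OF h(1), of x a] by simp
    ultimately have "h x - h a = f x - f a" by metis
    then show ?thesis by (simp add: algebra_simps)
  qed simp
  then show ?thesis using that h(1) by blast
qed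

text \<open>A simplex is given by the set \<open>U\<close> of its vertices in the metric space; \<open>X U\<close> is its underlying
  set and \<open>\<psi> U\<close> develops it isometrically into the plane. Independence of the vertices
  follows from the intersection property by Radon's theorem.\<close>

locale euclidean_complex =
  fixes \<V> :: "'a::metric_space set set" and X :: "'a set \<Rightarrow> 'a set"
    and \<psi> :: "'a set \<Rightarrow> 'a \<Rightarrow> real^2"
  assumes finite_simplices: "finite \<V>"
    and card_simplex: "U \<in> \<V> \<Longrightarrow> finite U \<and> U \<noteq> {} \<and> card U \<le> 3"
    and faces: "U \<in> \<V> \<Longrightarrow> W \<subseteq> U \<Longrightarrow> W \<noteq> {} \<Longrightarrow> W \<in> \<V>"
    and X_Int: "U \<in> \<V> \<Longrightarrow> W \<in> \<V> \<Longrightarrow> X U \<inter> X W = X (U \<inter> W)"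
    and X_empty: "X {} = {}"
    and isometric_chart: "U \<in> \<V> \<Longrightarrow> x \<in> X U \<Longrightarrow> y \<in> X U \<Longrightarrow> dist (\<psi> U x) (\<psi> U y) = dist x y"
    and chart_hull: "U \<in> \<V> \<Longrightarrow> W \<subseteq> U \<Longrightarrow> \<psi> U ` X W = convex hull (\<psi> U ` W)"
    and vertices_subset: "U \<in> \<V> \<Longrightarrow> U \<subseteq> X U"
begin

lemma X_mono: "U \<in> \<V> \<Longrightarrow> W \<subseteq> U \<Longrightarrow> X W \<subseteq> X U"
  using X_Int [of U W] faces [of U W] X_empty by (cases "W = {}") (auto simp: Int_absorb1)

lemma inj_chart: "U \<in> \<V> \<Longrightarrow> inj_on (\<psi> U) (X U)"
  unfolding inj_on_def using isometric_chart by (metis dist_eq_0_iff)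

lemma X_vertex: "{v} \<in> \<V> \<Longrightarrow> X {v} = {v}"
proof -
  assume v: "{v} \<in> \<V>"
  have "\<psi> {v} ` X {v} = \<psi> {v} ` {v}"
    using chart_hull [OF v, of "{v}"] by simp
  then show ?thesis
    using inj_on_image_eq_iff [OF inj_chart [OF v], of "X {v}" "{v}"] vertices_subset [OF v] by simp
qed

lemma independent_chart:
  assumes U: "U \<in> \<V>"
  shows "\<not> affine_dependent (\<psi> U ` U)"
proof
  assume "affine_dependent (\<psi> U ` U)"
  then obtain M N where MN: "M \<subseteq> \<psi> U ` U" "N \<subseteq> \<psi> U ` U" "M \<inter> N = {}"
    "convex hull M \<inter> convex hull N \<noteq> {}"
    by (rule Radon)
  define M' N' where "M' = {u \<in> U. \<psi> U u \<in> M}" and "N' = {u \<in> U. \<psi> U u \<in> N}"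
  have M: "M = \<psi> U ` M'" "N = \<psi> U ` N'" using MN by (auto simp: M'_def N'_def)
  have sub: "M' \<subseteq> U" "N' \<subseteq> U" "M' \<inter> N' = {}" using MN(3) by (auto simp: M'_def N'_def)
  have "M' \<noteq> {}" "N' \<noteq> {}" using MN(4) M by auto
  then have V: "M' \<in> \<V>" "N' \<in> \<V>" using faces U sub by auto
  obtain z where z: "z \<in> \<psi> U ` X M'" "z \<in> \<psi> U ` X N'"
    using MN(4) unfolding M chart_hull [OF U sub(1), symmetric] chart_hull [OF U sub(2), symmetric]
    by blast
  then obtain x y where xy: "x \<in> X M'" "y \<in> X N'" "\<psi> U x = \<psi> U y" by auto
  then have "x = y"
    using X_mono [OF U sub(1)] X_mono [OF U sub(2)]
    by (intro inj_onD [OF inj_chart [OF U] xy(3)]) auto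
  then have "x \<in> X (M' \<inter> N')" using xy X_Int [OF V] by auto
  then show False using X_empty sub by simp
qed

lemma inj_chart_vertices: "U \<in> \<V> \<Longrightarrow> inj_on (\<psi> U) U"
  by (rule inj_on_subset [OF inj_chart vertices_subset])

text \<open>Arc length along the segment in the chart, carried back to the space. What remains is
  intrinsic to the metric, as \<open>edge_sites\<close> requires.\<close>

lemma edge_parametrization:
  assumes U: "U \<in> \<V>" "card U = 2"
  obtains p q c where "U = {p, q}" "p \<noteq> q" "c 0 = p" "c (dist p q) = q"
    "c ` {0..dist p q} = X U"
    "\<And>s t. s \<in> {0..dist p q} \<Longrightarrow> t \<in> {0..dist p q} \<Longrightarrow> dist (c s) (c t) = \<bar>s - t\<bar>"
proof -
  obtain p q where pq: "U = {p, q}" "p \<noteq> q" using U(2) by (auto simp: card_2_iff)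
  define l where "l = dist p q"
  have l: "l > 0" using pq by (simp add: l_def)
  define r where "r t = \<psi> U p + (t / l) *\<^sub>R (\<psi> U q - \<psi> U p)" for t
  define c where "c t = inv_into (X U) (\<psi> U) (r t)" for t
  have pX: "p \<in> X U" "q \<in> X U" using vertices_subset [OF U(1)] pq by auto
  have dpq: "norm (\<psi> U q - \<psi> U p) = l"
    using isometric_chart [OF U(1) pX(2,1)] by (simp add: dist_norm l_def norm_minus_commute dist_commute)
  have img: "\<psi> U ` X U = closed_segment (\<psi> U p) (\<psi> U q)"
    using chart_hull [OF U(1) order_refl] pq by (simp add: segment_convex_hull)
  have rimg: "r ` {0..l} = closed_segment (\<psi> U p) (\<psi> U q)"
  proof
    show "r ` {0..l} \<subseteq> closed_segment (\<psi> U p) (\<psi> U q)"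
    proof
      fix z assume "z \<in> r ` {0..l}"
      then obtain t where t: "0 \<le> t" "t \<le> l" "z = r t" by auto
      then show "z \<in> closed_segment (\<psi> U p) (\<psi> U q)"
        unfolding closed_segment_def r_def using l
        by (intro CollectI exI [of _ "t / l"]) (auto simp: algebra_simps)
    qed
    show "closed_segment (\<psi> U p) (\<psi> U q) \<subseteq> r ` {0..l}"
    proof
      fix z assume "z \<in> closed_segment (\<psi> U p) (\<psi> U q)"
      then obtain u where u: "0 \<le> u" "u \<le> 1" "z = (1 - u) *\<^sub>R \<psi> U p + u *\<^sub>R \<psi> U q"
        by (auto simp: closed_segment_def)
      then have "z = r (u * l)" using l by (simp add: r_def algebra_simps)
      moreover have "u * l \<in> {0..l}" using u l mult_right_mono [of u 1 l] by auto
      ultimately show "z \<in> r ` {0..l}" by blast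
    qed
  qed
  have c: "c t \<in> X U" "\<psi> U (c t) = r t" if "t \<in> {0..l}" for t
  proof -
    have "r t \<in> \<psi> U ` X U" using that rimg img by auto
    then show "c t \<in> X U" "\<psi> U (c t) = r t"
      unfolding c_def by (auto intro: inv_into_into f_inv_into_f)
  qed
  show ?thesis
  proof (rule that [of p q c])
    show "U = {p, q}" "p \<noteq> q" by fact+
    have "r 0 = \<psi> U p" "r l = \<psi> U q" using l by (auto simp: r_def)
    then show "c 0 = p" "c (dist p q) = q"
      using inv_into_f_f [OF inj_chart [OF U(1)]] pX by (auto simp: c_def l_def [symmetric])
    have 1: "\<psi> U ` c ` {0..l} = \<psi> U ` X U"
      using c(2) rimg img by (simp add: image_image)
    have 2: "c ` {0..l} \<subseteq> X U" using c(1) by blast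
    show "c ` {0..dist p q} = X U"
      using 1 inj_on_image_eq_iff [OF inj_chart [OF U(1)] 2 order_refl] unfolding l_def by blast
    fix s t assume "s \<in> {0..dist p q}" "t \<in> {0..dist p q}"
    then have st: "s \<in> {0..l}" "t \<in> {0..l}" by (auto simp: l_def)
    then have "dist (c s) (c t) = dist (r s) (r t)"
      using isometric_chart [OF U(1) c(1) c(1)] c(2) by metis
    also have "r s - r t = ((s - t) / l) *\<^sub>R (\<psi> U q - \<psi> U p)"
      by (simp add: r_def diff_divide_distrib scaleR_left_diff_distrib)
    then have "dist (r s) (r t) = \<bar>s - t\<bar>"
      using l by (simp add: dist_norm dpq)
    finally show "dist (c s) (c t) = \<bar>s - t\<bar>" .
  qed
qed

text \<open>Betweenness is expressed by distances, so that every chart containing \<open>W\<close>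
  can read it as membership in a segment. The site is nearest among all of \<open>A\<close>, hence
  also among the sites visible in any one chart.\<close>

lemma sites:
  obtains A M where "finite A" "finite M"
    "\<And>W x. W \<in> \<V> \<Longrightarrow> card W \<le> 2 \<Longrightarrow> x \<in> X W \<Longrightarrow> \<exists>s\<in>A \<inter> X W. \<exists>m\<in>M \<inter> X W.
      dist s m = dist s x + dist x m \<and> (\<forall>a\<in>A. dist m s \<le> dist m a)"
proof -
  define E where "E = {U \<in> \<V>. card U = 2}"
  define V where "V = \<Union>\<V>"
  have vV: "{v} \<in> \<V>" if "v \<in> V" for v
    using that faces by (auto simp: V_def)
  \<comment> \<open>One relation for all data of an edge, so that a single choice picks end points
    and parametrization together.\<close>
  define R where "R U = (\<lambda>(p, q, c). {p, q} = U \<and> p \<noteq> q \<and> c 0 = p \<and> c (dist p q) = q \<and>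
      c ` {0..dist p q} = X U \<and>
      (\<forall>s\<in>{0..dist p q}. \<forall>t\<in>{0..dist p q}. dist (c s) (c t) = \<bar>s - t\<bar>))" for U
  have "\<exists>z. R U z" if "U \<in> E" for U
  proof -
    have U: "U \<in> \<V>" "card U = 2" using that by (auto simp: E_def)
    show ?thesis
    proof (rule edge_parametrization [OF U])
      fix p q and c :: "real \<Rightarrow> 'a"
      assume *: "U = {p, q}" "p \<noteq> q" "c 0 = p" "c (dist p q) = q" "c ` {0..dist p q} = X U"
        "\<And>s t. s \<in> {0..dist p q} \<Longrightarrow> t \<in> {0..dist p q} \<Longrightarrow> dist (c s) (c t) = \<bar>s - t\<bar>"
      have "R U (p, q, c)"
        unfolding R_def prod.case using * by simp
      then show ?thesis ..
    qed
  qed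
  then have "\<forall>U\<in>E. \<exists>z. R U z" by (rule ballI)
  from bchoice [OF this] obtain z where z: "\<And>U. U \<in> E \<Longrightarrow> R U (z U)" by blast
  define p q c where "p U = fst (z U)" and "q U = fst (snd (z U))" and "c U = snd (snd (z U))" for U
  have R: "R U (p U, q U, c U)" if "U \<in> E" for U
    using z [OF that] by (simp add: p_def q_def c_def)
  define l where "l U = dist (p U) (q U)" for U
  have E: "{p U, q U} = U" "p U \<noteq> q U" "c U 0 = p U" "c U (l U) = q U"
    "c U ` {0..l U} = X U"
    "\<And>s t. s \<in> {0..l U} \<Longrightarrow> t \<in> {0..l U} \<Longrightarrow> dist (c U s) (c U t) = \<bar>s - t\<bar>"
    if "U \<in> E" for U
    using R [OF that] unfolding R_def prod.case l_def [symmetric] by (elim conjE; simp only:; blast?)+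
  have l: "l U > 0" if "U \<in> E" for U using E(2) [OF that] by (simp add: l_def)
  have pq: "p U \<in> V" "q U \<in> V" if "U \<in> E" for U
    using E(1) [OF that] that unfolding E_def V_def by auto
  \<comment> \<open>By the intersection property a vertex on \<open>X U\<close> belongs to
    \<open>U\<close>, so it is an end; arc length places the ends at the parameters 0 and
    \<open>l U\<close> only.\<close>
  have inner: "c U t \<notin> V" if U: "U \<in> E" and t: "0 < t" "t < l U" for U t
  proof
    assume "c U t \<in> V"
    then have v: "{c U t} \<in> \<V>" by (rule vV)
    have "c U t \<in> X U" using E(5) [OF U] t by auto
    then have "c U t \<in> X (U \<inter> {c U t})"
      using X_Int [OF _ v, of U] X_vertex [OF v] U by (auto simp: E_def)
    then have "c U t \<in> U" using X_empty by (cases "c U t \<in> U") auto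
    then have "c U t = c U 0 \<or> c U t = c U (l U)" using E(1,3,4) [OF U] by (metis insertE singletonD)
    then show False
      using E(6) [OF U, of t 0] E(6) [OF U, of t "l U"] t by auto
  qed
  \<comment> \<open>Distinct edges share at most one vertex, and by \<open>X_Int\<close> their
    underlying sets meet at most there.\<close>
  have disj: "c U s \<in> V" if U: "U \<in> E" "U' \<in> E" "U \<noteq> U'" and st: "s \<in> {0..l U}" "t \<in> {0..l U'}"
    and eq: "c U s = c U' t" for U U' s t
  proof -
    have "c U s \<in> X U" using E(5) [OF U(1)] st(1) by blast
    moreover have "c U s \<in> X U'" unfolding eq using E(5) [OF U(2)] st(2) by blast
    ultimately have x: "c U s \<in> X (U \<inter> U')" using X_Int [of U U'] U by (auto simp: E_def)
    then have ne: "U \<inter> U' \<noteq> {}" using X_empty by auto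
    have cU: "card U = 2" "card U' = 2" "finite U" "finite U'"
      using U card_simplex by (auto simp: E_def)
    have "U \<inter> U' \<noteq> U"
      using card_subset_eq [OF cU(4), of U] cU U(3) by auto
    then have "card (U \<inter> U') < 2"
      using psubset_card_mono [OF cU(3), of "U \<inter> U'"] cU(1) by auto
    moreover have "card (U \<inter> U') > 0"
      using ne cU by (simp add: card_gt_0_iff)
    ultimately have "card (U \<inter> U') = 1" by linarith
    then obtain v where v: "U \<inter> U' = {v}" by (rule card_1_singletonE)
    then have v': "v \<in> V" using U(1) by (auto simp: E_def V_def)
    then have "c U s = v" using x v X_vertex [OF vV [OF v']] by simp
    then show ?thesis using v' by simp
  qed
  have fin: "finite E" "finite V"
    using finite_simplices card_simplex by (auto simp: E_def V_def)
  obtain A M where AM: "finite A" "finite M" "V \<subseteq> A"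
    "\<And>U t. U \<in> E \<Longrightarrow> t \<in> {0..l U} \<Longrightarrow> \<exists>s\<in>{0..l U}. \<exists>u\<in>{0..l U}. c U s \<in> A \<and> c U u \<in> M \<and>
      t \<in> closed_segment s u \<and> (\<forall>a\<in>A. dist (c U u) (c U s) \<le> dist (c U u) a)"
  proof (rule edge_sites [OF fin, of l c])
    show "c U 0 \<in> V" "c U (l U) \<in> V" if "U \<in> E" for U using pq E(3,4) that by auto
  qed (use l E(6) inner disj in auto)
  show ?thesis
  \<comment> \<open>Adding \<open>V\<close> covers the zero-dimensional \<open>W\<close>: a vertex
    is its own site and its own midpoint.\<close>
  proof (rule that [of A "M \<union> V"])
    show "finite A" "finite (M \<union> V)" using AM fin by auto
    fix W x assume W: "W \<in> \<V>" "card W \<le> 2" and x: "x \<in> X W"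
    have "card W > 0" using card_simplex [OF W(1)] by (auto simp: card_gt_0_iff)
    then consider "card W = 1" | "card W = 2" using W(2) by linarith
    then show "\<exists>s\<in>A \<inter> X W. \<exists>m\<in>(M \<union> V) \<inter> X W.
      dist s m = dist s x + dist x m \<and> (\<forall>a\<in>A. dist m s \<le> dist m a)"
    proof cases
      case 1
      then obtain v where v: "W = {v}" by (auto simp: card_1_singleton_iff)
      then have "x = v" using x X_vertex W by auto
      moreover have "v \<in> V" using W v by (auto simp: V_def)
      ultimately show ?thesis using AM(3) x by (intro bexI [of _ v]) auto
    next
      case 2
      then have U: "W \<in> E" using W by (auto simp: E_def)
      have "x \<in> c W ` {0..l W}" using E(5) [OF U] x by simp
      then obtain t where t: "t \<in> {0..l W}" "x = c W t" by (rule imageE)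
      obtain s u where su: "s \<in> {0..l W}" "u \<in> {0..l W}" "c W s \<in> A" "c W u \<in> M"
        "t \<in> closed_segment s u" "\<forall>a\<in>A. dist (c W u) (c W s) \<le> dist (c W u) a"
        using AM(4) [OF U t(1)] by blast
      have X: "c W s \<in> X W" "c W u \<in> X W"
        unfolding E(5) [OF U, symmetric] using su(1,2) by (auto intro: imageI)
      have "\<bar>s - u\<bar> = \<bar>s - t\<bar> + \<bar>t - u\<bar>"
      proof -
        have "s \<le> t \<and> t \<le> u \<or> u \<le> t \<and> t \<le> s"
          using su(5) unfolding closed_segment_eq_real_ivl by (simp split: if_splits)
        then show ?thesis by linarith
      qed
      then have d: "dist (c W s) (c W u) = dist (c W s) x + dist x (c W u)"
        using E(6) [OF U su(1,2)] E(6) [OF U su(1) t(1)] E(6) [OF U t(1) su(2)] t(2) by metis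
      show ?thesis
      proof (rule bexI, rule bexI, rule conjI)
        show "c W s \<in> A \<inter> X W" "c W u \<in> (M \<union> V) \<inter> X W"
          using su(3,4) X by blast+
      qed (fact d, fact su(6))
    qed
  qed
qed

text \<open>Each simplex is folded using only the sites and midpoints lying in it. A site and
  midpoint found on a common face lie in both simplices, and the site is nearest in both, so both
  maps take the same value.\<close>

lemma folding_map:
  obtains f :: "'a \<Rightarrow> real^2" and H :: "'a set \<Rightarrow> real^2 \<Rightarrow> real^2"
  where "\<And>U. U \<in> \<V> \<Longrightarrow> piecewise_isometric (H U)"
    "\<And>U x. U \<in> \<V> \<Longrightarrow> x \<in> X U \<Longrightarrow> f x = H U (\<psi> U x)"
proof -
  obtain A M where AM: "finite A" "finite M"
    and near: "\<And>W x. W \<in> \<V> \<Longrightarrow> card W \<le> 2 \<Longrightarrow> x \<in> X W \<Longrightarrow> \<exists>s\<in>A \<inter> X W. \<exists>m\<in>M \<inter> X W.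
      dist s m = dist s x + dist x m \<and> (\<forall>a\<in>A. dist m s \<le> dist m a)"
    using sites by metis
  \<comment> \<open>The requirement on \<open>H\<close> mentions the chart only as an argument: the
    prescribed value is intrinsic and can be compared for different \<open>U\<close>.\<close>
  define Q where "Q U H \<longleftrightarrow> piecewise_isometric H \<and>
    (\<forall>s\<in>A \<inter> X U. \<forall>m\<in>M \<inter> X U. (\<forall>a\<in>A. dist m s \<le> dist m a) \<longrightarrow>
      (\<forall>x\<in>X U. dist s m = dist s x + dist x m \<longrightarrow> H (\<psi> U x) = vector [dist s x, 0]))"
    for U and H :: "real^2 \<Rightarrow> real^2"
  have "\<exists>H. Q U H" if U: "U \<in> \<V>" for U
  proof -
    obtain H :: "real^2 \<Rightarrow> real^2" where H: "piecewise_isometric H"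
      "\<And>m s x. m \<in> \<psi> U ` (M \<inter> X U) \<Longrightarrow> s \<in> \<psi> U ` (A \<inter> X U) \<Longrightarrow>
        (\<And>a. a \<in> \<psi> U ` (A \<inter> X U) \<Longrightarrow> dist m s \<le> dist m a) \<Longrightarrow>
        x \<in> closed_segment s m \<Longrightarrow> H x = vector [dist s x, 0]"
      using fold_onto_axis [of "\<psi> U ` (A \<inter> X U)" "\<psi> U ` (M \<inter> X U)"] AM by auto
    have "H (\<psi> U x) = vector [dist s x, 0]"
      if s: "s \<in> A \<inter> X U" and m: "m \<in> M \<inter> X U" and n: "\<forall>a\<in>A. dist m s \<le> dist m a"
        and x: "x \<in> X U" and d: "dist s m = dist s x + dist x m" for s m x
    proof -
      have "H (\<psi> U x) = vector [dist (\<psi> U s) (\<psi> U x), 0]"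
      proof (rule H(2) [of "\<psi> U m"])
        show "\<psi> U m \<in> \<psi> U ` (M \<inter> X U)" "\<psi> U s \<in> \<psi> U ` (A \<inter> X U)" using s m by auto
        show "\<psi> U x \<in> closed_segment (\<psi> U s) (\<psi> U m)"
          using isometric_chart [OF U] s m x d
          by (simp add: between_mem_segment [symmetric] between)
        fix a assume "a \<in> \<psi> U ` (A \<inter> X U)"
        then obtain b where b: "b \<in> A" "b \<in> X U" "a = \<psi> U b" by auto
        then show "dist (\<psi> U m) (\<psi> U s) \<le> dist (\<psi> U m) a"
          using isometric_chart [OF U] s m n by simp
      qed
      then show ?thesis using isometric_chart [OF U] s x by simp
    qed
    then have "Q U H" unfolding Q_def using H(1) by simp
    then show ?thesis by blast
  qed
  then have "\<forall>U\<in>\<V>. \<exists>H. Q U H" by simp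
  from bchoice [OF this] obtain H where H: "\<forall>U\<in>\<V>. Q U (H U)" by blast
  have glue: "H U (\<psi> U x) = H U' (\<psi> U' x)"
    if U: "U \<in> \<V>" "U' \<in> \<V>" and x: "x \<in> X U" "x \<in> X U'" for U U' x
  proof (cases "U = U'")
    case False
    have xI: "x \<in> X (U \<inter> U')" using X_Int [OF U] x by blast
    then have "U \<inter> U' \<noteq> {}" using X_empty by auto
    then have W: "U \<inter> U' \<in> \<V>" using faces [OF U(1)] by simp
    have "card (U \<inter> U') < 3"
    proof (cases "U \<inter> U' = U")
      case True
      then have "U \<subset> U'" using False by blast
      then show ?thesis
        using psubset_card_mono [of U' U] card_simplex [OF U(2)] True by simp
    next
      case False
      then have "U \<inter> U' \<subset> U" by blast
      then show ?thesis
        using psubset_card_mono [of U "U \<inter> U'"] card_simplex [OF U(1)] by simp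
    qed
    then have "card (U \<inter> U') \<le> 2" by simp
    from near [OF W this xI] obtain s m where sm: "s \<in> A \<inter> X (U \<inter> U')" "m \<in> M \<inter> X (U \<inter> U')"
      "dist s m = dist s x + dist x m" "\<forall>a\<in>A. dist m s \<le> dist m a" by blast
    have "H V (\<psi> V x) = vector [dist s x, 0]" if V: "V \<in> \<V>" "U \<inter> U' \<subseteq> V" "x \<in> X V" for V
    proof -
      have "s \<in> A \<inter> X V" "m \<in> M \<inter> X V" using sm(1,2) X_mono [OF V(1,2)] by auto
      moreover have "Q V (H V)" using H V(1) by simp
      ultimately show ?thesis unfolding Q_def using sm(3,4) V(3) by simp
    qed
    then show ?thesis using U x by simp
  qed simp
  define f where "f x = (let U = (SOME U. U \<in> \<V> \<and> x \<in> X U) in H U (\<psi> U x))" for x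
  show ?thesis
  proof (rule that)
    show "piecewise_isometric (H U)" if "U \<in> \<V>" for U using H that by (simp add: Q_def)
    show "f x = H U (\<psi> U x)" if U: "U \<in> \<V>" "x \<in> X U" for U x
    proof -
      have "(SOME U. U \<in> \<V> \<and> x \<in> X U) \<in> \<V> \<and> x \<in> X (SOME U. U \<in> \<V> \<and> x \<in> X U)"
        using someI [of "\<lambda>U. U \<in> \<V> \<and> x \<in> X U" U] U by simp
      then show ?thesis unfolding f_def Let_def using U by (intro glue) simp_all
    qed
  qed
qed

text \<open>A model of the complex in which every chart becomes an affine function of the new
  coordinates, so that planar walls pull back to hyperplanes. The map \<open>\<eta>\<close> replaces
  the original triangulating homeomorphism.\<close>

lemma realization:
  obtains C :: "'a set \<Rightarrow> (real \<times> real \<times> real \<times> real \<times> real) set" and \<eta>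
    and h :: "'a set \<Rightarrow> real \<times> real \<times> real \<times> real \<times> real \<Rightarrow> real^2" and c :: "'a set \<Rightarrow> real^2"
  where "\<And>U. U \<in> \<V> \<Longrightarrow> polytope (C U)"
    "\<And>U W. U \<in> \<V> \<Longrightarrow> W \<in> \<V> \<Longrightarrow> C U \<inter> C W face_of C U"
    "\<And>U. U \<in> \<V> \<Longrightarrow> linear (h U)"
    "\<And>U. U \<in> \<V> \<Longrightarrow> inj_on (\<lambda>x. h U x + c U) (C U)"
    "\<And>U x. U \<in> \<V> \<Longrightarrow> x \<in> C U \<Longrightarrow> \<eta> x \<in> X U \<and> \<psi> U (\<eta> x) = h U x + c U"
    "\<And>U. U \<in> \<V> \<Longrightarrow> \<eta> ` C U = X U"
    "inj_on \<eta> (\<Union> (C ` \<V>))"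
proof -
  have finV: "finite (\<Union>\<V>)" using finite_simplices card_simplex by auto
  obtain \<gamma> :: "'a \<Rightarrow> real \<times> real \<times> real \<times> real \<times> real" where \<gamma>: "inj_on \<gamma> (\<Union>\<V>)"
    "\<And>W. W \<subseteq> \<Union>\<V> \<Longrightarrow> card W \<le> 6 \<Longrightarrow> \<not> affine_dependent (\<gamma> ` W)"
    using general_position [OF finV] by metis
  have ind: "\<not> affine_dependent (\<gamma> ` U)" if "U \<in> \<V>" for U
    using \<gamma>(2) [of U] card_simplex [OF that] that by auto
  have inj\<gamma>: "inj_on \<gamma> U" if "U \<in> \<V>" for U
    using inj_on_subset [OF \<gamma>(1)] that by blast
  define C where "C U = convex hull (\<gamma> ` U)" for U
  have C_mono: "C W \<subseteq> C U" if "W \<subseteq> U" for U W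
    unfolding C_def using that by (intro hull_mono image_mono)
  \<comment> \<open>The reason for dimension five: the vertices of both simplices together are at
    most six and therefore affinely independent.\<close>
  have C_Int: "C U \<inter> C W = C (U \<inter> W)" if "U \<in> \<V>" "W \<in> \<V>" for U W
  proof -
    have "card (U \<union> W) \<le> 6"
      using card_Un_le [of U W] card_simplex [OF that(1)] card_simplex [OF that(2)] by linarith
    then have "\<not> affine_dependent (\<gamma> ` U \<union> \<gamma> ` W)"
      using \<gamma>(2) [of "U \<union> W"] that by (auto simp: image_Un)
    moreover have "\<gamma> ` U \<inter> \<gamma> ` W = \<gamma> ` (U \<inter> W)"
      using that by (intro inj_on_image_Int [OF \<gamma>(1), symmetric]) auto
    ultimately show ?thesis
      unfolding C_def using convex_hull_Int by metis
  qed
  have "\<exists>hc. linear (fst hc) \<and> (\<forall>v\<in>U. fst hc (\<gamma> v) + snd hc = \<psi> U v)" if U: "U \<in> \<V>" for U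
  proof -
    obtain h c where hc: "linear h" "\<And>x. x \<in> \<gamma> ` U \<Longrightarrow> h x + c = \<psi> U (inv_into U \<gamma> x)"
      using affine_extension [OF ind [OF U], of "\<lambda>x. \<psi> U (inv_into U \<gamma> x)"] by blast
    have "linear (fst (h, c)) \<and> (\<forall>v\<in>U. fst (h, c) (\<gamma> v) + snd (h, c) = \<psi> U v)"
      using hc inv_into_f_f [OF inj\<gamma> [OF U]] by simp
    then show ?thesis by blast
  qed
  then have "\<forall>U\<in>\<V>. \<exists>hc. linear (fst hc) \<and> (\<forall>v\<in>U. fst hc (\<gamma> v) + snd hc = \<psi> U v)"
    by simp
  from bchoice [OF this] obtain hc where
    hc: "\<forall>U\<in>\<V>. linear (fst (hc U)) \<and> (\<forall>v\<in>U. fst (hc U) (\<gamma> v) + snd (hc U) = \<psi> U v)"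
    by blast
  define h c where "h U = fst (hc U)" and "c U = snd (hc U)" for U
  have lin: "linear (h U)" if "U \<in> \<V>" for U using hc that by (simp add: h_def)
  have h\<gamma>: "h U (\<gamma> v) + c U = \<psi> U v" if "U \<in> \<V>" "v \<in> U" for U v
    using hc that by (simp add: h_def c_def)
  have AC: "(\<lambda>x. h U x + c U) ` C U = \<psi> U ` X U" if U: "U \<in> \<V>" for U
  proof -
    have "(\<lambda>x. h U x + c U) ` \<gamma> ` U = \<psi> U ` U"
      using h\<gamma> [OF U] by (simp add: image_image)
    then show ?thesis
      unfolding C_def affine_map_hull [OF lin [OF U]] chart_hull [OF U order_refl] by simp
  qed
  \<comment> \<open>The vertices are independent in the chart too, so an affine map in the other
    direction exists. It is an inverse at the vertices, hence on their hull.\<close>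
  have injA: "inj_on (\<lambda>x. h U x + c U) (C U)" if U: "U \<in> \<V>" for U
  proof -
    obtain k d where k: "linear k" "\<And>y. y \<in> \<psi> U ` U \<Longrightarrow> k y + d = \<gamma> (inv_into U (\<psi> U) y)"
      using affine_extension [OF independent_chart [OF U], of "\<lambda>y. \<gamma> (inv_into U (\<psi> U) y)"] by blast
    have kv: "k (\<psi> U v) + d = \<gamma> v" if "v \<in> U" for v
      using k(2) inv_into_f_f [OF inj_chart_vertices [OF U]] that by simp
    have "k (h U x + c U) + d = x" if x: "x \<in> C U" for x
    proof -
      have "(k \<circ> h U) x + (k (c U) + d) = id x + 0"
      proof (rule affine_map_eq_on_hull [of "k \<circ> h U" id "\<gamma> ` U" "k (c U) + d" 0])
        show "linear (k \<circ> h U)" by (rule linear_compose [OF lin [OF U] k(1)])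
        show "linear id" by (rule linear_id)
        show "x \<in> convex hull (\<gamma> ` U)" using x by (simp add: C_def)
        fix y assume "y \<in> \<gamma> ` U"
        then obtain v where v: "v \<in> U" "y = \<gamma> v" by auto
        have "(k \<circ> h U) y + (k (c U) + d) = k (h U y + c U) + d"
          by (simp add: linear_add [OF k(1)])
        then show "(k \<circ> h U) y + (k (c U) + d) = id y + 0"
          using h\<gamma> [OF U v(1)] kv [OF v(1)] v(2) by simp
      qed
      then show ?thesis
        unfolding linear_add [OF k(1)] o_def id_apply by (simp only: add.assoc add_0_right)
    qed
    then show ?thesis by (intro inj_on_inverseI [where g = "\<lambda>y. k y + d"])
  qed
  define \<eta>' where "\<eta>' U x = inv_into (X U) (\<psi> U) (h U x + c U)" for U x
  have \<eta>': "\<eta>' U x \<in> X U" "\<psi> U (\<eta>' U x) = h U x + c U" if "U \<in> \<V>" "x \<in> C U" for U x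
  proof -
    have "h U x + c U \<in> \<psi> U ` X U" using AC [OF that(1)] that(2) by blast
    then show "\<eta>' U x \<in> X U" "\<psi> U (\<eta>' U x) = h U x + c U"
      unfolding \<eta>'_def by (rule inv_into_into, rule f_inv_into_f)
  qed
  have \<eta>'_img: "\<eta>' U ` C U = X U" if U: "U \<in> \<V>" for U
  proof -
    have 1: "\<psi> U ` \<eta>' U ` C U = \<psi> U ` X U"
      unfolding AC [OF U, symmetric] image_image using \<eta>'(2) [OF U] by (intro image_cong) auto
    have 2: "\<eta>' U ` C U \<subseteq> X U" using \<eta>'(1) [OF U] by blast
    show ?thesis
      using 1 inj_on_image_eq_iff [OF inj_chart [OF U] 2 order_refl] by blast
  qed
  \<comment> \<open>The change of charts from \<open>W\<close> to \<open>U\<close> is isometric,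
    hence affine, and affine maps that agree at the vertices of \<open>W\<close> agree on
    \<open>C W\<close>.\<close>
  have \<eta>'_face: "\<eta>' W x = \<eta>' U x" if U: "U \<in> \<V>" and WU: "W \<subseteq> U" and W: "W \<in> \<V>" and x: "x \<in> C W"
    for U W x
  proof -
    have sub: "X W \<subseteq> X U" by (rule X_mono [OF U WU])
    define g where "g z = \<psi> U (inv_into (X W) (\<psi> W) z)" for z
    have g: "g (\<psi> W y) = \<psi> U y" if "y \<in> X W" for y
      using inv_into_f_f [OF inj_chart [OF W] that] by (simp add: g_def)
    have "dist (g z) (g z') = dist z z'" if z: "z \<in> \<psi> W ` X W" "z' \<in> \<psi> W ` X W" for z z'
    proof -
      obtain y y' where y: "y \<in> X W" "z = \<psi> W y" "y' \<in> X W" "z' = \<psi> W y'" using z by auto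
      then show ?thesis
        using g isometric_chart [OF U, of y y'] isometric_chart [OF W, of y y'] sub
        by (simp add: subset_iff)
    qed
    then obtain k d where k: "linear k" "\<And>z. z \<in> \<psi> W ` X W \<Longrightarrow> g z = k z + d"
      using isometric_imp_affine [of "\<psi> W ` X W" g] by blast
    have kg: "\<psi> U y = k (\<psi> W y) + d" if "y \<in> X W" for y
      using k(2) g that by simp
    have "\<psi> U (\<eta>' W x) = k (h W x + c W) + d"
      using kg [OF \<eta>'(1) [OF W x]] \<eta>'(2) [OF W x] by simp
    also have "\<dots> = (k \<circ> h W) x + (k (c W) + d)"
      by (simp add: linear_add [OF k(1)])
    also have "\<dots> = h U x + c U"
    proof (rule affine_map_eq_on_hull [of "k \<circ> h W" "h U" "\<gamma> ` W" "k (c W) + d" "c U"])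
      show "linear (k \<circ> h W)" by (rule linear_compose [OF lin [OF W] k(1)])
      show "linear (h U)" by (rule lin [OF U])
      show "x \<in> convex hull (\<gamma> ` W)" using x by (simp add: C_def)
      fix y assume "y \<in> \<gamma> ` W"
      then obtain v where v: "v \<in> W" "y = \<gamma> v" by auto
      have "(k \<circ> h W) y + (k (c W) + d) = k (h W y + c W) + d"
        by (simp add: linear_add [OF k(1)])
      also have "\<dots> = k (\<psi> W v) + d" using h\<gamma> [OF W v(1)] v(2) by simp
      also have "\<dots> = \<psi> U v" using kg vertices_subset [OF W] v(1) by auto
      also have "\<dots> = h U y + c U" using h\<gamma> [OF U, of v] v WU by auto
      finally show "(k \<circ> h W) y + (k (c W) + d) = h U y + c U" .
    qed
    finally have 1: "\<psi> U (\<eta>' W x) = h U x + c U" .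
    have xU: "x \<in> C U" using C_mono [OF WU] x by blast
    show ?thesis
    proof (rule inj_onD [OF inj_chart [OF U]])
      show "\<psi> U (\<eta>' W x) = \<psi> U (\<eta>' U x)" using 1 \<eta>'(2) [OF U xU] by simp
      show "\<eta>' W x \<in> X U" using \<eta>'(1) [OF W x] sub by blast
      show "\<eta>' U x \<in> X U" by (rule \<eta>'(1) [OF U xU])
    qed
  qed
  have C_empty: "C {} = {}" by (simp add: C_def)
  have \<eta>'_eq: "\<eta>' U x = \<eta>' W x" if "U \<in> \<V>" "W \<in> \<V>" "x \<in> C U" "x \<in> C W" for U W x
  proof -
    have x: "x \<in> C (U \<inter> W)" using C_Int [OF that(1,2)] that(3,4) by blast
    then have "U \<inter> W \<noteq> {}" using C_empty by auto
    then have I: "U \<inter> W \<in> \<V>" using faces [OF that(1)] by simp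
    show ?thesis
      using \<eta>'_face [OF that(1) _ I x] \<eta>'_face [OF that(2) _ I x] by simp
  qed
  define \<eta> where "\<eta> x = \<eta>' (SOME U. U \<in> \<V> \<and> x \<in> C U) x" for x
  have \<eta>: "\<eta> x = \<eta>' U x" if U: "U \<in> \<V>" "x \<in> C U" for U x
  proof -
    have "(SOME U. U \<in> \<V> \<and> x \<in> C U) \<in> \<V> \<and> x \<in> C (SOME U. U \<in> \<V> \<and> x \<in> C U)"
      using someI [of "\<lambda>U. U \<in> \<V> \<and> x \<in> C U" U] U by simp
    then show ?thesis unfolding \<eta>_def using U by (intro \<eta>'_eq) simp_all
  qed
  have \<eta>_img: "\<eta> ` C U = X U" if "U \<in> \<V>" for U
    using \<eta>'_img [OF that] \<eta> [OF that] by (metis image_cong)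
  have \<eta>_chart: "\<eta> x \<in> X U" "\<psi> U (\<eta> x) = h U x + c U" if "U \<in> \<V>" "x \<in> C U" for U x
    using \<eta> [OF that] \<eta>' [OF that] by simp_all
  have inj_cell: "x = y" if U: "U \<in> \<V>" and xy: "x \<in> C U" "y \<in> C U" "\<eta> x = \<eta> y" for U x y
  proof (rule inj_onD [OF injA [OF U] _ xy(1,2)])
    show "h U x + c U = h U y + c U"
      unfolding \<eta>_chart(2) [OF U xy(1), symmetric] \<eta>_chart(2) [OF U xy(2), symmetric] xy(3) ..
  qed
  show ?thesis
  proof (rule that [of C h c \<eta>])
    fix U assume U: "U \<in> \<V>"
    show "polytope (C U)"
      unfolding C_def using card_simplex [OF U] by (intro polytope_convex_hull finite_imageI) simp
    show "C U \<inter> C W face_of C U" if W: "W \<in> \<V>" for W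
      unfolding C_Int [OF U W] unfolding C_def
      unfolding face_of_convex_hull_affine_independent [OF ind [OF U]]
      by (intro exI [of _ "\<gamma> ` (U \<inter> W)"] conjI refl) auto
    show "linear (h U)" "inj_on (\<lambda>x. h U x + c U) (C U)" "\<eta> ` C U = X U"
      by (fact lin [OF U], fact injA [OF U], fact \<eta>_img [OF U])
    show "\<eta> x \<in> X U \<and> \<psi> U (\<eta> x) = h U x + c U" if "x \<in> C U" for x
      using \<eta>_chart [OF U that] by simp
  next
    show "inj_on \<eta> (\<Union> (C ` \<V>))"
    proof (rule inj_onI)
      fix x y assume "x \<in> \<Union> (C ` \<V>)" "y \<in> \<Union> (C ` \<V>)" and eq: "\<eta> x = \<eta> y"
      then obtain U W where U: "U \<in> \<V>" "x \<in> C U" and W: "W \<in> \<V>" "y \<in> C W" by blast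
      have "\<eta> x \<in> X (U \<inter> W)"
        using \<eta>_chart(1) [OF U] \<eta>_chart(1) [OF W] eq X_Int [OF U(1) W(1)] by auto
      then have ne: "U \<inter> W \<noteq> {}" "\<eta> x \<in> X (U \<inter> W)" using X_empty by auto
      then have I: "U \<inter> W \<in> \<V>" using faces [OF U(1)] by simp
      \<comment> \<open>A point \<open>z\<close> of the common face has the same image. It belongs
        to both cells, and injectivity on each of them gives \<open>x = z\<close> and
        \<open>y = z\<close>.\<close>
      have "\<eta> x \<in> \<eta> ` C (U \<inter> W)" unfolding \<eta>_img [OF I] by (rule ne(2))
      then obtain z where z: "\<eta> x = \<eta> z" "z \<in> C (U \<inter> W)" by (rule imageE)
      have zC: "z \<in> C U" "z \<in> C W"
        by (rule subsetD [OF C_mono z(2)], simp)+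
      have "x = z" by (rule inj_cell [OF U zC(1) z(1)])
      moreover have "y = z" by (rule inj_cell [OF W zC(2)]) (simp only: z(1) eq [symmetric])
      ultimately show "x = y" by simp
    qed
  qed
qed

text \<open>All cells are cut by the walls of all simplices at once, which keeps the pieces
  compatible along common faces. The affine chart kept for each piece later certifies that its image
  is again isometric to a Euclidean simplex.\<close>

lemma fold_subdivision:
  obtains T :: "(real \<times> real \<times> real \<times> real \<times> real) set set" and \<eta> and f :: "'a \<Rightarrow> real^2"
  where "simplicial_complex T" "continuous_on (\<Union>T) \<eta>" "inj_on \<eta> (\<Union>T)" "\<eta> ` \<Union>T = \<Union> (X ` \<V>)"
    "\<And>S x y. S \<in> T \<Longrightarrow> x \<in> S \<Longrightarrow> y \<in> S \<Longrightarrow> dist (f (\<eta> x)) (f (\<eta> y)) = dist (\<eta> x) (\<eta> y)"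
    "\<And>S. S \<in> T \<Longrightarrow> \<exists>h (c :: real^2). linear h \<and> inj_on (\<lambda>x. h x + c) S \<and>
      (\<forall>x\<in>S. \<forall>y\<in>S. dist (h x + c) (h y + c) = dist (\<eta> x) (\<eta> y))"
proof (rule folding_map, rule realization)
  fix f :: "'a \<Rightarrow> real^2" and H
    and C :: "'a set \<Rightarrow> (real \<times> real \<times> real \<times> real \<times> real) set" and \<eta>
    and h :: "'a set \<Rightarrow> real \<times> real \<times> real \<times> real \<times> real \<Rightarrow> real^2" and c
  assume H: "\<And>U. U \<in> \<V> \<Longrightarrow> piecewise_isometric (H U)"
    "\<And>U x. U \<in> \<V> \<Longrightarrow> x \<in> X U \<Longrightarrow> f x = H U (\<psi> U x)"
    and C: "\<And>U. U \<in> \<V> \<Longrightarrow> polytope (C U)"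
    "\<And>U W. U \<in> \<V> \<Longrightarrow> W \<in> \<V> \<Longrightarrow> C U \<inter> C W face_of C U"
    and lin: "\<And>U. U \<in> \<V> \<Longrightarrow> linear (h U)"
    and injA: "\<And>U. U \<in> \<V> \<Longrightarrow> inj_on (\<lambda>x. h U x + c U) (C U)"
    and \<eta>: "\<And>U x. U \<in> \<V> \<Longrightarrow> x \<in> C U \<Longrightarrow> \<eta> x \<in> X U \<and> \<psi> U (\<eta> x) = h U x + c U"
    and \<eta>_img: "\<And>U. U \<in> \<V> \<Longrightarrow> \<eta> ` C U = X U"
    and inj: "inj_on \<eta> (\<Union> (C ` \<V>))"
  have "\<forall>U\<in>\<V>. \<exists>L. finite L \<and> (\<forall>x y. same_side L x y \<longrightarrow> dist (H U x) (H U y) = dist x y)"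
    using H(1) unfolding piecewise_isometric_def by simp
  from bchoice [OF this] obtain L where
    L: "\<forall>U\<in>\<V>. finite (L U) \<and> (\<forall>x y. same_side (L U) x y \<longrightarrow> dist (H U x) (H U y) = dist x y)"
    by (elim exE) (rule that)
  define I where "I = (\<Union>U\<in>\<V>. pull_back (h U) (c U) (L U))"
  have finI: "finite I" using finite_simplices L by (auto simp: I_def)
  have "\<exists>\<G>. \<Union>\<G> = \<Union>(C ` \<V>) \<and> finite \<G> \<and> (\<forall>D \<in> \<G>. \<exists>E. E \<in> C ` \<V> \<and> D \<subseteq> E) \<and>
      (\<forall>D \<in> C ` \<V>. \<forall>x \<in> D. \<exists>E. E \<in> \<G> \<and> x \<in> E \<and> E \<subseteq> D) \<and>
      (\<forall>D \<in> \<G>. polytope D) \<and> (\<forall>D \<in> \<G>. aff_dim D \<le> int DIM(real \<times> real \<times> real \<times> real \<times> real)) \<and>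
      (\<forall>D \<in> \<G>. \<forall>E \<in> \<G>. D \<inter> E face_of D) \<and>
      (\<forall>D \<in> \<G>. \<forall>x \<in> D. \<forall>y \<in> D. \<forall>a b. (a,b) \<in> I \<longrightarrow> a \<bullet> x \<le> b \<and> a \<bullet> y \<le> b \<or> a \<bullet> x \<ge> b \<and> a \<bullet> y \<ge> b)"
  proof (rule cell_subdivision_lemma)
    show "finite (C ` \<V>)" "finite I" using finite_simplices finI by simp_all
    show "polytope D" if "D \<in> C ` \<V>" for D using that C(1) by (elim imageE) simp
    show "D \<inter> E face_of D" if "D \<in> C ` \<V>" "E \<in> C ` \<V>" for D E
      using that C(2) by (elim imageE) simp
  qed (rule aff_dim_le_DIM)
  then obtain \<G> where G: "\<Union>\<G> = \<Union>(C ` \<V>)" "finite \<G>" "\<forall>D \<in> \<G>. \<exists>E. E \<in> C ` \<V> \<and> D \<subseteq> E"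
    "\<forall>D \<in> \<G>. polytope D" "\<forall>D \<in> \<G>. \<forall>E \<in> \<G>. D \<inter> E face_of D"
    "\<forall>D \<in> \<G>. \<forall>x \<in> D. \<forall>y \<in> D. \<forall>a b. (a,b) \<in> I \<longrightarrow> a \<bullet> x \<le> b \<and> a \<bullet> y \<le> b \<or> a \<bullet> x \<ge> b \<and> a \<bullet> y \<ge> b"
    by (elim exE conjE) (rule that; assumption)
  have "\<exists>T. simplicial_complex T \<and> \<Union>T = \<Union>\<G> \<and> (\<forall>S\<in>T. \<exists>D. D \<in> \<G> \<and> S \<subseteq> D)"
  proof (rule simplicial_subdivision_of_cell_complex [OF G(2)])
    show "polytope D" if "D \<in> \<G>" for D using G(4) that by (rule bspec)
    show "D \<inter> E face_of D" if "D \<in> \<G>" "E \<in> \<G>" for D E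
      using bspec [OF bspec [OF G(5) that(1)] that(2)] .
    fix T assume "simplicial_complex T" "\<Union>T = \<Union>\<G>" "\<And>S. S \<in> T \<Longrightarrow> \<exists>D. D \<in> \<G> \<and> S \<subseteq> D"
    then show "\<exists>T. simplicial_complex T \<and> \<Union>T = \<Union>\<G> \<and> (\<forall>S\<in>T. \<exists>D. D \<in> \<G> \<and> S \<subseteq> D)"
      by (intro exI [of _ T] conjI ballI)
  qed
  then obtain T where T: "simplicial_complex T" "\<Union>T = \<Union>\<G>" "\<forall>S\<in>T. \<exists>D. D \<in> \<G> \<and> S \<subseteq> D"
    by (elim exE conjE) (rule that; assumption)
  have cell: "\<exists>U\<in>\<V>. S \<subseteq> C U \<and> (\<forall>x\<in>S. \<forall>y\<in>S. same_side I x y)" if S: "S \<in> T" for S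
  proof -
    obtain D where D: "D \<in> \<G>" "S \<subseteq> D" using bspec [OF T(3) S] by (elim exE conjE)
    obtain E where E: "E \<in> C ` \<V>" "D \<subseteq> E" using bspec [OF G(3) D(1)] by (elim exE conjE)
    obtain U where U: "E = C U" "U \<in> \<V>" using E(1) by (rule imageE)
    have ss: "same_side I x y" if "x \<in> D" "y \<in> D" for x y
      unfolding same_side_def case_prod_unfold
      using bspec [OF bspec [OF bspec [OF G(6) D(1)] that(1)] that(2)] by (metis prod.collapse)
    show ?thesis
    proof (intro bexI [OF _ U(2)] conjI ballI)
      show "S \<subseteq> C U" using D(2) E(2) unfolding U(1) by (rule subset_trans)
      show "same_side I x y" if "x \<in> S" "y \<in> S" for x y
        using D(2) that by (intro ss) (rule subsetD, assumption+)+
    qed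
  qed
  have dist_\<eta>: "dist (h U x + c U) (h U y + c U) = dist (\<eta> x) (\<eta> y)"
    if "U \<in> \<V>" "x \<in> C U" "y \<in> C U" for U x y
    using isometric_chart [OF that(1), of "\<eta> x" "\<eta> y"] \<eta> [OF that(1,2)] \<eta> [OF that(1,3)] by simp
  show ?thesis
  proof (rule that [of T \<eta> f])
    show "simplicial_complex T" by (rule T(1))
    have UT: "\<Union>T = \<Union>(C ` \<V>)" using T(2) G(1) by simp
    show "inj_on \<eta> (\<Union>T)" unfolding UT by (rule inj)
    show "\<eta> ` \<Union>T = \<Union> (X ` \<V>)"
      unfolding UT image_UN using \<eta>_img by (metis SUP_cong)
    \<comment> \<open>On a closed cell \<open>\<eta>\<close> has the same distances as an affine
      map, and finitely many closed cells glue.\<close>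
    show "continuous_on (\<Union>T) \<eta>"
      unfolding UT
    proof (rule continuous_on_closed_Union [OF finite_simplices])
      fix U assume U: "U \<in> \<V>"
      show "closed (C U)" using C(1) [OF U] by (rule polytope_imp_closed)
      have "continuous_on (C U) (\<lambda>x. h U x + c U)"
        by (intro continuous_on_add linear_continuous_on lin [OF U, unfolded linear_conv_bounded_linear] continuous_on_const)
      then show "continuous_on (C U) \<eta>"
        unfolding continuous_on_iff using dist_\<eta> [OF U] by simp
    qed
    fix S assume S: "S \<in> T"
    obtain U where U: "U \<in> \<V>" "S \<subseteq> C U" "\<forall>x\<in>S. \<forall>y\<in>S. same_side I x y"
      using cell [OF S] by auto
    show "\<exists>h (c :: real^2). linear h \<and> inj_on (\<lambda>x. h x + c) S \<and>
      (\<forall>x\<in>S. \<forall>y\<in>S. dist (h x + c) (h y + c) = dist (\<eta> x) (\<eta> y))"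
      using lin [OF U(1)] inj_on_subset [OF injA [OF U(1)] U(2)] dist_\<eta> [OF U(1)] U(2)
      by (intro exI [of _ "h U"] exI [of _ "c U"]) (auto simp: subset_iff)
    fix x y assume xy: "x \<in> S" "y \<in> S"
    then have xyC: "x \<in> C U" "y \<in> C U" using U(2) by auto
    have "same_side I x y" using U(3) xy by simp
    then have "same_side (pull_back (h U) (c U) (L U)) x y"
      by (rule same_side_mono) (use U(1) in \<open>auto simp: I_def\<close>)
    then have "same_side (L U) (h U x + c U) (h U y + c U)"
      by (simp add: same_side_pull_back [OF lin [OF U(1)]])
    then have "dist (H U (h U x + c U)) (H U (h U y + c U)) = dist (h U x + c U) (h U y + c U)"
      using L U(1) by simp
    moreover have "f (\<eta> x) = H U (h U x + c U)" "f (\<eta> y) = H U (h U y + c U)"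
      using H(2) [OF U(1)] \<eta> [OF U(1) xyC(1)] \<eta> [OF U(1) xyC(2)] by simp_all
    ultimately show "dist (f (\<eta> x)) (f (\<eta> y)) = dist (\<eta> x) (\<eta> y)"
      using dist_\<eta> [OF U(1) xyC] by simp
  qed
qed

end

section \<open>Realization in the space of finitely supported sequences\<close>

text \<open>Injectivity is required on the hull only, since \<open>h\<close> may lower the dimension
  of the ambient space, as from five to two. A Radon partition of the image points would yield
  disjoint faces of the hull with a common image point.\<close>

lemma independent_affine_image:
  fixes h :: "'a::euclidean_space \<Rightarrow> 'b::real_vector"
  assumes h: "linear h" and C: "\<not> affine_dependent C"
    and inj: "inj_on (\<lambda>x. h x + c) (convex hull C)"
  shows "\<not> affine_dependent ((\<lambda>x. h x + c) ` C)"
proof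
  let ?A = "\<lambda>x. h x + c"
  assume "affine_dependent (?A ` C)"
  then obtain M N where MN: "M \<subseteq> ?A ` C" "N \<subseteq> ?A ` C" "M \<inter> N = {}"
    "convex hull M \<inter> convex hull N \<noteq> {}"
    by (rule Radon)
  define M' N' where "M' = {u \<in> C. ?A u \<in> M}" and "N' = {u \<in> C. ?A u \<in> N}"
  have M: "M = ?A ` M'" "N = ?A ` N'" using MN(1,2) by (auto simp: M'_def N'_def)
  have sub: "M' \<subseteq> C" "N' \<subseteq> C" "M' \<inter> N' = {}" using MN(3) by (auto simp: M'_def N'_def)
  have "\<not> affine_dependent (M' \<union> N')"
    using C sub affine_dependent_subset by (metis Un_least)
  then have "convex hull M' \<inter> convex hull N' = {}"
    using convex_hull_Int [of M' N'] sub(3) by simp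
  moreover obtain z where z: "z \<in> ?A ` (convex hull M')" "z \<in> ?A ` (convex hull N')"
    using MN(4) unfolding M affine_map_hull [OF h] by auto
  obtain x where x: "z = ?A x" "x \<in> convex hull M'" using z(1) by (rule imageE)
  obtain y where y: "z = ?A y" "y \<in> convex hull N'" using z(2) by (rule imageE)
  have "x = y"
  proof (rule inj_onD [OF inj])
    show "?A x = ?A y" using x y by simp
    show "x \<in> convex hull C" "y \<in> convex hull C"
      using x(2) y(2) hull_mono [OF sub(1)] hull_mono [OF sub(2)] by blast+
  qed
  ultimately show False using x y by blast
qed

lemma euclidean_embedding:
  obtains \<iota> :: "'e::euclidean_space \<Rightarrow> rinf" where "linear \<iota>"
    "\<And>x y. dist (\<iota> x) (\<iota> y) = dist x y" "\<And>x. \<iota> x \<in> R_space DIM('e)"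
proof -
  obtain \<beta> :: "nat \<Rightarrow> 'e" where \<beta>: "bij_betw \<beta> {..<DIM('e)} Basis"
    using ex_bij_betw_nat_finite [OF finite_Basis] by (auto simp: atLeast0LessThan)
  define \<iota> :: "'e \<Rightarrow> rinf" where "\<iota> x = Abs_rinf (\<lambda>i. if i < DIM('e) then x \<bullet> \<beta> i else 0)" for x
  have coord: "coord (\<iota> x) i = (if i < DIM('e) then x \<bullet> \<beta> i else 0)" for x i
  proof -
    have "finite {i. (if i < DIM('e) then x \<bullet> \<beta> i else 0) \<noteq> 0}"
      by (rule finite_subset [of _ "{..<DIM('e)}"]) auto
    then show ?thesis unfolding \<iota>_def by (subst Abs_rinf_inverse) simp_all
  qed
  have R: "\<iota> x \<in> R_space DIM('e)" for x by (simp add: R_space_def coord)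
  show ?thesis
  proof
    show "linear \<iota>"
      by (rule linearI) (auto intro!: rinf_eqI simp: coord inner_add_left)
    show "\<iota> x \<in> R_space DIM('e)" for x by (rule R)
    show "dist (\<iota> x) (\<iota> y) = dist x y" for x y
    proof -
      have "(\<Sum>i<DIM('e). (coord (\<iota> x) i - coord (\<iota> y) i)\<^sup>2) = (\<Sum>i<DIM('e). ((x - y) \<bullet> \<beta> i)\<^sup>2)"
        by (rule sum.cong) (simp_all add: coord inner_diff_left)
      also have "\<dots> = (\<Sum>b\<in>Basis. ((x - y) \<bullet> b)\<^sup>2)"
        by (rule sum.reindex_bij_betw [OF \<beta>])
      also have "\<dots> = (norm (x - y))\<^sup>2"
        by (simp only: power2_norm_eq_inner euclidean_inner [of "x - y" "x - y"]
            power2_eq_square [of "_ \<bullet> _"])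
      finally show ?thesis
        unfolding dist_R_space [OF R R] by (simp add: dist_norm)
    qed
  qed
qed

text \<open>The dimension in \<open>simplex\<close> is an integer, with -1 for the empty set;
  \<open>S \<noteq> {}\<close> makes \<open>nat k\<close> the true dimension.\<close>

lemma simplex_in_affine_image:
  fixes h :: "'a::euclidean_space \<Rightarrow> rinf"
  assumes h: "linear h" and S: "k simplex S" and ne: "S \<noteq> {}"
    and inj: "inj_on (\<lambda>x. h x + c) S" and R: "\<And>x. h x + c \<in> R_space n"
  shows "simplex_in n (nat k) ((\<lambda>x. h x + c) ` S)"
proof -
  obtain C where C: "\<not> affine_dependent C" "int (card C) = k + 1" "S = convex hull C"
    using S by (auto simp: simplex_def)
  have fin: "finite C" using C(1) aff_independent_finite by blast
  have "C \<noteq> {}" using C(3) ne by auto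
  then have "card C > 0" using fin by (simp add: card_gt_0_iff)
  then have "card C = nat k + 1" using C(2) by linarith
  moreover have "inj_on (\<lambda>x. h x + c) C"
    using inj unfolding C(3) by (rule inj_on_subset) (rule hull_subset)
  moreover have "\<not> affine_dependent ((\<lambda>x. h x + c) ` C)"
    using inj unfolding C(3) by (rule independent_affine_image [OF h C(1)])
  ultimately show ?thesis
    unfolding simplex_in_def C(3) affine_map_hull [OF h]
    using R fin by (intro exI [of _ "(\<lambda>x. h x + c) ` C"]) (auto simp: card_image)
qed

text \<open>Mediates between the two notions of complex: \<open>T\<close> is moved isometrically
  into \<open>R_space\<close> and its empty member discarded. Compactness turns the continuous
  injection into a homeomorphism.\<close>

lemma piecewise_distance_preserving_transfer:
  fixes T :: "'e::euclidean_space set set" and \<eta> :: "'e \<Rightarrow> 'a::metric_space" and f :: "'a \<Rightarrow> 'b::euclidean_space"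
  assumes T: "simplicial_complex T" and cont: "continuous_on (\<Union>T) \<eta>" and inj: "inj_on \<eta> (\<Union>T)"
    and P: "\<eta> ` \<Union>T = P"
    and f: "\<And>S x y. S \<in> T \<Longrightarrow> x \<in> S \<Longrightarrow> y \<in> S \<Longrightarrow> dist (f (\<eta> x)) (f (\<eta> y)) = dist (\<eta> x) (\<eta> y)"
    and charts: "\<And>S. S \<in> T \<Longrightarrow> \<exists>h (c :: real^2). linear h \<and> inj_on (\<lambda>x. h x + c) S \<and>
      (\<forall>x\<in>S. \<forall>y\<in>S. dist (h x + c) (h y + c) = dist (\<eta> x) (\<eta> y))"
  shows "piecewise_distance_preserving P f"
proof -
  obtain \<iota> :: "'e \<Rightarrow> rinf" where \<iota>: "linear \<iota>" "\<And>x y. dist (\<iota> x) (\<iota> y) = dist x y"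
    "\<And>x. \<iota> x \<in> R_space DIM('e)"
    by (rule euclidean_embedding [where 'e = 'e]) (rule that)
  have inj\<iota>: "inj \<iota>" by (rule injI) (metis \<iota>(2) dist_eq_0_iff)
  define K where "K = (`) \<iota> ` (T - {{}})"
  define h where "h = \<eta> \<circ> inv \<iota>"
  have h: "h (\<iota> x) = \<eta> x" for x by (simp add: h_def inv_f_f [OF inj\<iota>])
  have UK: "\<Union>K = \<iota> ` \<Union>T" by (auto simp: K_def)
  have Tfin: "finite T" and Tsimp: "\<And>S. S \<in> T \<Longrightarrow> \<exists>k. k simplex S"
    and Tface: "\<And>S F. S \<in> T \<Longrightarrow> F face_of S \<Longrightarrow> F \<in> T"
    and Tint: "\<And>S S'. S \<in> T \<Longrightarrow> S' \<in> T \<Longrightarrow> S \<inter> S' face_of S"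
    using T unfolding simplicial_complex_def by blast+
  have cpt: "compact (\<Union>T)"
  proof (rule compact_Union [OF Tfin])
    fix S assume "S \<in> T"
    then obtain k where "k simplex S" using Tsimp by blast
    then obtain C where C: "\<not> affine_dependent C" "S = convex hull C"
      by (auto simp: simplex_def)
    then show "compact S"
      using aff_independent_finite finite_imp_compact_convex_hull by blast
  qed
  have "simplicial_complex_in DIM('e) K"
    unfolding simplicial_complex_in_def
  proof (intro conjI ballI allI impI)
    show "finite K" using Tfin by (simp add: K_def)
    fix S' assume "S' \<in> K"
    then obtain S where S: "S' = \<iota> ` S" "S \<in> T" "S \<noteq> {}" by (auto simp: K_def)
    obtain k where k: "k simplex S" using Tsimp S(2) by blast
    have "simplex_in DIM('e) (nat k) ((\<lambda>x. \<iota> x + 0) ` S)"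
      by (rule simplex_in_affine_image [OF \<iota>(1) k S(3)])
        (use inj_on_subset [OF inj\<iota> subset_UNIV] \<iota>(3) in simp_all)
    then show "\<exists>k. simplex_in DIM('e) k S'" by (auto simp: S(1))
    show "F \<in> K" if "F face_of S' \<and> F \<noteq> {}" for F
    proof -
      have "F \<in> {F. F face_of \<iota> ` S}" using that by (simp add: S(1))
      then obtain G where G: "F = \<iota> ` G" "G face_of S"
        unfolding faces_of_linear_image [OF \<iota>(1) inj\<iota>] by auto
      then show ?thesis using Tface [OF S(2) G(2)] that by (auto simp: K_def)
    qed
    fix R' assume "R' \<in> K"
    then obtain R where R: "R' = \<iota> ` R" "R \<in> T" by (auto simp: K_def)
    have "S' \<inter> R' = \<iota> ` (S \<inter> R)" by (simp add: S(1) R(1) image_Int [OF inj\<iota>])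
    moreover have "S \<inter> R face_of S" "S \<inter> R face_of R"
      using Tint [OF S(2) R(2)] Tint [OF R(2) S(2)] by (simp_all add: Int_commute)
    ultimately show "S' \<inter> R' = {} \<or> S' \<inter> R' face_of S' \<and> S' \<inter> R' face_of R'"
      using S(1) R(1) face_of_linear_image [OF \<iota>(1) inj\<iota>] by simp
  qed
  moreover have "\<exists>g. homeomorphism (\<Union>K) P h g"
  proof (rule homeomorphism_compact)
    have cont\<iota>: "continuous_on A \<iota>" for A
      unfolding continuous_on_iff using \<iota>(2) by auto
    show "compact (\<Union>K)" unfolding UK by (rule compact_continuous_image [OF cont\<iota> cpt])
    show "h ` \<Union>K = P" unfolding UK using P by (simp add: image_image h)
    show "inj_on h (\<Union>K)"
      unfolding UK using inj by (auto simp: inj_on_def h)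
    have "continuous_on (\<iota> ` \<Union>T) (inv \<iota>)"
      unfolding continuous_on_iff using \<iota>(2) by (auto simp: inv_f_f [OF inj\<iota>])
    moreover have "inv \<iota> ` \<iota> ` \<Union>T = \<Union>T"
      by (simp add: image_image inv_f_f [OF inj\<iota>])
    ultimately show "continuous_on (\<Union>K) h"
      unfolding UK h_def using cont by (intro continuous_on_compose) simp_all
  qed
  moreover have "\<exists>n k T'. simplex_in n k T' \<and> isometric (h ` S') T'" if S': "S' \<in> K" for S'
  proof -
    obtain S where S: "S' = \<iota> ` S" "S \<in> T" "S \<noteq> {}" using S' by (auto simp: K_def)
    obtain k where k: "k simplex S" using Tsimp S(2) by blast
    obtain A and c :: "real^2" where A: "linear A" "inj_on (\<lambda>x. A x + c) S"
      "\<And>x y. x \<in> S \<Longrightarrow> y \<in> S \<Longrightarrow> dist (A x + c) (A y + c) = dist (\<eta> x) (\<eta> y)"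
      using charts [OF S(2)] by blast
    obtain \<kappa> :: "real^2 \<Rightarrow> rinf" where \<kappa>: "linear \<kappa>" "\<And>x y. dist (\<kappa> x) (\<kappa> y) = dist x y"
      "\<And>x. \<kappa> x \<in> R_space DIM(real^2)"
      by (rule euclidean_embedding [where 'e = "real^2"]) (rule that)
    \<comment> \<open>The planar chart followed by an isometric embedding of the plane:
      \<open>B\<close> S\<open>is the Euclidean simplex to which\<close>\<eta> \<open>S\<close> is
      isometric.\<close>
    define B where "B x = (\<kappa> \<circ> A) x + \<kappa> c" for x
    have B: "B x = \<kappa> (A x + c)" for x by (simp add: B_def linear_add [OF \<kappa>(1)])
    have distB: "dist (B x) (B y) = dist (\<eta> x) (\<eta> y)" if "x \<in> S" "y \<in> S" for x y
      unfolding B \<kappa>(2) using that by (rule A(3))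
    have inj\<eta>: "inj_on \<eta> S" by (rule inj_on_subset [OF inj]) (use S(2) in blast)
    have injB: "inj_on B S"
    proof (rule inj_onI)
      fix x y assume xy: "x \<in> S" "y \<in> S" "B x = B y"
      then have "\<eta> x = \<eta> y" using distB [OF xy(1,2)] by simp
      then show "x = y" using inj\<eta> xy by (simp add: inj_on_eq_iff)
    qed
    have "simplex_in DIM(real^2) (nat k) ((\<lambda>x. (\<kappa> \<circ> A) x + \<kappa> c) ` S)"
    proof (rule simplex_in_affine_image [OF _ k S(3)])
      show "linear (\<kappa> \<circ> A)" by (rule linear_compose [OF A(1) \<kappa>(1)])
      show "inj_on (\<lambda>x. (\<kappa> \<circ> A) x + \<kappa> c) S" using injB by (simp add: B_def [abs_def])
      show "(\<kappa> \<circ> A) x + \<kappa> c \<in> R_space DIM(real^2)" for x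
        using \<kappa>(3) [of "A x + c"] by (simp add: linear_add [OF \<kappa>(1)])
    qed
    then have simp: "simplex_in DIM(real^2) (nat k) (B ` S)" by (simp add: B_def [abs_def])
    define g where "g = B \<circ> inv_into S \<eta>"
    have g: "g (\<eta> x) = B x" if "x \<in> S" for x
      using that inj\<eta> by (simp add: g_def)
    have hS: "h ` S' = \<eta> ` S" by (simp add: S(1) image_image h)
    have "distance_preserving_on (\<eta> ` S) g"
      unfolding distance_preserving_on_def using g distB by simp
    moreover have "bij_betw g (\<eta> ` S) (B ` S)"
      unfolding bij_betw_def
    proof
      show "inj_on g (\<eta> ` S)" using injB by (auto simp: inj_on_def g)
      show "g ` \<eta> ` S = B ` S" using g by (simp add: image_image)
    qed
    ultimately have "isometric (h ` S') (B ` S)"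
      unfolding isometric_def hS by (intro exI [of _ g] conjI)
    then show ?thesis using simp by (intro exI conjI)
  qed
  moreover have "distance_preserving_on (h ` S') f" if S': "S' \<in> K" for S'
  proof -
    obtain S where S: "S' = \<iota> ` S" "S \<in> T" using S' by (auto simp: K_def)
    show ?thesis
      unfolding distance_preserving_on_def S(1) using f [OF S(2)] by (simp add: h)
  qed
  ultimately show ?thesis
    unfolding piecewise_distance_preserving_def polyhedral_triangulation_of_def triangulation_of_def
    by (intro exI [of _ K] exI [of _ h] conjI ballI) blast+
qed

section \<open>Developing the simplices of a polyhedral space\<close>

lemma convex_Diff_face:
  assumes F: "F face_of S" and S: "convex S"
  shows "convex (S - F)"
  unfolding convex_contains_open_segment
proof (intro ballI subsetI)
  fix a b x assume ab: "a \<in> S - F" "b \<in> S - F" and x: "x \<in> open_segment a b"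
  have "x \<in> S" using S ab x unfolding convex_contains_open_segment by blast
  moreover have "x \<notin> F" using face_ofD [OF F x] ab by blast
  ultimately show "x \<in> S - F" by blast
qed

text \<open>The points of \<open>S\<close> satisfying the claim form a convex set, because an open
  segment that meets a face has both ends in it. The argument is independent of dimension and so is
  valid in \<open>rinf\<close>.\<close>

lemma in_convex_hull_face:
  assumes F: "F face_of S" and S: "convex S" and W: "W \<subseteq> S" and x: "x \<in> F" "x \<in> convex hull W"
  shows "x \<in> convex hull (W \<inter> F)"
proof -
  have "convex {x \<in> S. x \<in> F \<longrightarrow> x \<in> convex hull (W \<inter> F)}"
  proof (rule iffD2 [OF convex_contains_open_segment], intro ballI subsetI)
    fix a b x assume a: "a \<in> {x \<in> S. x \<in> F \<longrightarrow> x \<in> convex hull (W \<inter> F)}"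
      and b: "b \<in> {x \<in> S. x \<in> F \<longrightarrow> x \<in> convex hull (W \<inter> F)}" and x: "x \<in> open_segment a b"
    have "x \<in> S" using S a b x unfolding convex_contains_open_segment by blast
    moreover have "x \<in> convex hull (W \<inter> F)" if "x \<in> F"
    proof -
      have "a \<in> F" "b \<in> F" using face_ofD [OF F x] a b that by blast+
      then have "open_segment a b \<subseteq> convex hull (W \<inter> F)"
        using a b iffD1 [OF convex_contains_open_segment convex_convex_hull] by blast
      then show ?thesis using x by blast
    qed
    ultimately show "x \<in> {x \<in> S. x \<in> F \<longrightarrow> x \<in> convex hull (W \<inter> F)}" by blast
  qed
  moreover have "W \<subseteq> {x \<in> S. x \<in> F \<longrightarrow> x \<in> convex hull (W \<inter> F)}"
    using W by (auto intro: hull_inc)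
  ultimately have "convex hull W \<subseteq> {x \<in> S. x \<in> F \<longrightarrow> x \<in> convex hull (W \<inter> F)}"
    by (intro hull_minimal)
  then show ?thesis using x by blast
qed

text \<open>Vertices are omitted one at a time. Each omitted vertex is outside the affine hull of
  the remaining ones, so a facet is left, and being a face is transitive.\<close>

lemma face_of_independent_hull:
  fixes V :: "'a::real_vector set"
  assumes V: "finite V" "\<not> affine_dependent V" and W: "W \<subseteq> V"
  shows "convex hull W face_of convex hull V"
proof -
  have "convex hull (V - D) face_of convex hull V" if "finite D" "D \<subseteq> V" for D
    using that
  proof (induction D rule: finite_induct)
    case empty
    show ?case by (simp add: face_of_refl)
  next
    case (insert d D)
    let ?U = "V - D"
    have d: "d \<in> ?U" using insert by auto
    have "\<not> affine_dependent ?U" using V(2) affine_dependent_subset by (metis Diff_subset)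
    then have "d \<notin> affine hull (?U - {d})" using d unfolding affine_dependent_def by blast
    moreover have "?U - (?U - {d}) = {d}" using d by blast
    ultimately have "affine hull (?U - {d}) \<inter> convex hull (?U - (?U - {d})) = {}" by simp
    then have "convex hull (?U - {d}) face_of convex hull ?U"
      using V(1) by (intro face_of_convex_hulls) auto
    moreover have "V - insert d D = ?U - {d}" by blast
    ultimately show ?case using insert face_of_trans by (metis insert_subset)
  qed
  from this [of "V - W"] show ?thesis
    using V(1) W by (simp add: double_diff)
qed

lemma vertex_of_independent_hull:
  fixes V :: "'a::real_vector set"
  assumes V: "finite V" "\<not> affine_dependent V" "v \<in> V" and F: "F \<subseteq> convex hull V" "v \<in> F"
  shows "{v} face_of F"
proof -
  have "convex hull {v} face_of convex hull V"
    using V by (intro face_of_independent_hull) auto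
  then show ?thesis using F by (auto intro: face_of_subset)
qed

lemma vertex_mem_if_face:
  assumes "{v} face_of convex hull W"
  shows "v \<in> W"
proof -
  have "v \<in> convex hull W" using face_of_imp_subset [OF assms] by simp
  then have "v \<in> convex hull (W \<inter> {v})"
    by (intro in_convex_hull_face [OF assms convex_convex_hull]) (auto intro: hull_inc)
  then show ?thesis by (cases "v \<in> W") auto
qed

text \<open>The vertices are recovered from the hull as its extreme points.\<close>

lemma independent_hull_inj:
  fixes V W :: "'a::real_vector set"
  assumes "finite V" "\<not> affine_dependent V" "finite W" "\<not> affine_dependent W"
    and "convex hull V = convex hull W"
  shows "V = W"
proof -
  have "V \<subseteq> W" if "finite V" "\<not> affine_dependent V" "convex hull V = convex hull W" for V W :: "'a set"
  proof
    fix v assume v: "v \<in> V"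
    have "{v} face_of convex hull V"
      using that v by (intro vertex_of_independent_hull [of V]) (auto intro: hull_inc)
    then show "v \<in> W" using that(3) vertex_mem_if_face by simp
  qed
  then show ?thesis using assms by (metis subset_antisym)
qed

text \<open>The intersection lies in the hull of those vertices of \<open>V\<close> that it
  contains. Each of them is an extreme point of the intersection, hence of
  \<open>convex hull W\<close>, hence a member of \<open>W\<close>.\<close>

lemma convex_hull_Int_of_faces:
  fixes V W :: "'a::real_vector set"
  assumes V: "finite V" "\<not> affine_dependent V"
    and F: "convex hull V \<inter> convex hull W = {} \<or> convex hull V \<inter> convex hull W face_of convex hull V \<and>
      convex hull V \<inter> convex hull W face_of convex hull W"
  shows "convex hull V \<inter> convex hull W = convex hull (V \<inter> W)"
proof
  let ?F = "convex hull V \<inter> convex hull W"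
  show "convex hull (V \<inter> W) \<subseteq> ?F" by (intro Int_greatest hull_mono) auto
  show "?F \<subseteq> convex hull (V \<inter> W)"
  proof
    fix x assume x: "x \<in> ?F"
    then have FV: "?F face_of convex hull V" and FW: "?F face_of convex hull W" using F by auto
    have "x \<in> convex hull (V \<inter> ?F)"
      using x by (intro in_convex_hull_face [OF FV convex_convex_hull]) (auto intro: hull_inc)
    moreover have "V \<inter> ?F \<subseteq> V \<inter> W"
    proof
      fix v assume v: "v \<in> V \<inter> ?F"
      then have "{v} face_of ?F" by (intro vertex_of_independent_hull [OF V]) auto
      then have "{v} face_of convex hull W" using FW by (rule face_of_trans)
      then show "v \<in> V \<inter> W" using v vertex_mem_if_face by auto
    qed
    ultimately show "x \<in> convex hull (V \<inter> W)" using hull_mono by blast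
  qed
qed

text \<open>Makes the topology of Euclidean spaces applicable to simplices in
  \<open>rinf\<close>.\<close>

lemma simplex_parametrization:
  fixes V :: "'v::real_normed_vector set"
  assumes V: "finite V" "\<not> affine_dependent V" "card V = DIM('e::euclidean_space) + 1"
  obtains h :: "'e::euclidean_space \<Rightarrow> 'v" and c where "linear h" "inj (\<lambda>x. h x + c)"
    "continuous_on UNIV (\<lambda>x. h x + c)"
    "(\<lambda>x. h x + c) ` (convex hull (insert 0 Basis)) = convex hull V"
proof -
  obtain b where b: "b \<in> V" using V(3) by fastforce
  have "card (V - {b}) = DIM('e)" using V b by simp
  then obtain \<beta> :: "'e \<Rightarrow> 'v" where \<beta>: "bij_betw \<beta> Basis (V - {b})"
    using finite_same_card_bij [of "Basis :: 'e set" "V - {b}"] V(1) by auto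
  obtain h :: "'e \<Rightarrow> 'v" where h: "linear h" "\<And>i. i \<in> Basis \<Longrightarrow> h i = \<beta> i - b"
    using linear_independent_extend [OF independent_Basis, of "\<lambda>i. \<beta> i - b"] by blast
  have ind: "independent ((\<lambda>x. - b + x) ` (V - {b}))"
    using V(2) affine_dependent_iff_dependent2 [OF b] by simp
  obtain g :: "'v \<Rightarrow> 'e" where g: "linear g"
    "\<And>y. y \<in> (\<lambda>x. - b + x) ` (V - {b}) \<Longrightarrow> g y = inv_into Basis \<beta> (y + b)"
    using linear_independent_extend [OF ind, of "\<lambda>y. inv_into Basis \<beta> (y + b)"] by blast
  have gh: "g (h x) = x" for x
  proof -
    have "g (h i) = i" if "i \<in> Basis" for i
    proof -
      have "\<beta> i \<in> V - {b}" using \<beta> that by (auto simp: bij_betw_def)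
      then have "\<beta> i - b \<in> (\<lambda>x. - b + x) ` (V - {b})" by force
      then have "g (\<beta> i - b) = inv_into Basis \<beta> (\<beta> i - b + b)" by (rule g(2))
      then show ?thesis using \<beta> that by (simp add: h(2) bij_betw_def)
    qed
    then have "(g \<circ> h) x = id x"
      using linear_eq_stdbasis [OF linear_compose [OF h(1) g(1)] linear_id] by simp
    then show ?thesis by simp
  qed
  show ?thesis
  proof (rule that [of h b])
    show "linear h" by (rule h(1))
    show "inj (\<lambda>x. h x + b)" by (rule injI) (metis gh add_right_imp_eq)
    show "continuous_on UNIV (\<lambda>x. h x + b)"
      by (intro continuous_on_add linear_continuous_on continuous_on_const
          h(1) [unfolded linear_conv_bounded_linear])
    have "(\<lambda>x. h x + b) ` Basis = \<beta> ` Basis" using h(2) by (intro image_cong) auto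
    then have "(\<lambda>x. h x + b) ` insert 0 Basis = V"
      using \<beta> b linear_0 [OF h(1)] by (auto simp: bij_betw_def)
    then show "(\<lambda>x. h x + b) ` (convex hull (insert 0 Basis)) = convex hull V"
      unfolding affine_map_hull [OF h(1)] by simp
  qed
qed

text \<open>Invariance of dimension for the interior of a standard simplex, sent to
  \<open>'f\<close> through both parametrizations. A face with \<open>DIM('e) + 1\<close> vertices
  is used, so a lower bound on \<open>card V\<close> suffices.\<close>

lemma simplex_dimension_le:
  fixes V :: "'v::real_normed_vector set" and W :: "'w::real_normed_vector set"
  assumes V: "finite V" "\<not> affine_dependent V" "card V \<ge> DIM('e::euclidean_space) + 1"
    and W: "finite W" "\<not> affine_dependent W" "card W = DIM('f::euclidean_space) + 1"
    and f: "continuous_on (convex hull V) f" "inj_on f (convex hull V)" "f ` (convex hull V) \<subseteq> convex hull W"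
  shows "DIM('e) \<le> DIM('f)"
proof -
  obtain V' where V': "V' \<subseteq> V" "card V' = DIM('e) + 1" "finite V'"
    using obtain_subset_with_card_n [OF V(3)] by metis
  have "\<not> affine_dependent V'" using V(2) V'(1) affine_dependent_subset by blast
  then obtain h :: "'e \<Rightarrow> 'v" and c where h: "inj (\<lambda>x. h x + c)" "continuous_on UNIV (\<lambda>x. h x + c)"
    "(\<lambda>x. h x + c) ` (convex hull (insert 0 Basis)) = convex hull V'"
    using simplex_parametrization [OF V'(3) _ V'(2)] by metis
  obtain k :: "'f \<Rightarrow> 'w" and d where k: "inj (\<lambda>x. k x + d)" "continuous_on UNIV (\<lambda>x. k x + d)"
    "(\<lambda>x. k x + d) ` (convex hull (insert 0 Basis)) = convex hull W"
    using simplex_parametrization [OF W] by metis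
  let ?S = "convex hull (insert 0 (Basis :: 'f set))"
  have "compact ?S" by (intro finite_imp_compact_convex_hull) simp
  then obtain g where g: "homeomorphism ?S (convex hull W) (\<lambda>x. k x + d) g"
    using homeomorphism_compact [of ?S "\<lambda>x. k x + d" "convex hull W"] k
    by (meson continuous_on_subset inj_on_subset subset_UNIV)
  let ?O = "interior (convex hull (insert 0 (Basis :: 'e set)))"
  have sub: "(\<lambda>x. h x + c) ` ?O \<subseteq> convex hull V"
    using image_mono [OF interior_subset, of "\<lambda>x. h x + c" "convex hull (insert 0 Basis)"]
      h(3) hull_mono [OF V'(1)] by blast
  have sub2: "(\<lambda>x. f (h x + c)) ` ?O \<subseteq> convex hull W"
    using sub f(3) by blast
  show ?thesis
  proof (rule invariance_of_dimension)
    show "open ?O" by simp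
    show "?O \<noteq> {}" using interior_std_simplex_nonempty by blast
    have "continuous_on ?O (\<lambda>x. f (h x + c))"
      using continuous_on_compose2 [OF f(1) continuous_on_subset [OF h(2) subset_UNIV] sub] .
    then show "continuous_on ?O (\<lambda>x. g (f (h x + c)))"
      using continuous_on_compose2 [OF homeomorphism_cont2 [OF g] _ sub2] by simp
    show "inj_on (\<lambda>x. g (f (h x + c))) ?O"
    proof (rule inj_onI)
      fix x y assume xy: "x \<in> ?O" "y \<in> ?O" and eq: "g (f (h x + c)) = g (f (h y + c))"
      have "f (h x + c) = f (h y + c)"
        using eq homeomorphism_apply2 [OF g] sub2 xy by (metis image_subset_iff)
      then have "h x + c = h y + c"
        using inj_onD [OF f(2)] sub xy by (metis image_subset_iff)
      then show "x = y" using injD [OF h(1)] by simp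
    qed
  qed
qed

section \<open>Planar charts of single simplices\<close>

lemma planar_chart:
  fixes B :: "'v::real_inner set"
  assumes B: "finite B" "card B \<le> 3"
  obtains \<kappa> :: "'v \<Rightarrow> real^2" where
    "\<And>x y. x \<in> convex hull B \<Longrightarrow> y \<in> convex hull B \<Longrightarrow> dist (\<kappa> x) (\<kappa> y) = dist x y"
    "\<kappa> ` (convex hull B) = convex hull (\<kappa> ` B)"
proof -
  have "\<exists>a b c. B \<subseteq> {a, b, c}"
  proof -
    consider "card B = 0" | "card B = 1" | "card B = 2" | "card B = 3" using B(2) by linarith
    then show ?thesis
    proof cases
      case 1
      then show ?thesis using B(1) by simp
    next
      case 2
      then show ?thesis by (auto simp: card_1_singleton_iff)
    next
      case 3
      then show ?thesis by (auto simp: card_2_iff)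
    next
      case 4
      then show ?thesis by (auto simp: card_3_iff)
    qed
  qed
  then obtain a b c where abc: "B \<subseteq> {a, b, c}" by blast
  \<comment> \<open>Gram-Schmidt on \<open>b - a\<close> and \<open>c - a\<close>. As
    \<open>sgn 0 = 0\<close>, coinciding or collinear points merely turn \<open>u\<close> or
    \<open>v\<close> into zero, and \<open>(u \<bullet> u) *\<^sub>R u = u\<close> holds in every
    case.\<close>
  define u where "u = sgn (b - a)"
  define w where "w = (c - a) - (u \<bullet> (c - a)) *\<^sub>R u"
  define v where "v = sgn w"
  have uu: "(u \<bullet> u) *\<^sub>R u = u" "(v \<bullet> v) *\<^sub>R v = v"
  proof -
    have "(sgn x \<bullet> sgn x) *\<^sub>R sgn x = sgn x" for x :: 'v
    proof (cases "x = 0")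
      case False
      then have "sgn x \<bullet> sgn x = 1" by (simp add: norm_eq_1 [symmetric] norm_sgn)
      then show ?thesis by simp
    qed simp
    then show "(u \<bullet> u) *\<^sub>R u = u" "(v \<bullet> v) *\<^sub>R v = v"
      unfolding u_def v_def by blast+
  qed
  have "u \<bullet> w = u \<bullet> (c - a) - (u \<bullet> (c - a)) * (u \<bullet> u)"
    by (simp add: w_def inner_diff_right)
  also have "\<dots> = 0"
  proof (cases "b = a")
    case False
    then have "u \<bullet> u = 1" unfolding u_def by (simp add: norm_eq_1 [symmetric] norm_sgn)
    then show ?thesis by simp
  qed (simp add: u_def)
  finally have "u \<bullet> w = 0" .
  then have uv: "u \<bullet> v = 0" by (simp add: v_def sgn_div_norm)
  have ba: "b - a = norm (b - a) *\<^sub>R u" "w = norm w *\<^sub>R v"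
    unfolding u_def v_def sgn_div_norm by (cases "b = a", simp, simp) (cases "w = 0", simp, simp)
  have ca: "c - a = (u \<bullet> (c - a)) *\<^sub>R u + norm w *\<^sub>R v"
    unfolding ba(2) [symmetric] by (simp add: w_def)
  have sp: "x - a \<in> span {u, v}" if "x \<in> convex hull B" for x
  proof -
    have "convex ((\<lambda>x. x + a) ` span {u, v})"
      by (simp add: add.commute [of _ a] convex_translation_eq subspace_imp_convex)
    moreover have "B \<subseteq> (\<lambda>x. x + a) ` span {u, v}"
    proof -
      have "b - a \<in> span {u, v}" by (subst ba(1)) (simp add: span_scale span_base)
      moreover have "c - a \<in> span {u, v}" by (subst ca) (intro span_add span_scale span_base; simp)
      moreover have "a - a \<in> span {u, v}" by (simp add: span_zero)
      ultimately have "x - a \<in> span {u, v}" if "x \<in> B" for x using abc that by auto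
      then show ?thesis by (force simp: image_iff)
    qed
    ultimately have "convex hull B \<subseteq> (\<lambda>x. x + a) ` span {u, v}" by (intro hull_minimal)
    then show ?thesis using that by auto
  qed
  define L :: "'v \<Rightarrow> real^2" where "L x = vector [u \<bullet> x, v \<bullet> x]" for x
  have L: "linear L"
    by (rule linearI) (simp_all add: L_def vec_eq_iff forall_2 inner_add_right)
  have normL: "norm (L x) = norm x" if xs: "x \<in> span {u, v}" for x
  proof -
    obtain s where "x - s *\<^sub>R u \<in> span {v}"
      using xs span_breakdown_eq [of x u "{v}"] by auto
    then obtain t where "x - s *\<^sub>R u = t *\<^sub>R v"
      using span_breakdown_eq [of "x - s *\<^sub>R u" v "{}"] by auto
    then have st: "x = s *\<^sub>R u + t *\<^sub>R v" by (simp add: diff_eq_eq add.commute)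
    have vu: "v \<bullet> u = 0" using uv by (simp add: inner_commute)
    have ux: "u \<bullet> x = s * (u \<bullet> u)" and vx: "v \<bullet> x = t * (v \<bullet> v)"
      using uv vu by (simp_all add: st inner_add_right)
    have sq: "(u \<bullet> u)\<^sup>2 = u \<bullet> u" "(v \<bullet> v)\<^sup>2 = v \<bullet> v"
      using arg_cong [OF uu(1), of "\<lambda>z. z \<bullet> u"] arg_cong [OF uu(2), of "\<lambda>z. z \<bullet> v"]
      by (simp_all add: power2_eq_square)
    have "(u \<bullet> x)\<^sup>2 + (v \<bullet> x)\<^sup>2 = s\<^sup>2 * (u \<bullet> u) + t\<^sup>2 * (v \<bullet> v)"
      unfolding ux vx power_mult_distrib sq ..
    also have "\<dots> = s * (u \<bullet> x) + t * (v \<bullet> x)"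
      unfolding ux vx by (simp add: power2_eq_square)
    also have "\<dots> = x \<bullet> x"
      by (subst (3) st) (simp only: inner_add_left inner_scaleR_left)
    finally have "(u \<bullet> x)\<^sup>2 + (v \<bullet> x)\<^sup>2 = x \<bullet> x" .
    moreover have "L x \<bullet> L x = (u \<bullet> x)\<^sup>2 + (v \<bullet> x)\<^sup>2"
      by (simp add: L_def inner_vec_def sum_2 power2_eq_square)
    ultimately show ?thesis by (simp add: norm_eq_sqrt_inner)
  qed
  show ?thesis
  proof (rule that [of "\<lambda>x. L x + 0"])
    show "(\<lambda>x. L x + 0) ` (convex hull B) = convex hull ((\<lambda>x. L x + 0) ` B)"
      by (rule affine_map_hull [OF L])
    fix x y assume xy: "x \<in> convex hull B" "y \<in> convex hull B"
    have "(x - a) - (y - a) \<in> span {u, v}" by (rule span_diff [OF sp [OF xy(1)] sp [OF xy(2)]])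
    then have "norm (L (x - y)) = norm (x - y)" using normL by simp
    then show "dist (L x + 0) (L y + 0) = dist x y"
      by (simp add: dist_norm linear_diff [OF L])
  qed
qed

text \<open>Two isometric charts of one set differ by an affine map, which respects hulls. So the
  straightness of an edge, found in a chart of the edge alone, can be read in the chart of a
  triangle.\<close>

lemma isometric_chart_hull:
  fixes \<psi> \<psi>' :: "'a::metric_space \<Rightarrow> real^2"
  assumes iso: "\<And>x y. x \<in> Y \<Longrightarrow> y \<in> Y \<Longrightarrow> dist (\<psi> x) (\<psi> y) = dist x y"
    and iso': "\<And>x y. x \<in> Y \<Longrightarrow> y \<in> Y \<Longrightarrow> dist (\<psi>' x) (\<psi>' y) = dist x y"
    and W: "W \<subseteq> Y" and hull: "\<psi>' ` Y = convex hull (\<psi>' ` W)"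
  shows "\<psi> ` Y = convex hull (\<psi> ` W)"
proof -
  have inj: "inj_on \<psi>' Y" by (rule inj_onI) (metis iso' dist_eq_0_iff)
  define g where "g z = \<psi> (inv_into Y \<psi>' z)" for z
  have g: "g (\<psi>' y) = \<psi> y" if "y \<in> Y" for y using inv_into_f_f [OF inj that] by (simp add: g_def)
  have "dist (g z) (g z') = dist z z'" if z: "z \<in> \<psi>' ` Y" "z' \<in> \<psi>' ` Y" for z z'
  proof -
    obtain y where y: "z = \<psi>' y" "y \<in> Y" using z(1) by (rule imageE)
    obtain y' where y': "z' = \<psi>' y'" "y' \<in> Y" using z(2) by (rule imageE)
    show ?thesis unfolding y(1) y'(1) g [OF y(2)] g [OF y'(2)] using iso iso' y(2) y'(2) by simp
  qed
  then obtain h c where h: "linear h" "\<And>z. z \<in> \<psi>' ` Y \<Longrightarrow> g z = h z + c"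
    using isometric_imp_affine [of "\<psi>' ` Y" g] by blast
  have \<psi>: "\<psi> y = h (\<psi>' y) + c" if "y \<in> Y" for y using h(2) g that by simp
  have "\<psi> ` Z = (\<lambda>z. h z + c) ` \<psi>' ` Z" if "Z \<subseteq> Y" for Z
    unfolding image_image using \<psi> that by (intro image_cong) auto
  from this [OF order_refl] this [OF W] show ?thesis
    unfolding hull affine_map_hull [OF h(1)] by simp
qed

text \<open>Removing an end point does not disconnect the source, but removing an inner point
  disconnects the target.\<close>

lemma segment_homeo_ends:
  fixes \<theta> :: "'v::real_normed_vector \<Rightarrow> 'w::real_inner"
  assumes V: "\<not> affine_dependent {v, w}" "v \<noteq> w"
    and cont: "continuous_on (convex hull {v, w}) \<theta>" and inj: "inj_on \<theta> (convex hull {v, w})"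
    and img: "\<theta> ` (convex hull {v, w}) = closed_segment a b"
  shows "\<theta> ` (convex hull {v, w}) = convex hull {\<theta> v, \<theta> w}"
proof -
  let ?S = "convex hull {v, w}"
  have end1: "\<theta> x \<in> {a, b}" if x: "x \<in> {v, w}" for x
  proof (rule ccontr)
    assume not: "\<theta> x \<notin> {a, b}"
    have xS: "x \<in> ?S" using x by (rule hull_inc)
    have "{x} face_of ?S"
      using V x xS by (intro vertex_of_independent_hull [of "{v, w}"]) auto
    then have "connected (?S - {x})"
      by (intro convex_connected convex_Diff_face) simp_all
    then have "connected (\<theta> ` (?S - {x}))"
      by (rule connected_continuous_image [OF continuous_on_subset [OF cont Diff_subset]])
    moreover have "\<theta> ` (?S - {x}) = closed_segment a b - {\<theta> x}"
      using inj_on_image_set_diff [OF inj Diff_subset, of "{x}" ] inj_on_image_set_diff [OF inj, of ?S "{x}"] xS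
      by (simp add: img)
    ultimately have con: "connected (closed_segment a b - {\<theta> x})" by simp
    have "\<theta> x \<in> closed_segment a b" using xS img by blast
    then obtain t where t: "0 \<le> t" "t \<le> 1" "\<theta> x = (1 - t) *\<^sub>R a + t *\<^sub>R b"
      by (auto simp: closed_segment_def)
    have ab: "a \<noteq> b" using not t(3) by (auto simp flip: scaleR_left_distrib)
    have t1: "(b - a) \<bullet> \<theta> x = (b - a) \<bullet> a + t * ((b - a) \<bullet> (b - a))"
      by (simp add: t(3) inner_add_right inner_diff_right algebra_simps)
    \<comment> \<open>Connectedness forces a second point with the value that the functional takes
      at \<open>\<theta> x\<close>, whereas the functional is injective on the segment.\<close>
    have "\<exists>z\<in>closed_segment a b - {\<theta> x}. (b - a) \<bullet> z = (b - a) \<bullet> \<theta> x"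
    proof (rule connected_ivt_hyperplane [OF con])
      show "a \<in> closed_segment a b - {\<theta> x}" "b \<in> closed_segment a b - {\<theta> x}" using not by auto
      show "(b - a) \<bullet> a \<le> (b - a) \<bullet> \<theta> x" unfolding t1 using t(1) by simp
      have "(b - a) \<bullet> b = (b - a) \<bullet> a + 1 * ((b - a) \<bullet> (b - a))" by (simp add: inner_diff_right)
      moreover have "t * ((b - a) \<bullet> (b - a)) \<le> 1 * ((b - a) \<bullet> (b - a))"
        using t(2) by (intro mult_right_mono) simp_all
      ultimately show "(b - a) \<bullet> \<theta> x \<le> (b - a) \<bullet> b" unfolding t1 by linarith
    qed
    then obtain z where z: "z \<in> closed_segment a b" "z \<noteq> \<theta> x" "(b - a) \<bullet> z = (b - a) \<bullet> \<theta> x" by blast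
    obtain s where s: "z = (1 - s) *\<^sub>R a + s *\<^sub>R b" using z(1) by (auto simp: closed_segment_def)
    have "(b - a) \<bullet> z = (b - a) \<bullet> a + s * ((b - a) \<bullet> (b - a))"
      by (simp add: s inner_add_right inner_diff_right algebra_simps)
    then have "s * ((b - a) \<bullet> (b - a)) = t * ((b - a) \<bullet> (b - a))" using z(3) t1 by linarith
    then have "s = t" using ab by (metis inner_eq_zero_iff mult_right_cancel right_minus_eq)
    then show False using z(2) s t(3) by simp
  qed
  have "\<theta> v \<noteq> \<theta> w"
    using inj_onD [OF inj, of v w] V(2) by (auto intro: hull_inc)
  then have "{\<theta> v, \<theta> w} = {a, b}" using end1 [of v] end1 [of w] by auto
  then show ?thesis using img by (simp add: segment_convex_hull)
qed

text \<open>Removing its boundary does not disconnect the source. Hence the image without the boundary of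
  the triangle spanned by the images of the vertices is connected, and as it meets the interior of
  that triangle it cannot leave it.\<close>

lemma triangle_homeo_vertices:
  fixes \<theta> :: "'v::real_normed_vector \<Rightarrow> real^2"
  assumes V: "\<not> affine_dependent {u, v, w}" "card {u, v, w} = 3"
    and cont: "continuous_on (convex hull {u, v, w}) \<theta>" and inj: "inj_on \<theta> (convex hull {u, v, w})"
    and convex: "convex (\<theta> ` (convex hull {u, v, w}))"
    and edges: "\<And>x y. x \<in> {u, v, w} \<Longrightarrow> y \<in> {u, v, w} \<Longrightarrow>
      \<theta> ` (convex hull {x, y}) = convex hull {\<theta> x, \<theta> y}"
  shows "\<theta> ` (convex hull {u, v, w}) = convex hull {\<theta> u, \<theta> v, \<theta> w}"
proof
  let ?S = "convex hull {u, v, w}" and ?D = "convex hull {\<theta> u, \<theta> v, \<theta> w}"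
  have V_in: "u \<in> ?S" "v \<in> ?S" "w \<in> ?S" by (simp_all add: hull_inc)
  show D_sub: "?D \<subseteq> \<theta> ` ?S" using V_in by (intro hull_minimal convex) auto
  have ne: "u \<noteq> v" "v \<noteq> w" "w \<noteq> u" using V(2) by (auto simp: card_insert_if split: if_splits)
  define E where "E = convex hull {u, v} \<union> convex hull {v, w} \<union> convex hull {w, u}"
  have ES: "E \<subseteq> ?S" unfolding E_def by (intro Un_least hull_mono) auto
  \<comment> \<open>Each edge is a face, so its removal leaves a convex set; the triangle without
    its boundary is the intersection of three of these.\<close>
  have "?S - E = (?S - convex hull {u, v}) \<inter> ((?S - convex hull {v, w}) \<inter> (?S - convex hull {w, u}))"
    unfolding E_def by blast
  also have "convex \<dots>"
    by (intro convex_Int convex_Diff_face face_of_independent_hull V(1)) auto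
  finally have "connected (\<theta> ` (?S - E))"
    by (intro connected_continuous_image [OF continuous_on_subset [OF cont Diff_subset]] convex_connected)
  moreover have "\<theta> ` (?S - E) = \<theta> ` ?S - \<theta> ` E"
    by (rule inj_on_image_set_diff [OF inj _ ES]) simp
  moreover have "\<theta> ` E = frontier ?D"
    unfolding E_def image_Un by (simp add: edges frontier_of_triangle segment_convex_hull)
  ultimately have con: "connected (\<theta> ` ?S - frontier ?D)" by simp
  have not_edge: "x \<notin> convex hull {y, z}"
    if "{x, y, z} = {u, v, w}" "x \<noteq> y" "x \<noteq> z" for x y z
  proof
    assume x: "x \<in> convex hull {y, z}"
    have "\<not> affine_dependent {x, y, z}" using V(1) that(1) by simp
    moreover have "{x, y, z} - {x} = {y, z}" using that by auto
    ultimately have "x \<notin> affine hull {y, z}" unfolding affine_dependent_def by (metis insertI1)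
    then show False using x convex_hull_subset_affine_hull by blast
  qed
  \<comment> \<open>Otherwise the image of one vertex lies between the other two, hence in the image
    of the opposite edge, and injectivity puts the vertex itself on that edge.\<close>
  have "\<not> collinear {\<theta> u, \<theta> v, \<theta> w}"
  proof
    assume "collinear {\<theta> u, \<theta> v, \<theta> w}"
    then have "\<theta> u \<in> convex hull {\<theta> v, \<theta> w} \<or> \<theta> v \<in> convex hull {\<theta> w, \<theta> u} \<or> \<theta> w \<in> convex hull {\<theta> u, \<theta> v}"
      by (simp add: collinear_between_cases between_mem_segment segment_convex_hull)
    moreover have mem: "x \<in> convex hull {y, z}"
      if "x \<in> {u, v, w}" "y \<in> {u, v, w}" "z \<in> {u, v, w}" "\<theta> x \<in> convex hull {\<theta> y, \<theta> z}" for x y z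
    proof -
      have "\<theta> x \<in> \<theta> ` (convex hull {y, z})" using edges that by simp
      then obtain p where p: "\<theta> x = \<theta> p" "p \<in> convex hull {y, z}" by (rule imageE)
      have "convex hull {y, z} \<subseteq> ?S" using that by (intro hull_mono) auto
      then have "x = p" using p that(1) by (intro inj_onD [OF inj p(1)]) (auto intro: hull_inc)
      then show ?thesis using p(2) by simp
    qed
    ultimately have "u \<in> convex hull {v, w} \<or> v \<in> convex hull {w, u} \<or> w \<in> convex hull {u, v}"
      using mem [of u v w] mem [of v w u] mem [of w u v] by blast
    moreover have "{v, w, u} = {u, v, w}" "{w, u, v} = {u, v, w}" by auto
    ultimately show False
      using not_edge [of u v w] not_edge [of v w u] not_edge [of w u v] ne by auto
  qed
  \<comment> \<open>The centroid is the point at which the image meets the interior.\<close>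
  then have "(1/3) *\<^sub>R \<theta> u + (1/3) *\<^sub>R \<theta> v + (1/3) *\<^sub>R \<theta> w \<in> interior ?D"
    by (subst interior_convex_hull_3_minimal) (auto intro!: exI [of _ "1/3 :: real"])
  then have "(\<theta> ` ?S - frontier ?D) \<inter> ?D \<noteq> {}"
    using D_sub interior_subset [of ?D] unfolding frontier_def by blast
  moreover have "(\<theta> ` ?S - frontier ?D) \<inter> frontier ?D = {}" by blast
  ultimately have "\<theta> ` ?S - frontier ?D - ?D = {}"
    using connected_Int_frontier [OF con, of ?D] by blast
  moreover have "frontier ?D \<subseteq> ?D"
    by (intro frontier_subset_closed compact_imp_closed finite_imp_compact_convex_hull) simp
  ultimately show "\<theta> ` ?S \<subseteq> ?D" by blast
qed

text \<open>A priori the model \<open>T\<close> could have a larger dimension than the simplex;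
  invariance of dimension excludes this, so \<open>T\<close> fits into the plane. The corners
  \<open>B\<close> are not yet matched with the vertices \<open>V\<close>.\<close>

lemma isometric_simplex_chart:
  fixes h :: "rinf \<Rightarrow> 'a::metric_space"
  assumes V: "finite V" "\<not> affine_dependent V" "card V \<in> {2, 3}"
    and cont: "continuous_on (convex hull V) h" and inj: "inj_on h (convex hull V)"
    and T: "simplex_in n k T" "isometric (h ` (convex hull V)) T"
  obtains \<psi> :: "'a \<Rightarrow> real^2" and B where
    "\<And>x y. x \<in> h ` (convex hull V) \<Longrightarrow> y \<in> h ` (convex hull V) \<Longrightarrow> dist (\<psi> x) (\<psi> y) = dist x y"
    "\<psi> ` h ` (convex hull V) = convex hull B" "finite B" "card B \<le> card V"
proof -
  let ?S = "convex hull V"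
  obtain B where B: "finite B" "\<not> affine_dependent B" "T = convex hull B"
    using T(1) by (auto simp: simplex_in_def)
  obtain \<phi> where \<phi>: "distance_preserving_on (h ` ?S) \<phi>" "bij_betw \<phi> (h ` ?S) T"
    using T(2) by (auto simp: isometric_def)
  have dist\<phi>: "dist (\<phi> x) (\<phi> y) = dist x y" if "x \<in> h ` ?S" "y \<in> h ` ?S" for x y
    using \<phi>(1) that unfolding distance_preserving_on_def by blast
  have "continuous_on (h ` ?S) \<phi>"
    unfolding continuous_on_iff using dist\<phi> by auto
  then have c: "continuous_on ?S (\<lambda>x. \<phi> (h x))"
    by (rule continuous_on_compose2 [OF _ cont order_refl])
  have i: "inj_on (\<lambda>x. \<phi> (h x)) ?S"
    using comp_inj_on [OF inj bij_betw_imp_inj_on [OF \<phi>(2)]] by (simp add: o_def)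
  have im: "(\<lambda>x. \<phi> (h x)) ` ?S = T"
    using bij_betw_imp_surj_on [OF \<phi>(2)] by (simp add: image_image)
  obtain g where g: "homeomorphism ?S T (\<lambda>x. \<phi> (h x)) g"
    using homeomorphism_compact [OF finite_imp_compact_convex_hull [OF V(1)] c im i] by blast
  have gT: "continuous_on (convex hull B) g" "inj_on g (convex hull B)" "g ` (convex hull B) \<subseteq> ?S"
    using homeomorphism_cont2 [OF g] homeomorphism_image2 [OF g]
      inj_on_inverseI [of T "\<lambda>x. \<phi> (h x)" g] homeomorphism_apply2 [OF g] unfolding B(3) by auto
  have card: "card B \<le> card V"
  proof (rule ccontr)
    assume "\<not> card B \<le> card V"
    then consider "card V = 2" "card B \<ge> 3" | "card V = 3" "card B \<ge> 4"
      using V(3) by force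
    then show False
    proof cases
      case 1
      then have "DIM(real^2) \<le> DIM(real)"
        by (intro simplex_dimension_le [OF B(1,2) _ V(1,2) _ gT]) simp_all
      then show False by simp
    next
      case 2
      then have "DIM(real^3) \<le> DIM(real^2)"
        by (intro simplex_dimension_le [OF B(1,2) _ V(1,2) _ gT]) simp_all
      then show False by simp
    qed
  qed
  then have B3: "card B \<le> 3" using V(3) by auto
  obtain \<kappa> :: "rinf \<Rightarrow> real^2" where \<kappa>:
    "\<And>x y. x \<in> convex hull B \<Longrightarrow> y \<in> convex hull B \<Longrightarrow> dist (\<kappa> x) (\<kappa> y) = dist x y"
    "\<kappa> ` (convex hull B) = convex hull (\<kappa> ` B)"
    by (rule planar_chart [OF B(1) B3]) (rule that)
  show ?thesis
  proof (rule that [of "\<lambda>x. \<kappa> (\<phi> x)" "\<kappa> ` B"])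
    show "dist (\<kappa> (\<phi> x)) (\<kappa> (\<phi> y)) = dist x y" if "x \<in> h ` ?S" "y \<in> h ` ?S" for x y
    proof -
      have "\<phi> x \<in> convex hull B" "\<phi> y \<in> convex hull B"
        using that bij_betw_imp_surj_on [OF \<phi>(2)] B(3) by auto
      then show ?thesis using \<kappa>(1) dist\<phi> that by simp
    qed
    have "(\<lambda>x. \<kappa> (\<phi> x)) ` h ` ?S = \<kappa> ` T"
      unfolding im [symmetric] image_image ..
    then show "(\<lambda>x. \<kappa> (\<phi> x)) ` h ` ?S = convex hull (\<kappa> ` B)"
      using B(3) \<kappa>(2) by simp
    show "finite (\<kappa> ` B)" using B(1) by simp
    show "card (\<kappa> ` B) \<le> card V" using card card_image_le [OF B(1), of \<kappa>] by linarith
  qed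
qed

lemma continuous_isometric_compose:
  fixes \<psi> :: "'a::metric_space \<Rightarrow> 'b::metric_space"
  assumes "continuous_on S h" "inj_on h S"
    and "\<And>x y. x \<in> h ` S \<Longrightarrow> y \<in> h ` S \<Longrightarrow> dist (\<psi> x) (\<psi> y) = dist x y"
  shows "continuous_on S (\<lambda>x. \<psi> (h x))" "inj_on (\<lambda>x. \<psi> (h x)) S"
proof -
  have "continuous_on (h ` S) \<psi>"
    unfolding continuous_on_iff using assms(3) by auto
  then show "continuous_on S (\<lambda>x. \<psi> (h x))"
    by (rule continuous_on_compose2 [OF _ assms(1) order_refl])
  show "inj_on (\<lambda>x. \<psi> (h x)) S"
  proof (rule inj_onI)
    fix x y assume xy: "x \<in> S" "y \<in> S" "\<psi> (h x) = \<psi> (h y)"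
    then have "dist (h x) (h y) = 0" using assms(3) [of "h x" "h y"] by simp
    then show "x = y" using inj_onD [OF assms(2)] xy by simp
  qed
qed

text \<open>The model is a segment, and a homeomorphism between segments takes ends to ends.\<close>

lemma edge_chart:
  fixes h :: "rinf \<Rightarrow> 'a::metric_space"
  assumes V: "\<not> affine_dependent {v, w}" "v \<noteq> w"
    and cont: "continuous_on (convex hull {v, w}) h" and inj: "inj_on h (convex hull {v, w})"
    and T: "simplex_in n k T" "isometric (h ` (convex hull {v, w})) T"
  obtains \<psi> :: "'a \<Rightarrow> real^2" where
    "\<And>x y. x \<in> h ` (convex hull {v, w}) \<Longrightarrow> y \<in> h ` (convex hull {v, w}) \<Longrightarrow> dist (\<psi> x) (\<psi> y) = dist x y"
    "\<psi> ` h ` (convex hull {v, w}) = convex hull (\<psi> ` h ` {v, w})"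
proof -
  let ?S = "convex hull {v, w}"
  have c2: "card {v, w} = 2" using V(2) by simp
  then have c23: "card {v, w} \<in> {2, 3}" by simp
  have fin: "finite {v, w}" by simp
  obtain \<psi> :: "'a \<Rightarrow> real^2" and B where \<psi>:
    "\<And>x y. x \<in> h ` ?S \<Longrightarrow> y \<in> h ` ?S \<Longrightarrow> dist (\<psi> x) (\<psi> y) = dist x y"
    "\<psi> ` h ` ?S = convex hull B" "finite B" "card B \<le> card {v, w}"
    by (rule isometric_simplex_chart [OF fin V(1) c23 cont inj T]) (rule that)
  have "B \<noteq> {}" using \<psi>(2) by auto
  then have "card B > 0" using \<psi>(3) by (simp add: card_gt_0_iff)
  then consider "card B = 1" | "card B = 2" using \<psi>(4) c2 by linarith
  then have "\<exists>a b. B = {a, b}"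
    by cases (auto simp: card_1_singleton_iff card_2_iff)
  then obtain a b where "B = {a, b}" by blast
  then have img: "(\<lambda>x. \<psi> (h x)) ` ?S = closed_segment a b"
    using \<psi>(2) by (simp add: segment_convex_hull image_image)
  have "(\<lambda>x. \<psi> (h x)) ` ?S = convex hull {\<psi> (h v), \<psi> (h w)}"
    by (rule segment_homeo_ends [OF V continuous_isometric_compose [OF cont inj \<psi>(1)] img])
  then have "\<psi> ` h ` ?S = convex hull (\<psi> ` h ` {v, w})" by (simp add: image_image)
  with \<psi>(1) show ?thesis by (rule that)
qed

text \<open>For a triangle, the isometry of the whole does not locate the vertices. The hypothesis
  on its faces makes the three sides straight, and then the images of the vertices span the
  image.\<close>

lemma simplex_chart:
  fixes h :: "rinf \<Rightarrow> 'a::metric_space"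
  assumes V: "finite V" "\<not> affine_dependent V" "card V \<le> 3" "V \<noteq> {}"
    and cont: "continuous_on (convex hull V) h" and inj: "inj_on h (convex hull V)"
    and T: "\<And>W. W \<subseteq> V \<Longrightarrow> W \<noteq> {} \<Longrightarrow> \<exists>n k T. simplex_in n k T \<and> isometric (h ` (convex hull W)) T"
  shows "\<exists>\<psi> :: 'a \<Rightarrow> real^2.
    (\<forall>x\<in>h ` (convex hull V). \<forall>y\<in>h ` (convex hull V). dist (\<psi> x) (\<psi> y) = dist x y) \<and>
    \<psi> ` h ` (convex hull V) = convex hull (\<psi> ` h ` V)"
proof -
  have "card V > 0" using V by (simp add: card_gt_0_iff)
  then consider "card V = 1" | "card V = 2" | "card V = 3" using V(3) by linarith
  then show ?thesis
  proof cases
    case 1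
    then obtain v where v: "V = {v}" by (auto simp: card_1_singleton_iff)
    show ?thesis by (rule exI [of _ "\<lambda>_. 0"]) (simp add: v)
  next
    case 2
    then obtain v w where vw: "V = {v, w}" "v \<noteq> w" by (auto simp: card_2_iff)
    obtain n k T where T': "simplex_in n k T" "isometric (h ` (convex hull V)) T"
      using T [OF order_refl V(4)] by blast
    show ?thesis
    proof (rule edge_chart [OF V(2) [unfolded vw(1)] vw(2) cont [unfolded vw(1)] inj [unfolded vw(1)]
          T'(1) T'(2) [unfolded vw(1)]])
      fix \<psi> :: "'a \<Rightarrow> real^2"
      assume *: "\<And>x y. x \<in> h ` (convex hull {v, w}) \<Longrightarrow> y \<in> h ` (convex hull {v, w}) \<Longrightarrow>
          dist (\<psi> x) (\<psi> y) = dist x y"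
        "\<psi> ` h ` (convex hull {v, w}) = convex hull (\<psi> ` h ` {v, w})"
      show ?thesis unfolding vw(1) by (intro exI [of _ \<psi>] conjI ballI *)
    qed
  next
    case 3
    then obtain u v w where uvw: "V = {u, v, w}" by (auto simp: card_3_iff)
    let ?S = "convex hull V"
    have c23: "card V \<in> {2, 3}" using 3 by simp
    obtain n k T where T': "simplex_in n k T" "isometric (h ` ?S) T"
      using T [OF order_refl V(4)] by blast
    obtain \<psi> :: "'a \<Rightarrow> real^2" and B where \<psi>:
      "\<And>x y. x \<in> h ` ?S \<Longrightarrow> y \<in> h ` ?S \<Longrightarrow> dist (\<psi> x) (\<psi> y) = dist x y"
      "\<psi> ` h ` ?S = convex hull B" "finite B" "card B \<le> card V"
      by (rule isometric_simplex_chart [OF V(1,2) c23 cont inj T']) (rule that)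
    have edges: "(\<lambda>z. \<psi> (h z)) ` (convex hull {x, y}) = convex hull {\<psi> (h x), \<psi> (h y)}"
      if xy: "x \<in> V" "y \<in> V" for x y
    proof (cases "x = y")
      case True
      then show ?thesis by simp
    next
      case False
      have sub: "{x, y} \<subseteq> V" using xy by simp
      have hull: "convex hull {x, y} \<subseteq> ?S" by (rule hull_mono [OF sub])
      have ind: "\<not> affine_dependent {x, y}" using V(2) affine_dependent_subset [OF _ sub] by blast
      obtain n' k' T'' where T'': "simplex_in n' k' T''" "isometric (h ` (convex hull {x, y})) T''"
        using T [OF sub insert_not_empty] by blast
      obtain \<psi>' :: "'a \<Rightarrow> real^2" where \<psi>':
        "\<And>a b. a \<in> h ` (convex hull {x, y}) \<Longrightarrow> b \<in> h ` (convex hull {x, y}) \<Longrightarrow> dist (\<psi>' a) (\<psi>' b) = dist a b"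
        "\<psi>' ` h ` (convex hull {x, y}) = convex hull (\<psi>' ` h ` {x, y})"
        by (rule edge_chart [OF ind False continuous_on_subset [OF cont hull] inj_on_subset [OF inj hull] T''])
          (rule that)
      have "\<psi> ` h ` (convex hull {x, y}) = convex hull (\<psi> ` h ` {x, y})"
      proof (rule isometric_chart_hull [OF _ \<psi>'(1) _ \<psi>'(2)])
        show "dist (\<psi> a) (\<psi> b) = dist a b"
          if "a \<in> h ` (convex hull {x, y})" "b \<in> h ` (convex hull {x, y})" for a b
          by (rule \<psi>(1) [OF subsetD [OF image_mono [OF hull] that(1)]
              subsetD [OF image_mono [OF hull] that(2)]])
        show "h ` {x, y} \<subseteq> h ` (convex hull {x, y})" by (intro image_mono hull_subset)
      qed
      then show ?thesis by (simp add: image_image)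
    qed
    note comp = continuous_isometric_compose [OF cont inj \<psi>(1)]
    have "(\<lambda>z. \<psi> (h z)) ` (convex hull {u, v, w}) = convex hull {\<psi> (h u), \<psi> (h v), \<psi> (h w)}"
    proof (rule triangle_homeo_vertices)
      show "\<not> affine_dependent {u, v, w}" "card {u, v, w} = 3"
        by (fact V(2) [unfolded uvw], fact 3 [unfolded uvw])
      show "continuous_on (convex hull {u, v, w}) (\<lambda>z. \<psi> (h z))"
        using comp(1) unfolding uvw .
      show "inj_on (\<lambda>z. \<psi> (h z)) (convex hull {u, v, w})"
        using comp(2) unfolding uvw .
      have "convex (\<psi> ` h ` ?S)" unfolding \<psi>(2) by (rule convex_convex_hull)
      then show "convex ((\<lambda>z. \<psi> (h z)) ` (convex hull {u, v, w}))"
        unfolding uvw image_image .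
      show "(\<lambda>z. \<psi> (h z)) ` (convex hull {x, y}) = convex hull {\<psi> (h x), \<psi> (h y)}"
        if "x \<in> {u, v, w}" "y \<in> {u, v, w}" for x y
        by (rule edges [unfolded uvw, OF that])
    qed
    then have "\<psi> ` h ` ?S = convex hull (\<psi> ` h ` V)" by (simp add: uvw image_image)
    then show ?thesis using \<psi>(1) by (intro exI [of _ \<psi>] conjI ballI) simp_all
  qed
qed

text \<open>A simplex is encoded by the images of its vertices in the metric space, so incidence
  becomes intersection of finite sets. Dimension two enters as the bound of three vertices.\<close>

lemma polyhedral_triangulation_charts:
  assumes tri: "polyhedral_triangulation_of P K h" and dim: "complex_has_dim K 2"
  obtains \<V> X \<psi> where "euclidean_complex \<V> X \<psi>" "\<Union> (X ` \<V>) = P"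
proof -
  obtain n g where K: "simplicial_complex_in n K" and hom: "homeomorphism (\<Union>K) P h g"
    using tri unfolding polyhedral_triangulation_of_def triangulation_of_def by blast
  have iso: "\<exists>n k T. simplex_in n k T \<and> isometric (h ` S) T" if "S \<in> K" for S
    using tri that unfolding polyhedral_triangulation_of_def by blast
  have gh: "g (h x) = x" if "x \<in> \<Union>K" for x using homeomorphism_apply1 [OF hom that] .
  have injh: "inj_on h (\<Union>K)" by (rule inj_on_inverseI [where g = g]) (rule gh)
  \<comment> \<open>The complex \<open>K\<close> indexed by vertex sets: a simplex determines its
    vertices, so this is one to one.\<close>
  define W where "W = {V. finite V \<and> V \<noteq> {} \<and> \<not> affine_dependent V \<and> convex hull V \<in> K}"
  have W: "finite V" "V \<noteq> {}" "\<not> affine_dependent V" "convex hull V \<in> K" if "V \<in> W" for V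
    using that by (auto simp: W_def)
  have hullK: "convex hull V \<subseteq> \<Union>K" if "V \<in> W" for V using W(4) [OF that] by blast
  have VK: "V \<subseteq> \<Union>K" if "V \<in> W" for V using hullK [OF that] hull_subset [of V convex] by blast
  have finW: "finite W"
  proof (rule inj_on_finite)
    show "inj_on (\<lambda>V. convex hull V) W"
      by (rule inj_onI) (rule independent_hull_inj; simp add: W)
    show "(\<lambda>V. convex hull V) ` W \<subseteq> K" using W(4) by blast
    show "finite K" using K by (simp add: simplicial_complex_in_def)
  qed
  have coverK: "\<exists>V\<in>W. S = convex hull V" if S: "S \<in> K" for S
  proof -
    obtain k where "simplex_in n k S" using K S by (auto simp: simplicial_complex_in_def)
    then obtain V where V: "finite V" "card V = k + 1" "\<not> affine_dependent V" "S = convex hull V"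
      by (auto simp: simplex_in_def)
    then have "V \<noteq> {}" by auto
    then have "V \<in> W" using V S by (simp add: W_def)
    then show ?thesis using V(4) by blast
  qed
  have card3: "card V \<le> 3" if V: "V \<in> W" for V
  proof -
    obtain k where k: "simplex_in n k (convex hull V)"
      using K W(4) [OF V] by (auto simp: simplicial_complex_in_def)
    then obtain V' where V': "finite V'" "card V' = k + 1" "\<not> affine_dependent V'"
      "convex hull V = convex hull V'"
      by (auto simp: simplex_in_def)
    have "V = V'" by (rule independent_hull_inj [OF W(1,3) [OF V] V'(1,3,4)])
    moreover have "k \<le> 2" using dim k W(4) [OF V] by (auto simp: complex_has_dim_def)
    ultimately show ?thesis using V'(2) by simp
  qed
  have faceW: "U \<in> W" if V: "V \<in> W" and U: "U \<subseteq> V" "U \<noteq> {}" for U V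
  proof -
    have "convex hull U face_of convex hull V" by (rule face_of_independent_hull [OF W(1,3) [OF V] U(1)])
    moreover have "convex hull U \<noteq> {}" using U(2) by simp
    ultimately have "convex hull U \<in> K"
      using K W(4) [OF V] unfolding simplicial_complex_in_def by blast
    moreover have "\<not> affine_dependent U" using W(3) [OF V] affine_dependent_subset [OF _ U(1)] by blast
    moreover have "finite U" using W(1) [OF V] U(1) by (rule rev_finite_subset)
    ultimately show ?thesis using U(2) by (simp add: W_def)
  qed
  have IntW: "convex hull U \<inter> convex hull V = convex hull (U \<inter> V)" if "U \<in> W" "V \<in> W" for U V
  proof (rule convex_hull_Int_of_faces)
    show "finite U" "\<not> affine_dependent U" using W that by auto
    show "convex hull U \<inter> convex hull V = {} \<or> convex hull U \<inter> convex hull V face_of convex hull U \<and>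
      convex hull U \<inter> convex hull V face_of convex hull V"
      using K W(4) that unfolding simplicial_complex_in_def by blast
  qed
  define \<V> where "\<V> = (`) h ` W"
  \<comment> \<open>Going back through \<open>g\<close> makes \<open>X\<close> a function of the
    vertex images alone, as the locale demands.\<close>
  define X where "X U = h ` (convex hull (g ` U))" for U
  have gV: "g ` h ` V = V" if "V \<subseteq> \<Union>K" for V
    using that gh by (force simp: image_image)
  have Xh: "X (h ` V) = h ` (convex hull V)" if "V \<subseteq> \<Union>K" for V
    by (simp add: X_def gV [OF that])
  have hV: "h ` V \<subseteq> X (h ` V)" if "V \<in> W" for V
    unfolding Xh [OF VK [OF that]] by (intro image_mono hull_subset)
  define Q where "Q U \<psi> \<longleftrightarrow> (\<forall>x\<in>X U. \<forall>y\<in>X U. dist (\<psi> x) (\<psi> y) = dist x y) \<and>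
    \<psi> ` X U = convex hull (\<psi> ` U)" for U and \<psi> :: "_ \<Rightarrow> real^2"
  have "\<exists>\<psi>. Q U \<psi>" if U: "U \<in> \<V>" for U
  proof -
    obtain V where V: "V \<in> W" "U = h ` V" using U by (auto simp: \<V>_def)
    have "\<exists>\<psi> :: _ \<Rightarrow> real^2.
      (\<forall>x\<in>h ` (convex hull V). \<forall>y\<in>h ` (convex hull V). dist (\<psi> x) (\<psi> y) = dist x y) \<and>
      \<psi> ` h ` (convex hull V) = convex hull (\<psi> ` h ` V)"
    proof (rule simplex_chart)
      show "finite V" "\<not> affine_dependent V" "card V \<le> 3" "V \<noteq> {}"
        using W card3 V(1) by blast+
      show "continuous_on (convex hull V) h"
        by (rule continuous_on_subset [OF homeomorphism_cont1 [OF hom] hullK [OF V(1)]])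
      show "inj_on h (convex hull V)" by (rule inj_on_subset [OF injh hullK [OF V(1)]])
      show "\<exists>n k T. simplex_in n k T \<and> isometric (h ` (convex hull U)) T"
        if "U \<subseteq> V" "U \<noteq> {}" for U
        by (rule iso [OF W(4) [OF faceW [OF V(1) that]]])
    qed
    then show ?thesis unfolding Q_def V(2) Xh [OF VK [OF V(1)]] .
  qed
  then have "\<forall>U\<in>\<V>. \<exists>\<psi>. Q U \<psi>" by (rule ballI)
  from bchoice [OF this] obtain \<psi> where \<psi>: "\<forall>U\<in>\<V>. Q U (\<psi> U)" by blast
  have \<psi>1: "dist (\<psi> U x) (\<psi> U y) = dist x y" if "U \<in> \<V>" "x \<in> X U" "y \<in> X U" for U x y
    using \<psi> that by (simp add: Q_def)
  have \<psi>2: "\<psi> U ` X U = convex hull (\<psi> U ` U)" if "U \<in> \<V>" for U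
    using \<psi> that by (simp add: Q_def)
  have face\<V>: "U' \<in> \<V>" if U: "U \<in> \<V>" "U' \<subseteq> U" "U' \<noteq> {}" for U U'
  proof -
    obtain V where V: "V \<in> W" "U = h ` V" using U(1) by (auto simp: \<V>_def)
    obtain V' where V': "V' \<subseteq> V" "U' = h ` V'" using U(2) V(2) by (auto simp: subset_image_iff)
    have "V' \<in> W" using faceW [OF V(1) V'(1)] U(3) V'(2) by blast
    then show ?thesis using V'(2) by (auto simp: \<V>_def)
  qed
  have XInt: "X U \<inter> X U' = X (U \<inter> U')" if U: "U \<in> \<V>" "U' \<in> \<V>" for U U'
  proof -
    obtain V where V: "V \<in> W" "U = h ` V" using U(1) by (auto simp: \<V>_def)
    obtain V' where V': "V' \<in> W" "U' = h ` V'" using U(2) by (auto simp: \<V>_def)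
    have "X U \<inter> X U' = h ` (convex hull V) \<inter> h ` (convex hull V')"
      unfolding V(2) V'(2) Xh [OF VK [OF V(1)]] Xh [OF VK [OF V'(1)]] ..
    also have "\<dots> = h ` (convex hull V \<inter> convex hull V')"
      by (rule inj_on_image_Int [OF injh hullK [OF V(1)] hullK [OF V'(1)], symmetric])
    also have "\<dots> = h ` (convex hull (V \<inter> V'))" by (simp only: IntW [OF V(1) V'(1)])
    also have "\<dots> = X (h ` (V \<inter> V'))" using VK [OF V(1)] by (intro Xh [symmetric]) blast
    also have "h ` (V \<inter> V') = U \<inter> U'"
      unfolding V(2) V'(2) by (rule inj_on_image_Int [OF injh VK [OF V(1)] VK [OF V'(1)]])
    finally show ?thesis .
  qed
  have Xe: "X {} = {}" by (simp add: X_def)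
  have sub\<V>: "U \<subseteq> X U" if U: "U \<in> \<V>" for U
  proof -
    obtain V where V: "V \<in> W" "U = h ` V" using U(1) by (auto simp: \<V>_def)
    then show ?thesis using hV by simp
  qed
  have "euclidean_complex \<V> X \<psi>"
  proof
    show "finite \<V>" using finW by (simp add: \<V>_def)
    show "finite U \<and> U \<noteq> {} \<and> card U \<le> 3" if U: "U \<in> \<V>" for U
    proof -
      obtain V where V: "V \<in> W" "U = h ` V" using U(1) by (auto simp: \<V>_def)
      then show ?thesis
        using W [OF V(1)] card3 [OF V(1)] card_image_le [OF W(1) [OF V(1)], of h] by auto
    qed
    show "\<psi> U ` X U' = convex hull (\<psi> U ` U')" if U: "U \<in> \<V>" "U' \<subseteq> U" for U U'
    proof (cases "U' = {}")
      case True
      then show ?thesis using Xe by simp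
    next
      case False
      have U': "U' \<in> \<V>" by (rule face\<V> [OF U False])
      have "X U \<inter> X U' = X U'" using XInt [OF U(1) U'] U(2) by (simp add: Int_absorb1)
      then have sub: "X U' \<subseteq> X U" by blast
      show ?thesis
      proof (rule isometric_chart_hull [OF _ \<psi>1 [OF U'] sub\<V> [OF U'] \<psi>2 [OF U']])
        show "dist (\<psi> U x) (\<psi> U y) = dist x y" if "x \<in> X U'" "y \<in> X U'" for x y
          using sub that by (intro \<psi>1 [OF U(1)]) blast+
      qed
    qed
  qed (fact face\<V> XInt Xe \<psi>1 sub\<V>)+
  moreover have "\<Union> (X ` \<V>) = P"
  proof -
    have "\<Union> (X ` \<V>) = (\<Union>V\<in>W. h ` (convex hull V))"
      unfolding \<V>_def image_image using Xh [OF VK] by (intro SUP_cong) simp_all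
    also have "\<dots> = h ` (\<Union>V\<in>W. convex hull V)" by (simp only: image_UN)
    also have "(\<Union>V\<in>W. convex hull V) = \<Union>K" using coverK W(4) by blast
    also have "h ` \<Union>K = P" by (rule homeomorphism_image1 [OF hom])
    finally show ?thesis .
  qed
  ultimately show ?thesis by (rule that)
qed

theorem mainTheorem1:
  fixes P :: "'a::metric_space set"
  assumes "polyhedral_space_of_dim 2 P"
  shows "\<exists>f :: 'a \<Rightarrow> real ^ 2. piecewise_distance_preserving P f"
proof -
  obtain K h where "polyhedral_triangulation_of P K h" "complex_has_dim K 2"
    using assms unfolding polyhedral_space_of_dim_def by blast
  then obtain \<V> X and \<psi> :: "'a set \<Rightarrow> 'a \<Rightarrow> real^2" where
    cx: "euclidean_complex \<V> X \<psi>" and P: "\<Union> (X ` \<V>) = P"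
    by (rule polyhedral_triangulation_charts)
  show ?thesis
  proof (rule euclidean_complex.fold_subdivision [OF cx], unfold P)
    fix T :: "(real \<times> real \<times> real \<times> real \<times> real) set set" and \<eta> and f :: "'a \<Rightarrow> real^2"
    assume T: "simplicial_complex T" "continuous_on (\<Union>T) \<eta>" "inj_on \<eta> (\<Union>T)" "\<eta> ` \<Union>T = P"
      "\<And>S x y. S \<in> T \<Longrightarrow> x \<in> S \<Longrightarrow> y \<in> S \<Longrightarrow> dist (f (\<eta> x)) (f (\<eta> y)) = dist (\<eta> x) (\<eta> y)"
      "\<And>S. S \<in> T \<Longrightarrow> \<exists>h (c :: real^2). linear h \<and> inj_on (\<lambda>x. h x + c) S \<and>
        (\<forall>x\<in>S. \<forall>y\<in>S. dist (h x + c) (h y + c) = dist (\<eta> x) (\<eta> y))"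
    show ?thesis
      by (rule exI [of _ f], rule piecewise_distance_preserving_transfer [OF T])
  qed
qed

end
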